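(* Let $\sigma_X,\sigma_Y>0$, $D\ge0$, and let $R$ be a (finite) rate with $R>R_{\mathrm{ID}}\big(D,N(0,\sigma_X^2),N(0,\sigma_Y^2)\big)$. Then there exists a single sequence of $D$-admissible, rate-$R$ identification systems $(T^{(n)},g^{(n)})$, $(T^{(n)},g^{(n)})$ having blocklength $n$, such that for all zero-mean probability distributions $P_{\tilde X}$ and $P_{\tilde Y}$ on $\mathbb{R}$ with variances $\sigma_X^2$ and $\sigma_Y^2$, respectively (in particular for $P_{\tilde X}=N(0,\sigma_X^2)$, $P_{\tilde Y}=N(0,\sigma_Y^2)$), $$\lim_{n\to\infty}\Pr\left\{g^{(n)}\big(T^{(n)}(\tilde{\mathbf{X}}),\tilde{\mathbf{Y}}\big)=\mathtt{maybe}\right\}=0,$$ where $(\tilde{\mathbf{X}},\tilde{\mathbf{Y}})\sim\prod_{i=1}^nP_{\tilde X}(\tilde x_i)P_{\tilde Y}(\tilde y_i)$. (The sequence of systems depends on $\sigma_X,\sigma_Y,D,R$ but not on $P_{\tilde X},P_{\tilde Y}$.)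
   Context: $N(\mu,\sigma^2)$ is the Gaussian distribution on $\mathbb{R}$ with mean $\mu$ and variance $\sigma^2$. For $\mathbf{x},\mathbf{y}\in\mathbb{R}^n$ put $d(\mathbf{x},\mathbf{y})=\frac1n\|\mathbf{x}-\mathbf{y}\|^2$ (Euclidean norm). A rate-$R$ identification system of blocklength $n$ is a pair $(T,g)$ of (measurable) maps $T:\mathbb{R}^n\to\{1,2,\dots,2^{nR}\}$ and $g:\{1,2,\dots,2^{nR}\}\times\mathbb{R}^n\to\{\mathtt{no},\mathtt{maybe}\}$; here $\{1,\dots,2^{nR}\}$ means the integers $i$ with $1\le i\le 2^{nR}$. It is $D$-admissible if $g(T(\mathbf{x}),\mathbf{y})=\mathtt{maybe}$ whenever $d(\mathbf{x},\mathbf{y})\le D$. Given distributions $P_X,P_Y$ on $\mathbb{R}$, let $\mathbf{X},\mathbf{Y}$ be independent random vectors in $\mathbb{R}^n$ with i.i.d. entries of law $P_X$ and $P_Y$ respectively. A rate $R$ is $D$-achievable if there is a sequence of rate-$R$ $D$-admissible systems $(T^{(n)},g^{(n)})$ of blocklength $n$ with $\lim_{n\to\infty}\Pr\{g^{(n)}(T^{(n)}(\mathbf{X}),\mathbf{Y})=\mathtt{maybe}\}=0$; $R_{\mathrm{ID}}(D,P_X,P_Y)$ is the infimum of all $D$-achievable rates ($\infty$ if there are none). *)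

theory Defs
  imports "HOL-Probability.Probability"
begin

text \<open>
  Since the blocklength varies, a vector of length \<open>n\<close> is an extensional function
  on \<open>{..<n}\<close>, i.e. a point of the product Borel space \<open>Rvec n\<close>.
\<close>

abbreviation Rvec :: "nat \<Rightarrow> (nat \<Rightarrow> real) measure" where
  "Rvec n \<equiv> (\<Pi>\<^sub>M i\<in>{..<n}. borel)"

definition distortion :: "nat \<Rightarrow> (nat \<Rightarrow> real) \<Rightarrow> (nat \<Rightarrow> real) \<Rightarrow> real" where
  "distortion n x y = (1 / real n) * (L2_set (\<lambda>i. x i - y i) {..<n})\<^sup>2"

datatype answer = No | Maybe

text \<open>Empty for \<open>R < 0\<close>, \<open>n \<ge> 1\<close>, so that there are no systems of negative rate.\<close>

definition indices :: "real \<Rightarrow> nat \<Rightarrow> nat set" where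
  "indices R n = {i. 1 \<le> i \<and> real i \<le> 2 powr (real n * R)}"

definition id_system ::
  "real \<Rightarrow> nat \<Rightarrow> ((nat \<Rightarrow> real) \<Rightarrow> nat) \<Rightarrow> (nat \<Rightarrow> (nat \<Rightarrow> real) \<Rightarrow> answer) \<Rightarrow> bool" where
  "id_system R n T g \<longleftrightarrow>
     T \<in> measurable (Rvec n) (count_space (indices R n)) \<and>
     (\<lambda>(i, y). g i y) \<in> measurable (count_space (indices R n) \<Otimes>\<^sub>M Rvec n) (count_space UNIV)"

definition admissible ::
  "real \<Rightarrow> nat \<Rightarrow> ((nat \<Rightarrow> real) \<Rightarrow> nat) \<Rightarrow> (nat \<Rightarrow> (nat \<Rightarrow> real) \<Rightarrow> answer) \<Rightarrow> bool" where
  "admissible D n T g \<longleftrightarrow>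
     (\<forall>x\<in>space (Rvec n). \<forall>y\<in>space (Rvec n). distortion n x y \<le> D \<longrightarrow> g (T x) y = Maybe)"

text \<open>Blocklengths are positive; the values at \<open>n = 0\<close> are irrelevant.\<close>

definition admissible_systems ::
  "real \<Rightarrow> real \<Rightarrow> (nat \<Rightarrow> (nat \<Rightarrow> real) \<Rightarrow> nat) \<Rightarrow>
   (nat \<Rightarrow> nat \<Rightarrow> (nat \<Rightarrow> real) \<Rightarrow> answer) \<Rightarrow> bool" where
  "admissible_systems D R T g \<longleftrightarrow>
     (\<forall>n\<ge>1. id_system R n (T n) (g n) \<and> admissible D n (T n) (g n))"

definition maybe_prob ::
  "real measure \<Rightarrow> real measure \<Rightarrow> nat \<Rightarrow> ((nat \<Rightarrow> real) \<Rightarrow> nat) \<Rightarrow>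
   (nat \<Rightarrow> (nat \<Rightarrow> real) \<Rightarrow> answer) \<Rightarrow> real" where
  "maybe_prob PX PY n T g =
     (let M = (\<Pi>\<^sub>M i\<in>{..<n}. PX) \<Otimes>\<^sub>M (\<Pi>\<^sub>M i\<in>{..<n}. PY)
      in measure M {(x, y) \<in> space M. g (T x) y = Maybe})"

definition achievable :: "real \<Rightarrow> real measure \<Rightarrow> real measure \<Rightarrow> real \<Rightarrow> bool" where
  "achievable D PX PY R \<longleftrightarrow>
     (\<exists>T g. admissible_systems D R T g \<and>
            (\<lambda>n. maybe_prob PX PY n (T n) (g n)) \<longlonglongrightarrow> 0)"

definition R_ID :: "real \<Rightarrow> real measure \<Rightarrow> real measure \<Rightarrow> ereal" where
  "R_ID D PX PY = Inf (ereal ` {R. achievable D PX PY R})"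

text \<open>The second parameter is the variance \<open>v > 0\<close>; \<open>normal_density\<close> takes the standard deviation.\<close>

definition gaussian :: "real \<Rightarrow> real \<Rightarrow> real measure" where
  "gaussian \<mu> v = density lborel (\<lambda>x. ennreal (normal_density \<mu> (sqrt v) x))"

definition has_mean_variance :: "real measure \<Rightarrow> real \<Rightarrow> real \<Rightarrow> bool" where
  "has_mean_variance P \<mu> v \<longleftrightarrow>
     integrable P (\<lambda>x. x) \<and> (LINT x|P. x) = \<mu> \<and>
     integrable P (\<lambda>x. (x - \<mu>)\<^sup>2) \<and> (LINT x|P. (x - \<mu>)\<^sup>2) = v"

end

theory Submission
  imports Defs "HOL-Real_Asymp.Real_Asymp"
begin

text \<open>
  Put \<open>\<kappa> = (\<sigma>X\<^sup>2 + \<sigma>Y\<^sup>2 - D) / (2 \<sigma>X \<sigma>Y)\<close>. Vectors \<open>x\<close>, \<open>y\<close> with \<open>\<bar>x\<bar>\<^sup>2 \<approx> n \<sigma>X\<^sup>2\<close> and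
  \<open>\<bar>y\<bar>\<^sup>2 \<approx> n \<sigma>Y\<^sup>2\<close> are similar only if their inner product is at least about \<open>\<kappa> n \<sigma>X \<sigma>Y\<close>.

  Every \<open>R > 0\<close> with \<open>2 powr (- R) < \<kappa>\<close> is achieved by one universal scheme. Let
  \<open>2 powr (- R) < r < min 1 \<kappa>\<close>, and cover the ball of radius about \<open>\<sigma>X sqrt n\<close> by fewer than
  \<open>2 powr (n R)\<close> balls of radius \<open>r\<close> times as large. If \<open>x\<close> lies in the ball with centre \<open>u\<close> and the
  inner product of \<open>u\<close> and \<open>y\<close> is \<open>o(n)\<close>, then that of \<open>x\<close> and \<open>y\<close> is at most
  \<open>o(n) + r n \<sigma>X \<sigma>Y\<close>, so that \<open>x\<close> and \<open>y\<close> are not similar. By Chebyshev's inequality the inner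
  product with any fixed \<open>u\<close> of length \<open>O(sqrt n)\<close> is \<open>o(n)\<close> for most \<open>y\<close>, and this uses
  nothing but the mean and the variance of the entries of \<open>y\<close>.

  Conversely, a scheme for Gaussian sources has a set \<open>A\<close> of vectors with a common index, of
  Gaussian measure about \<open>2 powr (- n R)\<close>, and a set \<open>B\<close> of measure at least one half none of whose
  members is similar to a member of \<open>A\<close>. Since inner products between \<open>A\<close> and \<open>B\<close> are at most about
  \<open>\<kappa> n \<sigma>X \<sigma>Y\<close>, the set \<open>s A + t B\<close> lies in a small ball, and the Brunn--Minkowski inequality with
  \<open>s / t\<close> tending to \<open>0\<close> gives \<open>2 powr (- R) \<le> \<kappa>\<close>.
\<close>

section \<open>Product measures\<close>

text \<open>The source laws are known only through two moments, so no exponential tail bound is at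
  hand, while a system has exponentially many indices. A union bound over the cells must be avoided:
  the covering is deterministic and misses no vector of the ball, and given \<open>x\<close> only
  the cell of \<open>x\<close> matters, so a failure probability that is small for each centre
  separately is enough.

  In the converse, scale both sources to unit variance, take weights \<open>p\<close> and
  \<open>1\<close>, and put \<open>Q = 2 powr (- R)\<close>. The volumes bound the radius of the sum
  set, per \<open>sqrt n\<close>, from below by about \<open>1 + p * Q\<close>; the inner products
  bound its square from above by about \<open>1 + 2 * p * \<kappa> + p^2\<close>. Comparing the
  terms linear in \<open>p\<close> gives \<open>Q \<le> \<kappa>\<close>; the quadratic ones are an
  error, so \<open>p\<close> must be small. The functional inequality replaces the one for sets
  because marginals of indicators are not indicators, so an induction on the coordinates needs
  functions.

  Both directions meet at \<kappa>, so the identification rate of the Gaussian pair never has to be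
  computed.\<close>

lemma PiM_density:
  fixes M :: "'i \<Rightarrow> 'a measure" and f :: "'i \<Rightarrow> 'a \<Rightarrow> ennreal"
  assumes "finite I" and sf: "\<And>i. sigma_finite_measure (M i)"
    and sfd: "\<And>i. sigma_finite_measure (density (M i) (f i))"
    and f [measurable]: "\<And>i. f i \<in> borel_measurable (M i)"
  shows "(\<Pi>\<^sub>M i\<in>I. density (M i) (f i)) = density (\<Pi>\<^sub>M i\<in>I. M i) (\<lambda>x. \<Prod>i\<in>I. f i (x i))"
proof -
  interpret M: product_sigma_finite M by (rule product_sigma_finite.intro) (rule sf)
  interpret D: product_sigma_finite "\<lambda>i. density (M i) (f i)"
    by (rule product_sigma_finite.intro) (rule sfd)
  show ?thesis
  proof (rule D.PiM_eqI[symmetric])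
    fix A assume "\<And>i. i \<in> I \<Longrightarrow> A i \<in> sets (density (M i) (f i))"
    then have A [measurable]: "\<And>i. i \<in> I \<Longrightarrow> A i \<in> sets (M i)" by simp
    have "emeasure (density (\<Pi>\<^sub>M i\<in>I. M i) (\<lambda>x. \<Prod>i\<in>I. f i (x i))) (Pi\<^sub>E I A)
        = (\<integral>\<^sup>+x. (\<Prod>i\<in>I. f i (x i)) * indicator (Pi\<^sub>E I A) x \<partial>Pi\<^sub>M I M)"
      using \<open>finite I\<close> A by (intro emeasure_density) (auto intro!: sets_PiM_I_finite)
    also have "\<dots> = (\<integral>\<^sup>+x. (\<Prod>i\<in>I. f i (x i) * indicator (A i) (x i)) \<partial>Pi\<^sub>M I M)"
    proof (rule nn_integral_cong)
      fix x assume "x \<in> space (Pi\<^sub>M I M)"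
      then have "x \<in> extensional I" by (auto simp: space_PiM PiE_def)
      then have "indicator (Pi\<^sub>E I A) x = (\<Prod>i\<in>I. indicator (A i) (x i) :: ennreal)"
        using \<open>finite I\<close> by (cases "x \<in> Pi I A")
          (auto simp: PiE_def Pi_iff indicator_def prod_zero_iff intro!: prod.neutral[symmetric])
      then show "(\<Prod>i\<in>I. f i (x i)) * indicator (Pi\<^sub>E I A) x
          = (\<Prod>i\<in>I. f i (x i) * indicator (A i) (x i))"
        by (simp add: prod.distrib)
    qed
    also have "\<dots> = (\<Prod>i\<in>I. \<integral>\<^sup>+x. f i x * indicator (A i) x \<partial>M i)"
      using \<open>finite I\<close> A by (intro M.product_nn_integral_prod) auto
    also have "\<dots> = (\<Prod>i\<in>I. emeasure (density (M i) (f i)) (A i))"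
      using A by (intro prod.cong) (auto simp: emeasure_density)
    finally show "emeasure (density (\<Pi>\<^sub>M i\<in>I. M i) (\<lambda>x. \<Prod>i\<in>I. f i (x i))) (Pi\<^sub>E I A)
        = (\<Prod>i\<in>I. emeasure (density (M i) (f i)) (A i))" .
  qed (use \<open>finite I\<close> in \<open>auto intro!: sets_PiM_cong\<close>)
qed

text \<open>Centred independent coordinates are orthogonal: an off-diagonal term of the expanded
  square factors over the coordinates and contains a factor of mean zero.\<close>

lemma
  fixes M :: "'i \<Rightarrow> 'a measure" and f :: "'i \<Rightarrow> 'a \<Rightarrow> real"
  assumes "finite I" and ps: "\<And>i. prob_space (M i)"
    and int: "\<And>i. i \<in> I \<Longrightarrow> integrable (M i) (f i)"
    and mean: "\<And>i. i \<in> I \<Longrightarrow> (\<integral>x. f i x \<partial>M i) = 0"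
    and int2: "\<And>i. i \<in> I \<Longrightarrow> integrable (M i) (\<lambda>x. (f i x)\<^sup>2)"
  shows integrable_PiM_sum_square: "integrable (Pi\<^sub>M I M) (\<lambda>x. (\<Sum>i\<in>I. f i (x i))\<^sup>2)"
    and integral_PiM_sum_square:
      "(\<integral>x. (\<Sum>i\<in>I. f i (x i))\<^sup>2 \<partial>Pi\<^sub>M I M) = (\<Sum>i\<in>I. \<integral>x. (f i x)\<^sup>2 \<partial>M i)"
proof -
  interpret product_prob_space M by (rule product_prob_spaceI) (rule ps)
  \<comment> \<open>Writes \<open>f i * f j\<close> as a product over all of \<open>I\<close> of
    functions of one coordinate each, the form that \<open>product_integral_prod\<close> needs; for
    \<open>i = j\<close> the two factors merge into a square.\<close>
  define g where "g = (\<lambda>i j k x. if k = i \<and> k = j then (f k x)\<^sup>2 else if k = i \<or> k = j then f k x else 1)"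
  have g_int: "integrable (M k) (g i j k)" if "k \<in> I" for i j k
    using that int int2 by (cases "k = i"; cases "k = j") (auto simp: g_def)
  have g_prod: "f i (x i) * f j (x j) = (\<Prod>k\<in>I. g i j k (x k))" if "i \<in> I" "j \<in> I" for i j x
  proof (cases "i = j")
    case True
    have "(\<Prod>k\<in>I. g i j k (x k)) = (\<Prod>k\<in>I. if k = i then (f k (x k))\<^sup>2 else 1)"
      using True by (intro prod.cong) (auto simp: g_def)
    then show ?thesis
      using True that \<open>finite I\<close> by (simp add: power2_eq_square)
  next
    case False
    have "(\<Prod>k\<in>I. g i j k (x k))
        = (\<Prod>k\<in>I. (if k = i then f k (x k) else 1) * (if k = j then f k (x k) else 1))"
      using False by (intro prod.cong) (auto simp: g_def)
    then show ?thesis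
      using False that \<open>finite I\<close> by (simp add: prod.distrib)
  qed
  have int_prod: "integrable (Pi\<^sub>M I M) (\<lambda>x. f i (x i) * f j (x j))" if "i \<in> I" "j \<in> I" for i j
    unfolding g_prod[OF that] by (rule product_integrable_prod) (use g_int \<open>finite I\<close> in auto)
  have eq_prod: "(\<integral>x. f i (x i) * f j (x j) \<partial>Pi\<^sub>M I M) = (if i = j then \<integral>x. (f i x)\<^sup>2 \<partial>M i else 0)"
    if "i \<in> I" "j \<in> I" for i j
  proof -
    have *: "(\<integral>x. f i (x i) * f j (x j) \<partial>Pi\<^sub>M I M) = (\<Prod>k\<in>I. \<integral>x. g i j k x \<partial>M k)"
      unfolding g_prod[OF that] by (rule product_integral_prod) (use g_int \<open>finite I\<close> in auto)
    show ?thesis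
    proof (cases "i = j")
      case True
      have "(\<Prod>k\<in>I. \<integral>x. g i j k x \<partial>M k) = (\<Prod>k\<in>I. if k = i then \<integral>x. (f k x)\<^sup>2 \<partial>M k else 1)"
        using True by (intro prod.cong) (auto simp: g_def M.prob_space)
      then show ?thesis using * True that \<open>finite I\<close> by simp
    next
      case False
      have "(\<integral>x. g i j i x \<partial>M i) = 0"
        using False mean that by (simp add: g_def)
      then show ?thesis using * False that \<open>finite I\<close> by (auto simp: prod_zero_iff)
    qed
  qed
  have sq: "(\<Sum>i\<in>I. f i (x i))\<^sup>2 = (\<Sum>i\<in>I. \<Sum>j\<in>I. f i (x i) * f j (x j))" for x
    by (simp add: power2_eq_square sum_product)
  show "integrable (Pi\<^sub>M I M) (\<lambda>x. (\<Sum>i\<in>I. f i (x i))\<^sup>2)"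
    unfolding sq by (intro Bochner_Integration.integrable_sum int_prod)
  have "(\<integral>x. (\<Sum>i\<in>I. f i (x i))\<^sup>2 \<partial>Pi\<^sub>M I M)
      = (\<Sum>i\<in>I. \<Sum>j\<in>I. \<integral>x. f i (x i) * f j (x j) \<partial>Pi\<^sub>M I M)"
    unfolding sq by (simp add: Bochner_Integration.integral_sum Bochner_Integration.integrable_sum int_prod)
  also have "\<dots> = (\<Sum>i\<in>I. \<Sum>j\<in>I. if i = j then \<integral>x. (f i x)\<^sup>2 \<partial>M i else 0)"
    by (intro sum.cong refl eq_prod)
  also have "\<dots> = (\<Sum>i\<in>I. \<integral>x. (f i x)\<^sup>2 \<partial>M i)"
    using \<open>finite I\<close> by simp
  finally show "(\<integral>x. (\<Sum>i\<in>I. f i (x i))\<^sup>2 \<partial>Pi\<^sub>M I M) = (\<Sum>i\<in>I. \<integral>x. (f i x)\<^sup>2 \<partial>M i)" .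
qed

text \<open>Both \<open>f\<close> and the law may vary with the coordinate: this serves inner
  products with a fixed vector as well as Gaussian products whose mean is a given vector.\<close>

lemma chebyshev_PiM:
  fixes M :: "'i \<Rightarrow> 'a measure" and f :: "'i \<Rightarrow> 'a \<Rightarrow> real"
  assumes "finite I" and ps: "\<And>i. prob_space (M i)"
    and int: "\<And>i. i \<in> I \<Longrightarrow> integrable (M i) (f i)"
    and mean: "\<And>i. i \<in> I \<Longrightarrow> (\<integral>x. f i x \<partial>M i) = 0"
    and int2: "\<And>i. i \<in> I \<Longrightarrow> integrable (M i) (\<lambda>x. (f i x)\<^sup>2)"
    and "a > 0" and V: "(\<Sum>i\<in>I. \<integral>x. (f i x)\<^sup>2 \<partial>M i) \<le> V"
  shows "measure (Pi\<^sub>M I M) {x \<in> space (Pi\<^sub>M I M). a \<le> \<bar>\<Sum>i\<in>I. f i (x i)\<bar>} \<le> V / a\<^sup>2"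
proof -
  have "measure (Pi\<^sub>M I M) {x \<in> space (Pi\<^sub>M I M). a\<^sup>2 \<le> (\<Sum>i\<in>I. f i (x i))\<^sup>2}
      \<le> (\<integral>x. (\<Sum>i\<in>I. f i (x i))\<^sup>2 \<partial>Pi\<^sub>M I M) / a\<^sup>2"
    using \<open>a > 0\<close> by (intro integral_Markov_inequality_measure[where A="{}"])
      (auto intro!: integrable_PiM_sum_square assms)
  also have "\<dots> \<le> V / a\<^sup>2"
    using V by (subst integral_PiM_sum_square) (auto intro!: assms divide_right_mono)
  finally show ?thesis
    using \<open>a > 0\<close> by (simp add: abs_le_square_iff[symmetric])
qed

text \<open>It will be applied to squares of entries whose fourth moment may be infinite, so
  Chebyshev's inequality alone does not suffice. Truncation splits the centred \<open>f\<close> into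
  a bounded part \<open>g\<close>, handled by Chebyshev, and a part \<open>h\<close> of small mean
  absolute value, handled by Markov.\<close>

lemma weak_law_PiM:
  fixes P :: "'a measure" and f :: "'a \<Rightarrow> real"
  assumes "prob_space P" and int: "integrable P f" and "\<epsilon> > 0"
  shows "(\<lambda>n. measure (\<Pi>\<^sub>M i\<in>{..<n}. P)
            {x \<in> space (\<Pi>\<^sub>M i\<in>{..<n}. P). real n * \<epsilon> \<le> \<bar>(\<Sum>i<n. f (x i)) - real n * (\<integral>x. f x \<partial>P)\<bar>})
          \<longlonglongrightarrow> 0"
proof (rule LIMSEQ_I)
  interpret prob_space P by fact
  fix \<eta> :: real assume "\<eta> > 0"
  define c where "c K x = max (- real K) (min (real K) (f x))" for K :: nat and x
  have [measurable]: "f \<in> borel_measurable P" using int by simp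
  have c_meas [measurable]: "c K \<in> borel_measurable P" for K
    unfolding c_def by measurable
  have c_le: "\<bar>c K x\<bar> \<le> \<bar>f x\<bar>" "\<bar>c K x\<bar> \<le> real K" for K x
    by (auto simp: c_def)
  have c_int: "integrable P (c K)" for K
    by (rule Bochner_Integration.integrable_bound[OF int]) (use c_le in auto)
  have "(\<lambda>K. \<integral>x. \<bar>f x - c K x\<bar> \<partial>P) \<longlonglongrightarrow> (\<integral>x. 0 \<partial>P)"
  proof (rule integral_dominated_convergence[where w="\<lambda>x. 2 * \<bar>f x\<bar>"])
    show "AE x in P. (\<lambda>K. \<bar>f x - c K x\<bar>) \<longlonglongrightarrow> 0"
    proof (rule AE_I2)
      fix x
      have "eventually (\<lambda>K. \<bar>f x\<bar> \<le> real K) sequentially"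
        using eventually_ge_at_top[of "nat \<lceil>\<bar>f x\<bar>\<rceil>"] by eventually_elim linarith
      then have "eventually (\<lambda>K. \<bar>f x - c K x\<bar> = 0) sequentially"
        by eventually_elim (auto simp: c_def)
      then show "(\<lambda>K. \<bar>f x - c K x\<bar>) \<longlonglongrightarrow> 0"
        by (rule tendsto_eventually)
    qed
    show "AE x in P. norm \<bar>f x - c K x\<bar> \<le> 2 * \<bar>f x\<bar>" for K
      using c_le(1)[of K] by (auto intro!: AE_I2 simp: abs_if split: if_splits) (smt (verit))+
  qed (use int in auto)
  \<comment> \<open>Centring at most doubles the mean absolute value, to
    \<open>\<eta> * \<epsilon> / 4\<close>; Markov's inequality at level
    \<open>n * \<epsilon> / 2\<close> then costs \<open>\<eta> / 2\<close>.\<close>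
  then have "\<exists>K. (\<integral>x. \<bar>f x - c K x\<bar> \<partial>P) < \<eta> * \<epsilon> / 8"
    using \<open>\<eta> > 0\<close> \<open>\<epsilon> > 0\<close> order_tendstoD(2)[of _ 0 sequentially "\<eta> * \<epsilon> / 8"]
    by (force simp: eventually_sequentially)
  then obtain K where K: "(\<integral>x. \<bar>f x - c K x\<bar> \<partial>P) < \<eta> * \<epsilon> / 8" ..
  define g where "g x = c K x - (\<integral>x. c K x \<partial>P)" for x
  define h where "h x = (f x - c K x) - (\<integral>x. f x - c K x \<partial>P)" for x
  have fgh: "f x - (\<integral>x. f x \<partial>P) = g x + h x" for x
    using int c_int by (simp add: g_def h_def)
  have g_int: "integrable P g" "(\<integral>x. g x \<partial>P) = 0"
    unfolding g_def using c_int by (auto simp: prob_space)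
  have "\<bar>\<integral>x. c K x \<partial>P\<bar> \<le> real K"
  proof -
    have "\<bar>\<integral>x. c K x \<partial>P\<bar> \<le> (\<integral>x. \<bar>c K x\<bar> \<partial>P)"
      by (rule integral_abs_bound)
    also have "\<dots> \<le> (\<integral>x. real K \<partial>P)"
      by (intro integral_mono) (use c_int c_le in auto)
    finally show ?thesis by (simp add: prob_space)
  qed
  then have g_le: "\<bar>g x\<bar> \<le> 2 * real K" for x
    using c_le(2)[of K x] by (simp add: g_def)
  have g_le2: "(g x)\<^sup>2 \<le> (2 * real K)\<^sup>2" for x
    using g_le[of x] by (metis abs_ge_zero power2_abs power_mono)
  have g2_int: "integrable P (\<lambda>x. (g x)\<^sup>2)"
    using g_le2 g_int(1) by (intro integrable_const_bound[of _ "(2 * real K)\<^sup>2"]) auto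
  have g2: "(\<integral>x. (g x)\<^sup>2 \<partial>P) \<le> (2 * real K)\<^sup>2"
    using integral_mono[OF g2_int _ g_le2] by (simp add: prob_space)
  have h_int: "integrable P h"
    unfolding h_def using int c_int by auto
  have h_le: "(\<integral>x. \<bar>h x\<bar> \<partial>P) \<le> \<eta> * \<epsilon> / 4"
  proof -
    have "(\<integral>x. \<bar>h x\<bar> \<partial>P) \<le> (\<integral>x. \<bar>f x - c K x\<bar> + \<bar>\<integral>x. f x - c K x \<partial>P\<bar> \<partial>P)"
      by (intro integral_mono) (use int c_int h_int in \<open>auto simp: h_def\<close>)
    also have "\<dots> = (\<integral>x. \<bar>f x - c K x\<bar> \<partial>P) + \<bar>\<integral>x. f x - c K x \<partial>P\<bar>"
      using int c_int by (simp add: prob_space)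
    also have "\<dots> \<le> 2 * (\<integral>x. \<bar>f x - c K x\<bar> \<partial>P)"
      using integral_abs_bound[of P "\<lambda>x. f x - c K x"] by simp
    finally show ?thesis using K by simp
  qed
  define V where "V = (2 * real K)\<^sup>2"
  have bound: "measure (\<Pi>\<^sub>M i\<in>{..<n}. P)
            {x \<in> space (\<Pi>\<^sub>M i\<in>{..<n}. P). real n * \<epsilon> \<le> \<bar>(\<Sum>i<n. f (x i)) - real n * (\<integral>x. f x \<partial>P)\<bar>}
         \<le> 4 * V / \<epsilon>\<^sup>2 * (1 / real n) + \<eta> / 2" if "n > 0" for n
  proof -
    let ?P = "\<Pi>\<^sub>M i\<in>{..<n}. P"
    interpret PP: product_prob_space "\<lambda>_. P" "{..<n}" by unfold_locales
    define G where "G = {x \<in> space ?P. real n * \<epsilon> / 2 \<le> \<bar>\<Sum>i<n. g (x i)\<bar>}"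
    define E where "E = {x \<in> space ?P. real n * \<epsilon> / 2 \<le> (\<Sum>i<n. \<bar>h (x i)\<bar>)}"
    have [measurable]: "g \<in> borel_measurable P" "h \<in> borel_measurable P"
      using g_int h_int by auto
    have comp: "integrable ?P (\<lambda>x. \<bar>h (x i)\<bar>)" "(\<integral>x. \<bar>h (x i)\<bar> \<partial>?P) = (\<integral>x. \<bar>h x\<bar> \<partial>P)" if "i < n" for i
    proof -
      have d: "distr ?P P (\<lambda>x. x i) = P"
        using that by (intro distr_PiM_component) (auto intro: prob_space_axioms)
      have m: "(\<lambda>x. x i) \<in> ?P \<rightarrow>\<^sub>M P" using that by simp
      show "integrable ?P (\<lambda>x. \<bar>h (x i)\<bar>)"
        using integrable_distr[OF m, of "\<lambda>y. \<bar>h y\<bar>"] d h_int by simp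
      show "(\<integral>x. \<bar>h (x i)\<bar> \<partial>?P) = (\<integral>x. \<bar>h x\<bar> \<partial>P)"
        using integral_distr[OF m, of "\<lambda>y. \<bar>h y\<bar>"] d by simp
    qed
    have "measure ?P {x \<in> space ?P. real n * \<epsilon> \<le> \<bar>(\<Sum>i<n. f (x i)) - real n * (\<integral>x. f x \<partial>P)\<bar>}
        \<le> measure ?P (G \<union> E)"
    proof (rule PP.finite_measure_mono)
      show "G \<union> E \<in> sets ?P" unfolding G_def E_def by measurable
      have "real n * \<epsilon> \<le> \<bar>\<Sum>i<n. g (x i)\<bar> + (\<Sum>i<n. \<bar>h (x i)\<bar>)"
        if "real n * \<epsilon> \<le> \<bar>(\<Sum>i<n. f (x i)) - real n * (\<integral>x. f x \<partial>P)\<bar>" for x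
      proof -
        have "(\<Sum>i<n. f (x i)) - real n * (\<integral>x. f x \<partial>P) = (\<Sum>i<n. f (x i) - (\<integral>x. f x \<partial>P))"
          by (simp add: sum_subtractf)
        also have "\<dots> = (\<Sum>i<n. g (x i)) + (\<Sum>i<n. h (x i))"
          unfolding fgh by (simp add: sum.distrib)
        finally show ?thesis
          using that sum_abs[of "\<lambda>i. h (x i)" "{..<n}"] by linarith
      qed
      then show "{x \<in> space ?P. real n * \<epsilon> \<le> \<bar>(\<Sum>i<n. f (x i)) - real n * (\<integral>x. f x \<partial>P)\<bar>} \<subseteq> G \<union> E"
        unfolding G_def E_def by fastforce
    qed
    also have "\<dots> \<le> measure ?P G + measure ?P E"
      unfolding G_def E_def by (intro measure_Un_le) measurable
    also have "measure ?P G \<le> (real n * V) / (real n * \<epsilon> / 2)\<^sup>2"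
      unfolding G_def using g_int g2_int g2 \<open>n > 0\<close> \<open>\<epsilon> > 0\<close>
      by (intro chebyshev_PiM) (auto simp: prob_space_axioms V_def mult_left_mono)
    also have "(real n * V) / (real n * \<epsilon> / 2)\<^sup>2 = 4 * V / \<epsilon>\<^sup>2 * (1 / real n)"
      using \<open>n > 0\<close> by (simp add: field_simps power2_eq_square)
    also have "measure ?P E \<le> (\<integral>x. (\<Sum>i<n. \<bar>h (x i)\<bar>) \<partial>?P) / (real n * \<epsilon> / 2)"
      unfolding E_def using \<open>n > 0\<close> \<open>\<epsilon> > 0\<close> comp
      by (intro integral_Markov_inequality_measure[where A="{}"]) (auto intro!: sum_nonneg)
    also have "(\<integral>x. (\<Sum>i<n. \<bar>h (x i)\<bar>) \<partial>?P) = real n * (\<integral>x. \<bar>h x\<bar> \<partial>P)"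
      using comp by (simp add: Bochner_Integration.integral_sum)
    also have "real n * (\<integral>x. \<bar>h x\<bar> \<partial>P) / (real n * \<epsilon> / 2) \<le> \<eta> / 2"
      using \<open>n > 0\<close> \<open>\<epsilon> > 0\<close> h_le by (simp add: field_simps)
    finally show ?thesis by simp
  qed
  have lim: "(\<lambda>n. 4 * V / \<epsilon>\<^sup>2 * (1 / real n) + \<eta> / 2) \<longlonglongrightarrow> 4 * V / \<epsilon>\<^sup>2 * 0 + \<eta> / 2"
    by (intro tendsto_intros lim_1_over_n)
  have "eventually (\<lambda>n. 4 * V / \<epsilon>\<^sup>2 * (1 / real n) + \<eta> / 2 < \<eta>) sequentially"
    by (rule order_tendstoD(2)[OF lim]) (use \<open>\<eta> > 0\<close> in simp)
  then obtain n0 where n0: "\<And>n. n \<ge> n0 \<Longrightarrow> 4 * V / \<epsilon>\<^sup>2 * (1 / real n) + \<eta> / 2 < \<eta>"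
    by (auto simp: eventually_sequentially)
  show "\<exists>n0. \<forall>n\<ge>n0. norm (measure (\<Pi>\<^sub>M i\<in>{..<n}. P)
            {x \<in> space (\<Pi>\<^sub>M i\<in>{..<n}. P). real n * \<epsilon> \<le> \<bar>(\<Sum>i<n. f (x i)) - real n * (\<integral>x. f x \<partial>P)\<bar>} - 0) < \<eta>"
  proof (intro exI[of _ "max 1 n0"] allI impI)
    fix n assume "max 1 n0 \<le> n"
    then have "n > 0" "n0 \<le> n" by auto
    from le_less_trans[OF bound[OF this(1)] n0[OF this(2)]]
    show "norm (measure (\<Pi>\<^sub>M i\<in>{..<n}. P)
            {x \<in> space (\<Pi>\<^sub>M i\<in>{..<n}. P). real n * \<epsilon> \<le> \<bar>(\<Sum>i<n. f (x i)) - real n * (\<integral>x. f x \<partial>P)\<bar>} - 0) < \<eta>"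
      by (simp only: diff_0_right real_norm_def abs_of_nonneg[OF measure_nonneg])
  qed
qed

section \<open>The Prekopa--Leindler inequality\<close>

text \<open>Attach \<open>s A\<close> to a point of \<open>t B\<close> near its infimum, and
  \<open>t B\<close> to a point of \<open>s A\<close> near its supremum. Both copies lie in
  \<open>C\<close>, the first essentially to the left of the second, and they overlap in an interval
  of length at most \<open>e\<close>, which pays for extrema that are not attained.\<close>

lemma brunn_minkowski_real:
  fixes A B C :: "real set"
  assumes [measurable]: "A \<in> sets borel" "B \<in> sets borel" "C \<in> sets borel"
    and "A \<noteq> {}" "B \<noteq> {}" "bounded A" "bounded B" and "s > 0" "t > 0"
    and sub: "\<And>a b. a \<in> A \<Longrightarrow> b \<in> B \<Longrightarrow> s * a + t * b \<in> C"
  shows "ennreal s * emeasure lborel A + ennreal t * emeasure lborel B \<le> emeasure lborel C"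
proof (rule ennreal_le_epsilon)
  fix e :: real assume "e > 0"
  define d where "d = e / (s + t)"
  have "d > 0" using \<open>e > 0\<close> \<open>s > 0\<close> \<open>t > 0\<close> by (simp add: d_def)
  have bdd: "bdd_above A" "bdd_below B"
    using \<open>bounded A\<close> \<open>bounded B\<close> by (auto intro: bounded_imp_bdd_above bounded_imp_bdd_below)
  obtain a where a: "a \<in> A" "Sup A - d < a"
    using less_cSupD[of A "Sup A - d"] \<open>A \<noteq> {}\<close> \<open>d > 0\<close> by auto
  obtain b where b: "b \<in> B" "b < Inf B + d"
    using cInf_lessD[of B "Inf B + d"] \<open>B \<noteq> {}\<close> \<open>d > 0\<close> by auto
  define S where "S = {x. (x - t * b) / s \<in> A}"
  define T where "T = {x. (x - s * a) / t \<in> B}"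
  have [measurable]: "S \<in> sets borel" "T \<in> sets borel"
    unfolding S_def T_def by measurable
  have S: "emeasure lborel S = ennreal s * emeasure lborel A"
  proof -
    have "emeasure lborel S = (\<integral>\<^sup>+x. indicator S x \<partial>lborel)" by simp
    also have "\<dots> = ennreal \<bar>s\<bar> * (\<integral>\<^sup>+x. indicator S (t * b + s * x) \<partial>lborel)"
      using \<open>s > 0\<close> by (intro nn_integral_real_affine) auto
    also have "(\<lambda>x. indicator S (t * b + s * x) :: ennreal) = indicator A"
      using \<open>s > 0\<close> by (auto simp: S_def indicator_def fun_eq_iff)
    finally show ?thesis using \<open>s > 0\<close> by simp
  qed
  have T: "emeasure lborel T = ennreal t * emeasure lborel B"
  proof -
    have "emeasure lborel T = (\<integral>\<^sup>+x. indicator T x \<partial>lborel)" by simp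
    also have "\<dots> = ennreal \<bar>t\<bar> * (\<integral>\<^sup>+x. indicator T (s * a + t * x) \<partial>lborel)"
      using \<open>t > 0\<close> by (intro nn_integral_real_affine) auto
    also have "(\<lambda>x. indicator T (s * a + t * x) :: ennreal) = indicator B"
      using \<open>t > 0\<close> by (auto simp: T_def indicator_def fun_eq_iff)
    finally show ?thesis using \<open>t > 0\<close> by simp
  qed
  have "S \<subseteq> C"
  proof
    fix x assume "x \<in> S"
    then show "x \<in> C"
      using sub[of "(x - t * b) / s" b] b \<open>s > 0\<close> by (auto simp: S_def)
  qed
  moreover have "T \<subseteq> C"
  proof
    fix x assume "x \<in> T"
    then show "x \<in> C"
      using sub[of a "(x - s * a) / t"] a \<open>t > 0\<close> by (auto simp: T_def)
  qed
  ultimately have un: "emeasure lborel (S \<union> T) \<le> emeasure lborel C"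
    by (intro emeasure_mono) auto
  define l where "l = s * a + t * Inf B"
  have "S \<inter> T \<subseteq> {l .. l + e}"
  proof
    fix x assume x: "x \<in> S \<inter> T"
    then have "(x - t * b) / s \<le> Sup A" "Inf B \<le> (x - s * a) / t"
      using bdd by (auto simp: S_def T_def intro: cSup_upper cInf_lower)
    then have 1: "x \<le> s * Sup A + t * b" "l \<le> x"
      using \<open>s > 0\<close> \<open>t > 0\<close> by (simp_all add: l_def field_simps)
    have "s * Sup A + t * b \<le> s * (a + d) + t * (Inf B + d)"
      using a b \<open>s > 0\<close> \<open>t > 0\<close> by (intro add_mono mult_left_mono) auto
    also have "\<dots> = l + (s + t) * d" by (simp add: l_def algebra_simps)
    also have "\<dots> = l + e" using \<open>s > 0\<close> \<open>t > 0\<close> by (simp add: d_def)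
    finally show "x \<in> {l .. l + e}" using 1 by auto
  qed
  then have "emeasure lborel (S \<inter> T) \<le> emeasure lborel {l .. l + e}"
    by (intro emeasure_mono) auto
  then have int: "emeasure lborel (S \<inter> T) \<le> ennreal e"
    using \<open>e > 0\<close> by simp
  have "emeasure lborel S + emeasure lborel T = emeasure lborel (S \<union> T) + emeasure lborel (S \<inter> T)"
    by (intro emeasure_Un_Int) auto
  also have "\<dots> \<le> emeasure lborel C + ennreal e"
    using un int by (rule add_mono)
  finally show "ennreal s * emeasure lborel A + ennreal t * emeasure lborel B \<le> emeasure lborel C + ennreal e"
    unfolding S T .
qed

text \<open>Tonelli for the region between the axis and the graph; \<open>ennreal\<close> cuts off
  negative values just as the indicator cuts off negative levels.\<close>

lemma nn_integral_layer_cake: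
  fixes f :: "real \<Rightarrow> real"
  assumes [measurable]: "f \<in> borel_measurable borel"
  shows "(\<integral>\<^sup>+x. ennreal (f x) \<partial>lborel)
    = (\<integral>\<^sup>+\<tau>. indicator {0..} \<tau> * emeasure lborel {x. \<tau> < f x} \<partial>lborel)"
proof -
  have "ennreal (f x) = (\<integral>\<^sup>+\<tau>. indicator {\<tau>. 0 \<le> \<tau> \<and> \<tau> < f x} \<tau> \<partial>lborel)" for x
  proof -
    have "{\<tau>. 0 \<le> \<tau> \<and> \<tau> < f x} = {0..<f x}" by auto
    then show ?thesis by (cases "0 \<le> f x") (auto simp: ennreal_neg)
  qed
  then have "(\<integral>\<^sup>+x. ennreal (f x) \<partial>lborel)
      = (\<integral>\<^sup>+x. \<integral>\<^sup>+\<tau>. indicator {\<tau>. 0 \<le> \<tau> \<and> \<tau> < f x} \<tau> \<partial>lborel \<partial>lborel)"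
    by simp
  also have "\<dots> = (\<integral>\<^sup>+\<tau>. \<integral>\<^sup>+x. indicator {\<tau>. 0 \<le> \<tau> \<and> \<tau> < f x} \<tau> \<partial>lborel \<partial>lborel)"
    by (rule lborel_pair.Fubini'[symmetric]) simp
  also have "\<dots> = (\<integral>\<^sup>+\<tau>. indicator {0..} \<tau> * emeasure lborel {x. \<tau> < f x} \<partial>lborel)"
  proof (rule nn_integral_cong)
    fix \<tau> :: real
    have "(\<integral>\<^sup>+x. indicator {\<tau>. 0 \<le> \<tau> \<and> \<tau> < f x} \<tau> \<partial>lborel)
        = (\<integral>\<^sup>+x. indicator {0..} \<tau> * indicator {x. \<tau> < f x} x \<partial>lborel)"
      by (intro nn_integral_cong) (auto simp: indicator_def)
    also have "\<dots> = indicator {0..} \<tau> * emeasure lborel {x. \<tau> < f x}"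
      by (subst nn_integral_cmult) auto
    finally show "(\<integral>\<^sup>+x. indicator {\<tau>. 0 \<le> \<tau> \<and> \<tau> < f x} \<tau> \<partial>lborel)
        = indicator {0..} \<tau> * emeasure lborel {x. \<tau> < f x}" .
  qed
  finally show ?thesis .
qed

text \<open>The invariant of the induction on coordinates: it guarantees finite real-valued
  integrals, contains the indicators of bounded measurable sets, and survives integrating out a
  coordinate.\<close>

definition box_bounded :: "'i set \<Rightarrow> (('i \<Rightarrow> real) \<Rightarrow> real) \<Rightarrow> bool" where
  "box_bounded I f \<longleftrightarrow> f \<in> borel_measurable (\<Pi>\<^sub>M i\<in>I. lborel) \<and>
     (\<exists>C K. \<forall>x\<in>space (\<Pi>\<^sub>M i\<in>I. lborel). 0 \<le> f x \<and> f x \<le> C \<and> (f x \<noteq> 0 \<longrightarrow> (\<forall>i\<in>I. \<bar>x i\<bar> \<le> K)))"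

lemma integrable_bounded_support:
  fixes f :: "real \<Rightarrow> real"
  assumes "f \<in> borel_measurable borel" "\<And>x. 0 \<le> f x" "\<And>x. f x \<le> C" "\<And>x. f x \<noteq> 0 \<Longrightarrow> \<bar>x\<bar> \<le> K"
  shows "integrable lborel f"
proof (rule integrableI_bounded_set[where A="{-K..K}" and B=C])
  show "AE x in lborel. x \<notin> {- K..K} \<longrightarrow> f x = 0"
    using assms(4) by (intro AE_I2) (fastforce simp: abs_le_iff)
qed (use assms in \<open>auto simp: emeasure_lborel_Icc_eq\<close>)

lemma box_bounded_integrable:
  assumes "finite I" "box_bounded I f"
  shows "integrable (\<Pi>\<^sub>M i\<in>I. lborel) f"
proof -
  interpret product_sigma_finite "\<lambda>_. lborel :: real measure"
    by (rule product_sigma_finite.intro) (rule sigma_finite_lborel)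
  obtain C K where CK: "\<And>x. x \<in> space (\<Pi>\<^sub>M i\<in>I. lborel) \<Longrightarrow>
      0 \<le> f x \<and> f x \<le> C \<and> (f x \<noteq> 0 \<longrightarrow> (\<forall>i\<in>I. \<bar>x i\<bar> \<le> K))"
    and m: "f \<in> borel_measurable (\<Pi>\<^sub>M i\<in>I. lborel)"
    using assms(2) unfolding box_bounded_def by blast
  show ?thesis
  proof (rule integrableI_bounded_set[where A="\<Pi>\<^sub>E i\<in>I. {-K..K}" and B=C])
    show "(\<Pi>\<^sub>E i\<in>I. {- K..K}) \<in> sets (Pi\<^sub>M I (\<lambda>i. lborel))"
      using \<open>finite I\<close> by (intro sets_PiM_I_finite) auto
    show "emeasure (Pi\<^sub>M I (\<lambda>i. lborel)) (\<Pi>\<^sub>E i\<in>I. {- K..K}) < \<infinity>"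
      using \<open>finite I\<close> by (subst emeasure_PiM) (auto simp: emeasure_lborel_Icc_eq less_top[symmetric] ennreal_power power_0_left)
    show "AE x in Pi\<^sub>M I (\<lambda>i. lborel). x \<notin> (\<Pi>\<^sub>E i\<in>I. {- K..K}) \<longrightarrow> f x = 0"
    proof (intro AE_I2 impI, rule ccontr)
      fix x assume x: "x \<in> space (Pi\<^sub>M I (\<lambda>i. lborel))" "x \<notin> (\<Pi>\<^sub>E i\<in>I. {- K..K})" "f x \<noteq> 0"
      then have "\<forall>i\<in>I. \<bar>x i\<bar> \<le> K" using CK by blast
      with x show False by (auto simp: space_PiM PiE_iff abs_le_iff minus_le_iff)
    qed
    show "AE x in Pi\<^sub>M I (\<lambda>i. lborel). x \<in> (\<Pi>\<^sub>E i\<in>I. {- K..K}) \<longrightarrow> norm (f x) \<le> C"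
      using CK by (intro AE_I2) simp
  qed (rule m)
qed

text \<open>After division by the suprema, \<open>f\<close> and \<open>g\<close> have nonempty
  superlevel sets at the same levels, so the inequality for sets can be integrated over all levels.
  The result is additive in the two integrals; the weighted inequality of arithmetic and geometric
  means turns it into a product. The exponent \<theta> is kept independent of \<open>s\<close> and
  \<open>t\<close> so that it can be optimised later; for \<open>s = \<theta>\<close>,
  \<open>t = 1 - \<theta>\<close> the constant is 1 and the classical form appears.\<close>

lemma prekopa_leindler_real:
  fixes f g h :: "real \<Rightarrow> real"
  assumes [measurable]: "f \<in> borel_measurable borel" "g \<in> borel_measurable borel"
      "h \<in> borel_measurable borel"
    and f: "\<And>x. 0 \<le> f x" "\<And>x. f x \<le> Cf" "\<And>x. f x \<noteq> 0 \<Longrightarrow> \<bar>x\<bar> \<le> Kf"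
    and g: "\<And>x. 0 \<le> g x" "\<And>x. g x \<le> Cg" "\<And>x. g x \<noteq> 0 \<Longrightarrow> \<bar>x\<bar> \<le> Kg"
    and h: "integrable lborel h" "\<And>x. 0 \<le> h x"
    and "s > 0" "t > 0" "0 < \<theta>" "\<theta> < 1"
    and fgh: "\<And>x y. f x powr \<theta> * g y powr (1 - \<theta>) \<le> h (s * x + t * y)"
  shows "(s / \<theta>) powr \<theta> * (t / (1 - \<theta>)) powr (1 - \<theta>)
      * ((\<integral>x. f x \<partial>lborel) powr \<theta> * (\<integral>x. g x \<partial>lborel) powr (1 - \<theta>)) \<le> (\<integral>x. h x \<partial>lborel)"
proof -
  have f_int: "integrable lborel f"
    by (rule integrable_bounded_support[OF assms(1) f])
  have g_int: "integrable lborel g"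
    by (rule integrable_bounded_support[OF assms(2) g])
  define F where "F = (\<integral>x. f x \<partial>lborel)"
  define G where "G = (\<integral>x. g x \<partial>lborel)"
  have "F \<ge> 0" "G \<ge> 0" unfolding F_def G_def using f g by auto
  have h_nonneg: "(\<integral>x. h x \<partial>lborel) \<ge> 0" using h by auto
  show ?thesis
  proof (cases "F = 0 \<or> G = 0")
    case True
    then show ?thesis using h_nonneg by (auto simp: F_def G_def)
  next
    case False
    then have "F > 0" "G > 0" using \<open>F \<ge> 0\<close> \<open>G \<ge> 0\<close> by auto
    have bdd: "bdd_above (range f)" "bdd_above (range g)"
      using bdd_aboveI2[of UNIV f Cf, OF f(2)] bdd_aboveI2[of UNIV g Cg, OF g(2)] by simp_all
    define M where "M = Sup (range f)"
    define N where "N = Sup (range g)"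
    have f_le: "f x \<le> M" and g_le: "g x \<le> N" for x
      unfolding M_def N_def using bdd by (simp_all add: cSup_upper)
    have "M > 0"
    proof (rule ccontr)
      assume "\<not> M > 0"
      then have "f = (\<lambda>x. 0)" using f_le f(1) by (intro ext order.antisym) (auto intro: order_trans simp: not_less)
      then show False using \<open>F > 0\<close> by (simp add: F_def)
    qed
    have "N > 0"
    proof (rule ccontr)
      assume "\<not> N > 0"
      then have "g = (\<lambda>x. 0)" using g_le g(1) by (intro ext order.antisym) (auto intro: order_trans simp: not_less)
      then show False using \<open>G > 0\<close> by (simp add: G_def)
    qed
    define L where "L = M powr \<theta> * N powr (1 - \<theta>)"
    have "L > 0" using \<open>M > 0\<close> \<open>N > 0\<close> by (simp add: L_def)
    \<comment> \<open>Levels in \<open>[0, 1)\<close> are the only ones with content: there both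
      sets on the left are nonempty, as \<open>brunn_minkowski_real\<close> requires. From level 1
      on both are empty.\<close>
    have level: "ennreal s * (indicator {0..} \<tau> * emeasure lborel {x. \<tau> < f x / M})
        + ennreal t * (indicator {0..} \<tau> * emeasure lborel {x. \<tau> < g x / N})
        \<le> indicator {0..} \<tau> * emeasure lborel {x. \<tau> < h x / L}" for \<tau>
    proof (cases "0 \<le> \<tau> \<and> \<tau> < 1")
      case True
      have "\<tau> * M < M" "\<tau> * N < N" using True \<open>M > 0\<close> \<open>N > 0\<close> by auto
      then have "\<exists>x. \<tau> * M < f x" "\<exists>x. \<tau> * N < g x"
        unfolding M_def N_def using less_cSupD[of "range f"] less_cSupD[of "range g"] by blast+
      then have ne: "{x. \<tau> < f x / M} \<noteq> {}" "{x. \<tau> < g x / N} \<noteq> {}"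
        using \<open>M > 0\<close> \<open>N > 0\<close> by (auto simp: field_simps)
      have "\<bar>x\<bar> \<le> Kf" if "\<tau> < f x / M" for x
        using f(3)[of x] that True by (cases "f x = 0") auto
      then have "{x. \<tau> < f x / M} \<subseteq> {-Kf..Kf}" by (auto simp: abs_le_iff minus_le_iff)
      moreover have "\<bar>x\<bar> \<le> Kg" if "\<tau> < g x / N" for x
        using g(3)[of x] that True by (cases "g x = 0") auto
      then have "{x. \<tau> < g x / N} \<subseteq> {-Kg..Kg}" by (auto simp: abs_le_iff minus_le_iff)
      ultimately
      have bd: "bounded {x. \<tau> < f x / M}" "bounded {x. \<tau> < g x / N}"
        by (meson bounded_closed_interval bounded_subset)+
      have "ennreal s * emeasure lborel {x. \<tau> < f x / M} + ennreal t * emeasure lborel {x. \<tau> < g x / N}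
          \<le> emeasure lborel {x. \<tau> < h x / L}"
      proof (rule brunn_minkowski_real[OF _ _ _ ne bd \<open>s > 0\<close> \<open>t > 0\<close>])
        fix a b assume a: "a \<in> {x. \<tau> < f x / M}" and b: "b \<in> {x. \<tau> < g x / N}"
        have fa: "\<tau> * M < f a" and gb: "\<tau> * N < g b"
          using a b \<open>M > 0\<close> \<open>N > 0\<close> by (auto simp: field_simps)
        \<comment> \<open>The exponents sum to 1, so the geometric mean is homogeneous of degree 1
          and one level \<tau> serves all three functions.\<close>
        have "\<tau> * L = (\<tau> * M) powr \<theta> * (\<tau> * N) powr (1 - \<theta>)"
        proof -
          have "\<tau> powr \<theta> * \<tau> powr (1 - \<theta>) = \<tau>"
            using True by (simp add: powr_add[symmetric])
          then have "\<tau> * L = (\<tau> powr \<theta> * \<tau> powr (1 - \<theta>)) * L" by simp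
          then show ?thesis
            using True \<open>M > 0\<close> \<open>N > 0\<close> by (simp add: L_def powr_mult)
        qed
        also have "\<dots> < f a powr \<theta> * g b powr (1 - \<theta>)"
          using fa gb True \<open>M > 0\<close> \<open>N > 0\<close> \<open>0 < \<theta>\<close> \<open>\<theta> < 1\<close>
          by (intro mult_strict_mono' powr_less_mono2) auto
        also have "\<dots> \<le> h (s * a + t * b)" by (rule fgh)
        finally show "s * a + t * b \<in> {x. \<tau> < h x / L}"
          using \<open>L > 0\<close> by (simp add: field_simps)
      qed auto
      then show ?thesis using True by simp
    next
      case False
      then consider "\<tau> < 0" | "1 \<le> \<tau>" by linarith
      then show ?thesis
      proof cases
        case 2
        have "f x / M \<le> 1" "g x / N \<le> 1" for x
          using f_le[of x] g_le[of x] \<open>M > 0\<close> \<open>N > 0\<close> by simp_all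
        then have "f x / M \<le> \<tau>" "g x / N \<le> \<tau>" for x
          using 2 order_trans by blast+
        then have "{x. \<tau> < f x / M} = {}" "{x. \<tau> < g x / N} = {}"
          by (simp_all add: not_less)
        then show ?thesis by (simp only: emeasure_empty mult_zero_right add_0_right zero_le)
      qed simp
    qed
    have [measurable]: "(\<lambda>\<tau>. emeasure lborel {x. \<tau> < k x}) \<in> borel_measurable borel"
      if [measurable]: "k \<in> borel_measurable borel" for k :: "real \<Rightarrow> real"
      by measurable
    have "ennreal s * (\<integral>\<^sup>+x. ennreal (f x / M) \<partial>lborel) + ennreal t * (\<integral>\<^sup>+x. ennreal (g x / N) \<partial>lborel)
        \<le> (\<integral>\<^sup>+x. ennreal (h x / L) \<partial>lborel)"
    proof -
      have "ennreal s * (\<integral>\<^sup>+x. ennreal (f x / M) \<partial>lborel) + ennreal t * (\<integral>\<^sup>+x. ennreal (g x / N) \<partial>lborel)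
        = (\<integral>\<^sup>+\<tau>. ennreal s * (indicator {0..} \<tau> * emeasure lborel {x. \<tau> < f x / M})
          + ennreal t * (indicator {0..} \<tau> * emeasure lborel {x. \<tau> < g x / N}) \<partial>lborel)"
        by (subst nn_integral_add, simp, simp, subst (1 2) nn_integral_cmult, simp, simp,
            subst (1 2) nn_integral_layer_cake) simp_all
      also have "\<dots> \<le> (\<integral>\<^sup>+\<tau>. indicator {0..} \<tau> * emeasure lborel {x. \<tau> < h x / L} \<partial>lborel)"
        by (intro nn_integral_mono level)
      also have "\<dots> = (\<integral>\<^sup>+x. ennreal (h x / L) \<partial>lborel)"
        by (rule nn_integral_layer_cake[symmetric]) simp
      finally show ?thesis .
    qed
    also have "(\<integral>\<^sup>+x. ennreal (f x / M) \<partial>lborel) = ennreal (F / M)"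
      unfolding F_def using f_int f(1) \<open>M > 0\<close> by (subst nn_integral_eq_integral) auto
    also have "(\<integral>\<^sup>+x. ennreal (g x / N) \<partial>lborel) = ennreal (G / N)"
      unfolding G_def using g_int g(1) \<open>N > 0\<close> by (subst nn_integral_eq_integral) auto
    also have "(\<integral>\<^sup>+x. ennreal (h x / L) \<partial>lborel) = ennreal ((\<integral>x. h x \<partial>lborel) / L)"
      using h \<open>L > 0\<close> by (subst nn_integral_eq_integral) auto
    finally have "s * (F / M) + t * (G / N) \<le> (\<integral>x. h x \<partial>lborel) / L"
      using \<open>s > 0\<close> \<open>t > 0\<close> \<open>F > 0\<close> \<open>G > 0\<close> \<open>M > 0\<close> \<open>N > 0\<close> \<open>L > 0\<close> h_nonneg
      by (simp add: ennreal_mult[symmetric] ennreal_plus[symmetric] del: ennreal_plus)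
    \<comment> \<open>The sum \<open>s F / M + t G / N\<close> is read as a convex combination with
      weights \<theta> and \<open>1 - \<theta>\<close>; this is where the constant of the statement
      comes from.\<close>
    moreover have "(s / \<theta> * (F / M)) powr \<theta> * (t / (1 - \<theta>) * (G / N)) powr (1 - \<theta>)
        \<le> \<theta> * (s / \<theta> * (F / M)) + (1 - \<theta>) * (t / (1 - \<theta>) * (G / N))"
      using \<open>s > 0\<close> \<open>t > 0\<close> \<open>F > 0\<close> \<open>G > 0\<close> \<open>M > 0\<close> \<open>N > 0\<close> \<open>0 < \<theta>\<close> \<open>\<theta> < 1\<close>
      by (intro Youngs_inequality_0) auto
    ultimately have "(s / \<theta> * (F / M)) powr \<theta> * (t / (1 - \<theta>) * (G / N)) powr (1 - \<theta>) * L
        \<le> (\<integral>x. h x \<partial>lborel)"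
      using \<open>0 < \<theta>\<close> \<open>\<theta> < 1\<close> \<open>L > 0\<close>
      by (simp add: pos_le_divide_eq) (meson order_trans mult_right_mono less_imp_le)
    moreover have "(s / \<theta> * (F / M)) powr \<theta> * (t / (1 - \<theta>) * (G / N)) powr (1 - \<theta>) * L
        = (s / \<theta>) powr \<theta> * (t / (1 - \<theta>)) powr (1 - \<theta>) * (F powr \<theta> * G powr (1 - \<theta>))"
    proof -
      have "(s / \<theta> * (F / M)) powr \<theta> = (s / \<theta>) powr \<theta> * (F powr \<theta> / M powr \<theta>)"
        using \<open>s > 0\<close> \<open>F > 0\<close> \<open>M > 0\<close> \<open>0 < \<theta>\<close> by (simp add: powr_mult powr_divide)
      moreover have "(t / (1 - \<theta>) * (G / N)) powr (1 - \<theta>) = (t / (1 - \<theta>)) powr (1 - \<theta>) * (G powr (1 - \<theta>) / N powr (1 - \<theta>))"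
        using \<open>t > 0\<close> \<open>G > 0\<close> \<open>N > 0\<close> \<open>\<theta> < 1\<close> by (simp add: powr_mult powr_divide)
      ultimately show ?thesis
        using \<open>M > 0\<close> \<open>N > 0\<close> by (simp add: L_def)
    qed
    ultimately show ?thesis by (simp add: F_def G_def)
  qed
qed

lemma box_bounded_slice:
  assumes "box_bounded (insert i I) f" "i \<notin> I" "x \<in> space (\<Pi>\<^sub>M i\<in>I. lborel)"
  obtains C K where "(\<lambda>y. f (x(i := y))) \<in> borel_measurable borel"
    "\<And>y. 0 \<le> f (x(i := y))" "\<And>y. f (x(i := y)) \<le> C" "\<And>y. f (x(i := y)) \<noteq> 0 \<Longrightarrow> \<bar>y\<bar> \<le> K"
proof -
  obtain C K where CK: "\<And>x. x \<in> space (\<Pi>\<^sub>M i\<in>insert i I. lborel) \<Longrightarrow>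
      0 \<le> f x \<and> f x \<le> C \<and> (f x \<noteq> 0 \<longrightarrow> (\<forall>i\<in>insert i I. \<bar>x i\<bar> \<le> K))"
    and m: "f \<in> borel_measurable (\<Pi>\<^sub>M i\<in>insert i I. lborel)"
    using assms(1) unfolding box_bounded_def by blast
  have sp: "x(i := y) \<in> space (\<Pi>\<^sub>M i\<in>insert i I. lborel)" for y
    using assms(3) by (auto simp: space_PiM PiE_iff extensional_def)
  have "(\<lambda>y. f (x(i := y))) \<in> borel_measurable lborel"
    using measurable_comp[OF measurable_component_update[OF assms(3) assms(2)] m]
    by (simp add: comp_def)
  then show thesis
    using CK[OF sp] by (intro that[of C K]) auto
qed

lemma box_bounded_marginal:
  assumes "finite I" "i \<notin> I" "box_bounded (insert i I) f"
  shows "box_bounded I (\<lambda>x. \<integral>y. f (x(i := y)) \<partial>lborel)"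
proof -
  obtain C K where CK: "\<And>x. x \<in> space (\<Pi>\<^sub>M i\<in>insert i I. lborel) \<Longrightarrow>
      0 \<le> f x \<and> f x \<le> C \<and> (f x \<noteq> 0 \<longrightarrow> (\<forall>i\<in>insert i I. \<bar>x i\<bar> \<le> K))"
    and m [measurable]: "f \<in> borel_measurable (\<Pi>\<^sub>M i\<in>insert i I. lborel)"
    using assms(3) unfolding box_bounded_def by blast
  define F where "F x = (\<integral>y. f (x(i := y)) \<partial>lborel)" for x
  have "(\<lambda>(x, y). f (x(i := y))) \<in> borel_measurable (Pi\<^sub>M I (\<lambda>i. lborel) \<Otimes>\<^sub>M lborel)"
    using measurable_comp[OF measurable_add_dim[of i I "\<lambda>_. lborel :: real measure"] m]
    by (simp add: comp_def split_beta')
  then have meas: "F \<in> borel_measurable (\<Pi>\<^sub>M i\<in>I. lborel)"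
    unfolding F_def by (rule lborel.borel_measurable_lebesgue_integral)
  have "0 \<le> F x \<and> F x \<le> \<bar>C\<bar> * (2 * \<bar>K\<bar>) \<and> (F x \<noteq> 0 \<longrightarrow> (\<forall>j\<in>I. \<bar>x j\<bar> \<le> K))"
    if x: "x \<in> space (\<Pi>\<^sub>M i\<in>I. lborel)" for x
  proof -
    have sp: "x(i := y) \<in> space (\<Pi>\<^sub>M i\<in>insert i I. lborel)" for y
      using x by (auto simp: space_PiM PiE_iff extensional_def)
    obtain C' K' where s: "(\<lambda>y. f (x(i := y))) \<in> borel_measurable borel"
      "\<And>y. 0 \<le> f (x(i := y))" "\<And>y. f (x(i := y)) \<le> C'" "\<And>y. f (x(i := y)) \<noteq> 0 \<Longrightarrow> \<bar>y\<bar> \<le> K'"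
      using box_bounded_slice[OF assms(3,2) x] by metis
    have int: "integrable lborel (\<lambda>y. f (x(i := y)))"
      by (rule integrable_bounded_support[OF s])
    have "f (x(i := y)) \<le> \<bar>C\<bar> * indicator {-\<bar>K\<bar>..\<bar>K\<bar>} y" for y
      using CK[OF sp[of y]] by (cases "f (x(i := y)) = 0") (auto simp: indicator_def abs_le_iff)
    then have "F x \<le> (\<integral>y. \<bar>C\<bar> * indicator {-\<bar>K\<bar>..\<bar>K\<bar>} y \<partial>lborel)"
      unfolding F_def by (intro integral_mono int) auto
    also have "\<dots> = \<bar>C\<bar> * (2 * \<bar>K\<bar>)" by simp
    finally have "F x \<le> \<bar>C\<bar> * (2 * \<bar>K\<bar>)" .
    moreover have "0 \<le> F x" unfolding F_def using s(2) by simp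
    moreover have "\<forall>j\<in>I. \<bar>x j\<bar> \<le> K" if "F x \<noteq> 0"
    proof -
      have "\<exists>y. f (x(i := y)) \<noteq> 0"
        using that unfolding F_def by (metis (mono_tags, lifting) Bochner_Integration.integral_cong integral_zero)
      then obtain y where "f (x(i := y)) \<noteq> 0" ..
      then have "\<forall>j\<in>insert i I. \<bar>(x(i := y)) j\<bar> \<le> K" using CK[OF sp] by blast
      then show ?thesis using \<open>i \<notin> I\<close> by (metis fun_upd_other insertCI)
    qed
    ultimately show ?thesis by blast
  qed
  then show ?thesis
    unfolding box_bounded_def F_def[symmetric] using meas by blast
qed

text \<open>Induction on the coordinates. For fixed \<open>x\<close>, \<open>y\<close> and
  \<open>z = s x + t y\<close> in the old coordinates, the one-dimensional inequality in the new
  coordinate says that the three marginals satisfy the hypothesis again, up to one factor of the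
  constant.\<close>

lemma prekopa_leindler:
  fixes f g h :: "('i \<Rightarrow> real) \<Rightarrow> real"
  assumes "finite I" and "box_bounded I f" "box_bounded I g" "box_bounded I h"
    and "s > 0" "t > 0" "0 < \<theta>" "\<theta> < 1"
    and "\<And>x y. x \<in> space (\<Pi>\<^sub>M i\<in>I. lborel) \<Longrightarrow> y \<in> space (\<Pi>\<^sub>M i\<in>I. lborel) \<Longrightarrow>
        f x powr \<theta> * g y powr (1 - \<theta>) \<le> h (\<lambda>i\<in>I. s * x i + t * y i)"
  shows "((s / \<theta>) powr \<theta> * (t / (1 - \<theta>)) powr (1 - \<theta>)) ^ card I
      * ((\<integral>x. f x \<partial>(\<Pi>\<^sub>M i\<in>I. lborel)) powr \<theta> * (\<integral>x. g x \<partial>(\<Pi>\<^sub>M i\<in>I. lborel)) powr (1 - \<theta>))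
      \<le> (\<integral>x. h x \<partial>(\<Pi>\<^sub>M i\<in>I. lborel))"
  using assms
proof (induction I arbitrary: f g h rule: finite_induct)
  case empty
  interpret product_sigma_finite "\<lambda>_. lborel :: real measure"
    by (rule product_sigma_finite.intro) (rule sigma_finite_lborel)
  have "(\<lambda>_. undefined) \<in> space (Pi\<^sub>M {} (\<lambda>_::'i. lborel :: real measure))"
    by (simp add: space_PiM)
  from empty.prems(8)[OF this this] show ?case
    by (simp add: PiM_empty lebesgue_integral_count_space_finite restrict_def)
next
  case (insert i I)
  interpret product_sigma_finite "\<lambda>_. lborel :: real measure"
    by (rule product_sigma_finite.intro) (rule sigma_finite_lborel)
  let ?P = "\<lambda>I. \<Pi>\<^sub>M i\<in>I. (lborel :: real measure)"
  define c where "c = (s / \<theta>) powr \<theta> * (t / (1 - \<theta>)) powr (1 - \<theta>)"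
  have "c > 0" using insert.prems by (simp add: c_def)
  define m where "m f x = (\<integral>y. f (x(i := y)) \<partial>lborel)" for f :: "('i \<Rightarrow> real) \<Rightarrow> real" and x
  have bb: "box_bounded I (m f)" if "box_bounded (insert i I) f" for f
    unfolding m_def using insert.hyps that by (intro box_bounded_marginal)
  have fub: "(\<integral>x. f x \<partial>?P (insert i I)) = (\<integral>x. m f x \<partial>?P I)" if "box_bounded (insert i I) f" for f
    unfolding m_def using insert.hyps that
    by (intro product_integral_insert box_bounded_integrable) auto
  \<comment> \<open>Dividing the marginal of \<open>h\<close> by \<open>c\<close> restores the
    pointwise hypothesis exactly; so each coordinate contributes one factor
    \<open>c\<close>.\<close>
  have bbh: "box_bounded I (\<lambda>x. m h x / c)"
  proof -
    from bb[OF insert.prems(3)] obtain C K where "m h \<in> borel_measurable (?P I)"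
      and CK: "\<And>x. x \<in> space (?P I) \<Longrightarrow> 0 \<le> m h x \<and> m h x \<le> C \<and> (m h x \<noteq> 0 \<longrightarrow> (\<forall>i\<in>I. \<bar>x i\<bar> \<le> K))"
      unfolding box_bounded_def by blast
    then show ?thesis
      unfolding box_bounded_def using \<open>c > 0\<close>
      by (intro conjI exI[of _ "C / c"] exI[of _ K]) (auto intro: divide_right_mono)
  qed
  have "m f x powr \<theta> * m g y powr (1 - \<theta>) \<le> m h (\<lambda>i\<in>I. s * x i + t * y i) / c"
    if x: "x \<in> space (?P I)" and y: "y \<in> space (?P I)" for x y
  proof -
    define z where "z = (\<lambda>i\<in>I. s * x i + t * y i)"
    have z: "z \<in> space (?P I)" by (simp add: z_def space_PiM)
    obtain Cf Kf where f: "(\<lambda>y. f (x(i := y))) \<in> borel_measurable borel"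
      "\<And>y. 0 \<le> f (x(i := y))" "\<And>y. f (x(i := y)) \<le> Cf" "\<And>y. f (x(i := y)) \<noteq> 0 \<Longrightarrow> \<bar>y\<bar> \<le> Kf"
      using box_bounded_slice[OF insert.prems(1) insert.hyps(2) x] by metis
    obtain Cg Kg where g: "(\<lambda>w. g (y(i := w))) \<in> borel_measurable borel"
      "\<And>w. 0 \<le> g (y(i := w))" "\<And>w. g (y(i := w)) \<le> Cg" "\<And>w. g (y(i := w)) \<noteq> 0 \<Longrightarrow> \<bar>w\<bar> \<le> Kg"
      using box_bounded_slice[OF insert.prems(2) insert.hyps(2) y] by metis
    obtain Ch Kh where h: "(\<lambda>w. h (z(i := w))) \<in> borel_measurable borel"
      "\<And>w. 0 \<le> h (z(i := w))" "\<And>w. h (z(i := w)) \<le> Ch" "\<And>w. h (z(i := w)) \<noteq> 0 \<Longrightarrow> \<bar>w\<bar> \<le> Kh"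
      using box_bounded_slice[OF insert.prems(3) insert.hyps(2) z] by metis
    have "c * (m f x powr \<theta> * m g y powr (1 - \<theta>)) \<le> m h z"
      unfolding m_def c_def
    proof (rule prekopa_leindler_real[OF f(1) g(1) h(1) f(2-4) g(2-4) integrable_bounded_support[OF h] h(2) insert.prems(4-7)])
      fix a b :: real
      have "x(i := a) \<in> space (?P (insert i I))" "y(i := b) \<in> space (?P (insert i I))"
        using x y by (auto simp: space_PiM PiE_iff extensional_def)
      note insert.prems(8)[OF this]
      also have "(\<lambda>j\<in>insert i I. s * (x(i := a)) j + t * (y(i := b)) j) = z(i := s * a + t * b)"
        using insert.hyps by (auto simp: z_def fun_eq_iff)
      finally show "f (x(i := a)) powr \<theta> * g (y(i := b)) powr (1 - \<theta>) \<le> h (z(i := s * a + t * b))" .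
    qed
    then show ?thesis
      using \<open>c > 0\<close> unfolding z_def by (simp add: pos_le_divide_eq mult.commute)
  qed
  note step = this
  have "c ^ card I * ((\<integral>x. m f x \<partial>?P I) powr \<theta> * (\<integral>x. m g x \<partial>?P I) powr (1 - \<theta>))
      \<le> (\<integral>x. m h x / c \<partial>?P I)"
    using insert.IH[OF bb[OF insert.prems(1)] bb[OF insert.prems(2)] bbh insert.prems(4-7) step]
    unfolding c_def .
  then have "c ^ Suc (card I) * ((\<integral>x. m f x \<partial>?P I) powr \<theta> * (\<integral>x. m g x \<partial>?P I) powr (1 - \<theta>))
      \<le> (\<integral>x. m h x \<partial>?P I)"
    using \<open>c > 0\<close> by (simp add: pos_le_divide_eq mult_ac)
  then show ?case
    using insert.hyps by (simp add: fub insert.prems(1-3) c_def)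
qed

section \<open>Gaussian products\<close>

lemma prob_space_gaussian: "v > 0 \<Longrightarrow> prob_space (gaussian m v)"
  unfolding gaussian_def by (intro prob_space_normal_density) simp

lemma sets_gaussian [simp, measurable_cong]: "sets (gaussian m v) = sets borel"
  and space_gaussian [simp]: "space (gaussian m v) = UNIV"
  by (simp_all add: gaussian_def)

lemma gaussian_integral:
  assumes "v > 0" "has_bochner_integral lborel (\<lambda>x. normal_density m (sqrt v) x * f x) I"
    and [measurable]: "f \<in> borel_measurable borel"
  shows "integrable (gaussian m v) f" "(\<integral>x. f x \<partial>gaussian m v) = (I::real)"
proof -
  have nn: "AE x in lborel. 0 \<le> normal_density m (sqrt v) x" by simp
  show "integrable (gaussian m v) f"
    unfolding gaussian_def using assms nn
    by (subst integrable_real_density) (auto simp: has_bochner_integral_iff)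
  show "(\<integral>x. f x \<partial>gaussian m v) = I"
    unfolding gaussian_def using assms nn
    by (subst integral_real_density) (auto simp: has_bochner_integral_iff)
qed

lemma gaussian_moment_1:
  assumes "v > 0"
  shows "integrable (gaussian m v) (\<lambda>x. x - m)" "(\<integral>x. x - m \<partial>gaussian m v) = 0"
proof -
  have "has_bochner_integral lborel (\<lambda>x. normal_density m (sqrt v) x * (x - m)) 0"
    using normal_moment_odd[of "sqrt v" m 0] assms by simp
  from gaussian_integral[OF assms this]
  show "integrable (gaussian m v) (\<lambda>x. x - m)" "(\<integral>x. x - m \<partial>gaussian m v) = 0" by simp_all
qed

lemma gaussian_moment_2:
  assumes "v > 0"
  shows "integrable (gaussian m v) (\<lambda>x. (x - m)\<^sup>2)" "(\<integral>x. (x - m)\<^sup>2 \<partial>gaussian m v) = v"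
proof -
  have "has_bochner_integral lborel (\<lambda>x. normal_density m (sqrt v) x * (x - m)\<^sup>2) v"
    using normal_moment_even[of "sqrt v" m 1] assms by simp
  from gaussian_integral[OF assms this]
  show "integrable (gaussian m v) (\<lambda>x. (x - m)\<^sup>2)" "(\<integral>x. (x - m)\<^sup>2 \<partial>gaussian m v) = v" by simp_all
qed

lemma gaussian_moment_4:
  assumes "v > 0"
  shows "integrable (gaussian m v) (\<lambda>x. (x - m) ^ 4)" "(\<integral>x. (x - m) ^ 4 \<partial>gaussian m v) = 3 * v\<^sup>2"
proof -
  have "has_bochner_integral lborel (\<lambda>x. normal_density m (sqrt v) x * (x - m) ^ 4)
      (fact 4 / ((2 / (sqrt v)\<^sup>2) ^ 2 * fact 2))"
    using normal_moment_even[of "sqrt v" m 2] assms by simp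
  also have "fact 4 / ((2 / (sqrt v)\<^sup>2) ^ 2 * fact 2) = 3 * v\<^sup>2"
    using assms by (simp add: fact_numeral power2_eq_square)
  finally have "has_bochner_integral lborel (\<lambda>x. normal_density m (sqrt v) x * (x - m) ^ 4) (3 * v\<^sup>2)" .
  from gaussian_integral[OF assms this]
  show "integrable (gaussian m v) (\<lambda>x. (x - m) ^ 4)" "(\<integral>x. (x - m) ^ 4 \<partial>gaussian m v) = 3 * v\<^sup>2" by simp_all
qed

section \<open>Gaussian product measures compared with volume\<close>

lemma PiM_gaussian:
  assumes "finite I" "v > 0"
  shows "(\<Pi>\<^sub>M i\<in>I. gaussian (m i) v) = density (\<Pi>\<^sub>M i\<in>I. lborel)
    (\<lambda>x. ennreal ((1 / sqrt (2 * pi * v)) ^ card I * exp (- (\<Sum>i\<in>I. (x i - m i)\<^sup>2) / (2 * v))))"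
proof -
  interpret G: prob_space "gaussian (m i) v" for i
    using \<open>v > 0\<close> by (rule prob_space_gaussian)
  have "(\<Pi>\<^sub>M i\<in>I. gaussian (m i) v) = density (\<Pi>\<^sub>M i\<in>I. lborel)
      (\<lambda>x. \<Prod>i\<in>I. ennreal (normal_density (m i) (sqrt v) (x i)))"
    unfolding gaussian_def
    using assms(1) G.sigma_finite_measure_axioms sigma_finite_lborel
    by (intro PiM_density) (auto simp: gaussian_def)
  moreover have "(\<Prod>i\<in>I. ennreal (normal_density (m i) (sqrt v) (x i)))
      = ennreal ((1 / sqrt (2 * pi * v)) ^ card I * exp (- (\<Sum>i\<in>I. (x i - m i)\<^sup>2) / (2 * v)))" for x
  proof -
    have "(\<Prod>i\<in>I. ennreal (normal_density (m i) (sqrt v) (x i)))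
        = ennreal (\<Prod>i\<in>I. normal_density (m i) (sqrt v) (x i))"
      by (rule prod_ennreal) simp
    also have "(\<Prod>i\<in>I. normal_density (m i) (sqrt v) (x i))
        = (\<Prod>i\<in>I. (1 / sqrt (2 * pi * v)) * exp (- (x i - m i)\<^sup>2 / (2 * v)))"
      using \<open>v > 0\<close> by (simp add: normal_density_def)
    also have "\<dots> = (1 / sqrt (2 * pi * v)) ^ card I * (\<Prod>i\<in>I. exp (- (x i - m i)\<^sup>2 / (2 * v)))"
      by (simp only: prod.distrib prod_constant)
    also have "(\<Prod>i\<in>I. exp (- (x i - m i)\<^sup>2 / (2 * v))) = exp (- (\<Sum>i\<in>I. (x i - m i)\<^sup>2) / (2 * v))"
      using \<open>finite I\<close> by (simp add: exp_sum[symmetric] sum_negf sum_divide_distrib)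
    finally show ?thesis .
  qed
  ultimately show ?thesis by simp
qed

text \<open>The density depends only on the distance to the mean vector, so distance bounds on
  \<open>E\<close> let Gaussian measure and volume be exchanged; this estimate and its converse
  below replace all explicit volume formulas.\<close>

lemma emeasure_PiM_gaussian_le:
  assumes "finite I" "v > 0" and E: "E \<in> sets (\<Pi>\<^sub>M i\<in>I. lborel)"
    and a: "\<And>x. x \<in> E \<Longrightarrow> a \<le> (\<Sum>i\<in>I. (x i - m i)\<^sup>2)"
  shows "emeasure (\<Pi>\<^sub>M i\<in>I. gaussian (m i) v) E
    \<le> ennreal ((1 / sqrt (2 * pi * v)) ^ card I * exp (- a / (2 * v))) * emeasure (\<Pi>\<^sub>M i\<in>I. lborel) E"
proof -
  have "emeasure (\<Pi>\<^sub>M i\<in>I. gaussian (m i) v) E = (\<integral>\<^sup>+x. ennreal ((1 / sqrt (2 * pi * v)) ^ card I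
      * exp (- (\<Sum>i\<in>I. (x i - m i)\<^sup>2) / (2 * v))) * indicator E x \<partial>(\<Pi>\<^sub>M i\<in>I. lborel))"
    unfolding PiM_gaussian[OF assms(1,2)] using E by (intro emeasure_density) auto
  also have "\<dots> \<le> (\<integral>\<^sup>+x. ennreal ((1 / sqrt (2 * pi * v)) ^ card I * exp (- a / (2 * v)))
      * indicator E x \<partial>(\<Pi>\<^sub>M i\<in>I. lborel))"
    using \<open>v > 0\<close> a by (intro nn_integral_mono)
      (auto simp: indicator_def intro!: ennreal_leI mult_left_mono divide_right_mono)
  also have "\<dots> = ennreal ((1 / sqrt (2 * pi * v)) ^ card I * exp (- a / (2 * v))) * emeasure (\<Pi>\<^sub>M i\<in>I. lborel) E"
    using E by (rule nn_integral_cmult_indicator)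
  finally show ?thesis .
qed

lemma emeasure_PiM_gaussian_ge:
  assumes "finite I" "v > 0" and E: "E \<in> sets (\<Pi>\<^sub>M i\<in>I. lborel)"
    and b: "\<And>x. x \<in> E \<Longrightarrow> (\<Sum>i\<in>I. (x i - m i)\<^sup>2) \<le> b"
  shows "ennreal ((1 / sqrt (2 * pi * v)) ^ card I * exp (- b / (2 * v))) * emeasure (\<Pi>\<^sub>M i\<in>I. lborel) E
    \<le> emeasure (\<Pi>\<^sub>M i\<in>I. gaussian (m i) v) E"
proof -
  have "ennreal ((1 / sqrt (2 * pi * v)) ^ card I * exp (- b / (2 * v))) * emeasure (\<Pi>\<^sub>M i\<in>I. lborel) E
      = (\<integral>\<^sup>+x. ennreal ((1 / sqrt (2 * pi * v)) ^ card I * exp (- b / (2 * v)))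
      * indicator E x \<partial>(\<Pi>\<^sub>M i\<in>I. lborel))"
    using E by (rule nn_integral_cmult_indicator[symmetric])
  also have "\<dots> \<le> (\<integral>\<^sup>+x. ennreal ((1 / sqrt (2 * pi * v)) ^ card I
      * exp (- (\<Sum>i\<in>I. (x i - m i)\<^sup>2) / (2 * v))) * indicator E x \<partial>(\<Pi>\<^sub>M i\<in>I. lborel))"
    using \<open>v > 0\<close> b by (intro nn_integral_mono)
      (auto simp: indicator_def intro!: ennreal_leI mult_left_mono divide_right_mono)
  also have "\<dots> = emeasure (\<Pi>\<^sub>M i\<in>I. gaussian (m i) v) E"
    unfolding PiM_gaussian[OF assms(1,2)] using E by (intro emeasure_density[symmetric]) auto
  finally show ?thesis .
qed

lemma prob_space_PiM_gaussian: "v > 0 \<Longrightarrow> prob_space (\<Pi>\<^sub>M i\<in>I. gaussian (m i) v)"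
  by (intro prob_space_PiM prob_space_gaussian)

lemma sets_PiM_gaussian: "sets (\<Pi>\<^sub>M i\<in>I. gaussian (m i) v) = sets (\<Pi>\<^sub>M i\<in>I. lborel)"
  by (intro sets_PiM_cong) auto

text \<open>A change of measure through volume: far from \<open>m\<close> the first density is
  small, close to \<open>k\<close> the second is large, and the quotient of the two bounds is the
  factor.\<close>

lemma measure_PiM_gaussian_change:
  assumes "finite I" "v > 0" "w > 0" and E: "E \<in> sets (\<Pi>\<^sub>M i\<in>I. lborel)"
    and a: "\<And>x. x \<in> E \<Longrightarrow> a \<le> (\<Sum>i\<in>I. (x i - m i)\<^sup>2)"
    and b: "\<And>x. x \<in> E \<Longrightarrow> (\<Sum>i\<in>I. (x i - k i)\<^sup>2) \<le> b"
  shows "sqrt (v / w) ^ card I * exp (a / (2 * v) - b / (2 * w)) * measure (\<Pi>\<^sub>M i\<in>I. gaussian (m i) v) E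
    \<le> measure (\<Pi>\<^sub>M i\<in>I. gaussian (k i) w) E"
proof -
  interpret V: prob_space "\<Pi>\<^sub>M i\<in>I. gaussian (m i) v" using assms by (intro prob_space_PiM_gaussian)
  interpret W: prob_space "\<Pi>\<^sub>M i\<in>I. gaussian (k i) w" using assms by (intro prob_space_PiM_gaussian)
  define cv where "cv = (1 / sqrt (2 * pi * v)) ^ card I * exp (- a / (2 * v))"
  define cw where "cw = (1 / sqrt (2 * pi * w)) ^ card I * exp (- b / (2 * w))"
  have pos: "cv > 0" "cw > 0" using assms by (auto simp: cv_def cw_def)
  have "ennreal (cw / cv) * emeasure (\<Pi>\<^sub>M i\<in>I. gaussian (m i) v) E
      \<le> ennreal (cw / cv) * (ennreal cv * emeasure (\<Pi>\<^sub>M i\<in>I. lborel) E)"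
    unfolding cv_def using assms(1,2) E a by (intro mult_left_mono emeasure_PiM_gaussian_le) auto
  also have "\<dots> = ennreal cw * emeasure (\<Pi>\<^sub>M i\<in>I. lborel) E"
    using pos by (simp add: mult.assoc[symmetric] ennreal_mult[symmetric])
  also have "\<dots> \<le> emeasure (\<Pi>\<^sub>M i\<in>I. gaussian (k i) w) E"
    unfolding cw_def using assms(1,3) E b by (intro emeasure_PiM_gaussian_ge) auto
  finally have "cw / cv * measure (\<Pi>\<^sub>M i\<in>I. gaussian (m i) v) E \<le> measure (\<Pi>\<^sub>M i\<in>I. gaussian (k i) w) E"
    using pos by (simp add: V.emeasure_eq_measure W.emeasure_eq_measure ennreal_mult[symmetric])
  moreover have "cw / cv = sqrt (v / w) ^ card I * exp (a / (2 * v) - b / (2 * w))"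
  proof -
    have "cw / cv = ((1 / sqrt (2 * pi * w)) / (1 / sqrt (2 * pi * v))) ^ card I
        * (exp (- b / (2 * w)) / exp (- a / (2 * v)))"
      by (simp only: cw_def cv_def power_divide times_divide_times_eq)
    also have "(1 / sqrt (2 * pi * w)) / (1 / sqrt (2 * pi * v)) = sqrt (v / w)"
      by (simp add: real_sqrt_mult real_sqrt_divide)
    also have "exp (- b / (2 * w)) / exp (- a / (2 * v)) = exp (a / (2 * v) - b / (2 * w))"
      by (simp add: exp_diff[symmetric])
    finally show ?thesis .
  qed
  ultimately show ?thesis by simp
qed

text \<open>With \<open>w = 1 - s\<^sup>2\<close>, the vectors \<open>u\<close> with independent entries \<open>N(w x\<^sub>i, w s\<^sup>2)\<close> concentrate
  where \<open>\<bar>u\<bar>\<^sup>2 \<approx> n w\<close> and \<open>\<bar>x - u\<bar>\<^sup>2 \<approx> n s\<^sup>2\<close>; this is the optimal test channel for Gaussian rate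
  distortion, and there the density with respect to \<open>N(0, w)\<close> is about \<open>s ^ (- n)\<close>.\<close>

lemma gaussian_cap:
  fixes s \<delta> :: real
  assumes "0 < s" "s < 1" "\<delta> > 0"
  defines "w \<equiv> 1 - s\<^sup>2"
  defines "K \<equiv> 3 / (2 * w) + 1 / (2 * w * s\<^sup>2)"
  shows "\<exists>n0. \<forall>n\<ge>n0. \<forall>x. (\<Sum>i<n. (x i)\<^sup>2) \<le> real n \<longrightarrow>
    1 / 2 * (s * exp (- K * \<delta>)) ^ n \<le> measure (\<Pi>\<^sub>M i\<in>{..<n}. gaussian 0 w)
      {u \<in> space (\<Pi>\<^sub>M i\<in>{..<n}. lborel). (\<Sum>i<n. (x i - u i)\<^sup>2) \<le> real n * (s\<^sup>2 + 3 * \<delta>)}"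
proof -
  have "w > 0" "w < 1"
    using assms(1,2) by (simp_all add: w_def power_less_one_iff abs_square_less_1)
  \<comment> \<open>The conditional variance in the test channel; the mean is
    \<open>w * x i\<close>.\<close>
  define v where "v = w * s\<^sup>2"
  have "v > 0" using \<open>w > 0\<close> \<open>0 < s\<close> by (simp add: v_def)
  \<comment> \<open>The two ceilings make each of the two Chebyshev bounds below at most 1/4,
    leaving probability 1/2 for \<open>E\<close>.\<close>
  define n0 where "n0 = nat \<lceil>8 * v\<^sup>2 / \<delta>\<^sup>2\<rceil> + nat \<lceil>4 * v / \<delta>\<^sup>2\<rceil> + 1"
  have n0: "n0 > 0" "real n0 \<ge> 8 * v\<^sup>2 / \<delta>\<^sup>2" "real n0 \<ge> 4 * v / \<delta>\<^sup>2"
    using real_nat_ceiling_ge[of "8 * v\<^sup>2 / \<delta>\<^sup>2"] real_nat_ceiling_ge[of "4 * v / \<delta>\<^sup>2"]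
    unfolding n0_def of_nat_add by linarith+
  show ?thesis
  proof (intro exI[of _ n0] allI impI)
    fix n :: nat and x :: "nat \<Rightarrow> real"
    assume "n0 \<le> n" and x: "(\<Sum>i<n. (x i)\<^sup>2) \<le> real n"
    have "n > 0" and n: "real n \<ge> 8 * v\<^sup>2 / \<delta>\<^sup>2" "real n \<ge> 4 * v / \<delta>\<^sup>2"
      using n0 \<open>n0 \<le> n\<close> by linarith+
    let ?L = "\<Pi>\<^sub>M i\<in>{..<n}. (lborel :: real measure)"
    let ?G = "\<Pi>\<^sub>M i\<in>{..<n}. gaussian (w * x i) v"
    interpret G: prob_space ?G using \<open>v > 0\<close> by (rule prob_space_PiM_gaussian)
    interpret W: prob_space "\<Pi>\<^sub>M i\<in>{..<n}. gaussian 0 w" using \<open>w > 0\<close> by (intro prob_space_PiM prob_space_gaussian)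
    have sp: "space ?G = space ?L" by (rule sets_eq_imp_space_eq[OF sets_PiM_gaussian])
    \<comment> \<open>Both \<open>\<bar>u\<bar>^2\<close> and \<open>\<bar>x - u\<bar>^2\<close> are
      expanded around \<open>u = w x\<close>. Outside \<open>A\<close> the quadratic term is under
      control, outside \<open>B\<close> the cross term is.\<close>
    define A where "A = {u \<in> space ?G. real n * \<delta> \<le> \<bar>\<Sum>i<n. ((u i - w * x i)\<^sup>2 - v)\<bar>}"
    define B where "B = {u \<in> space ?G. real n * \<delta> \<le> \<bar>\<Sum>i<n. x i * (u i - w * x i)\<bar>}"
    define E where "E = space ?G - (A \<union> B)"
    have AB: "A \<in> G.events" "B \<in> G.events"
      unfolding A_def B_def by measurable
    then have "E \<in> G.events" unfolding E_def by auto
    then have E: "E \<in> sets ?L" by (simp add: sets_PiM_gaussian)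
    have sq: "((y - m)\<^sup>2 - v)\<^sup>2 = (y - m) ^ 4 - 2 * v * (y - m)\<^sup>2 + v\<^sup>2" for y m :: real
    proof -
      have "(z\<^sup>2 - v)\<^sup>2 = z ^ 4 - 2 * v * z\<^sup>2 + v\<^sup>2" for z :: real
        by (simp add: power2_eq_square power4_eq_xxxx algebra_simps)
      then show ?thesis .
    qed
    have sq_dev: "integrable (gaussian m v) (\<lambda>y. (y - m)\<^sup>2 - v)"
        "(\<integral>y. (y - m)\<^sup>2 - v \<partial>gaussian m v) = 0"
        "integrable (gaussian m v) (\<lambda>y. ((y - m)\<^sup>2 - v)\<^sup>2)"
        "(\<integral>y. ((y - m)\<^sup>2 - v)\<^sup>2 \<partial>gaussian m v) = 2 * v\<^sup>2" for m
    proof -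
      note m2 = gaussian_moment_2[OF \<open>v > 0\<close>, of m] and m4 = gaussian_moment_4[OF \<open>v > 0\<close>, of m]
      interpret g: prob_space "gaussian m v" using \<open>v > 0\<close> by (rule prob_space_gaussian)
      show "integrable (gaussian m v) (\<lambda>y. (y - m)\<^sup>2 - v)"
        "(\<integral>y. (y - m)\<^sup>2 - v \<partial>gaussian m v) = 0"
        "integrable (gaussian m v) (\<lambda>y. ((y - m)\<^sup>2 - v)\<^sup>2)"
        "(\<integral>y. ((y - m)\<^sup>2 - v)\<^sup>2 \<partial>gaussian m v) = 2 * v\<^sup>2"
        unfolding sq using m2 m4 g.prob_space by (simp_all add: power2_eq_square)
    qed
    have "G.prob A \<le> (real n * (2 * v\<^sup>2)) / (real n * \<delta>)\<^sup>2"
      unfolding A_def using \<open>n > 0\<close> \<open>\<delta> > 0\<close> \<open>v > 0\<close>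
      by (intro chebyshev_PiM) (auto simp: sq_dev prob_space_gaussian)
    also have "\<dots> \<le> 1 / 4"
      using \<open>n > 0\<close> \<open>\<delta> > 0\<close> n(1) by (simp add: field_simps power2_eq_square)
    finally have A: "G.prob A \<le> 1 / 4" .
    have "G.prob B \<le> (real n * v) / (real n * \<delta>)\<^sup>2"
      unfolding B_def
    proof (rule chebyshev_PiM)
      fix i
      note m1 = gaussian_moment_1[OF \<open>v > 0\<close>, of "w * x i"] and m2 = gaussian_moment_2[OF \<open>v > 0\<close>, of "w * x i"]
      show "prob_space (gaussian (w * x i) v)" using \<open>v > 0\<close> by (rule prob_space_gaussian)
      show "integrable (gaussian (w * x i) v) (\<lambda>y. x i * (y - w * x i))"
        "(\<integral>y. x i * (y - w * x i) \<partial>gaussian (w * x i) v) = 0"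
        "integrable (gaussian (w * x i) v) (\<lambda>y. (x i * (y - w * x i))\<^sup>2)"
        using m1 m2 by (simp_all add: power_mult_distrib)
    next
      have "(\<Sum>i<n. \<integral>y. (x i * (y - w * x i))\<^sup>2 \<partial>gaussian (w * x i) v) = (\<Sum>i<n. (x i)\<^sup>2) * v"
        using gaussian_moment_2[OF \<open>v > 0\<close>] by (simp add: power_mult_distrib sum_distrib_right)
      also have "\<dots> \<le> real n * v" using x \<open>v > 0\<close> by (intro mult_right_mono) auto
      finally show "(\<Sum>i<n. \<integral>y. (x i * (y - w * x i))\<^sup>2 \<partial>gaussian (w * x i) v) \<le> real n * v" .
    qed (use \<open>n > 0\<close> \<open>\<delta> > 0\<close> in auto)
    also have "\<dots> \<le> 1 / 4"
      using \<open>n > 0\<close> \<open>\<delta> > 0\<close> n(2) by (simp add: field_simps power2_eq_square)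
    finally have B: "G.prob B \<le> 1 / 4" .
    have "G.prob E = 1 - G.prob (A \<union> B)"
      unfolding E_def using AB by (intro G.prob_compl) auto
    moreover have "G.prob (A \<union> B) \<le> G.prob A + G.prob B"
      using AB by (intro measure_Un_le)
    ultimately have PE: "1 / 2 \<le> G.prob E" using A B by linarith
    have in_E: "real n * v - real n * \<delta> \<le> (\<Sum>i<n. (u i - w * x i)\<^sup>2)"
      "(\<Sum>i<n. (u i)\<^sup>2) \<le> real n * w + 3 * real n * \<delta>"
      "(\<Sum>i<n. (x i - u i)\<^sup>2) \<le> real n * (s\<^sup>2 + 3 * \<delta>)" if "u \<in> E" for u
    proof -
      define X where "X = (\<Sum>i<n. (x i)\<^sup>2)"
      define Z where "Z = (\<Sum>i<n. (u i - w * x i)\<^sup>2)"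
      define C where "C = (\<Sum>i<n. x i * (u i - w * x i))"
      have "0 \<le> X" "X \<le> real n" using x by (auto simp: X_def intro: sum_nonneg)
      have Z: "\<bar>Z - real n * v\<bar> \<le> real n * \<delta>" and C: "\<bar>C\<bar> \<le> real n * \<delta>"
        using that by (auto simp: E_def A_def B_def Z_def C_def sum_subtractf)
      show "real n * v - real n * \<delta> \<le> Z" using Z by linarith
      have "(\<Sum>i<n. (u i)\<^sup>2) = (\<Sum>i<n. w\<^sup>2 * (x i)\<^sup>2 + (u i - w * x i)\<^sup>2 + 2 * w * (x i * (u i - w * x i)))"
        by (intro sum.cong) (auto simp: power2_eq_square algebra_simps)
      also have "\<dots> = w\<^sup>2 * X + Z + 2 * w * C"
        by (simp add: X_def Z_def C_def sum.distrib sum_distrib_left)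
      also have "w\<^sup>2 * X \<le> w\<^sup>2 * real n" using \<open>X \<le> real n\<close> by (intro mult_left_mono) auto
      also have "2 * w * C \<le> 2 * w * (real n * \<delta>)" using C \<open>w > 0\<close> by (intro mult_left_mono) auto
      also have "2 * w * (real n * \<delta>) \<le> 2 * 1 * (real n * \<delta>)"
        using \<open>w < 1\<close> \<open>\<delta> > 0\<close> by (intro mult_right_mono mult_left_mono) auto
      also have "Z \<le> real n * v + real n * \<delta>" using Z by linarith
      finally have "(\<Sum>i<n. (u i)\<^sup>2) \<le> w\<^sup>2 * real n + (real n * v + real n * \<delta>) + 2 * 1 * (real n * \<delta>)" by simp
      also have "\<dots> = real n * w + 3 * real n * \<delta>"
        unfolding v_def w_def by (simp add: power2_eq_square algebra_simps)
      finally show "(\<Sum>i<n. (u i)\<^sup>2) \<le> real n * w + 3 * real n * \<delta>" .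
      have s2: "s\<^sup>2 = 1 - w" "0 \<le> s\<^sup>2" "s\<^sup>2 \<le> 1" using \<open>w > 0\<close> by (simp_all add: w_def)
      \<comment> \<open>Uses \<open>x - u = s^2 x - (u - w x)\<close>; the leading terms add up to
        \<open>s^4 + w s^2 = s^2\<close>, as those of \<open>\<bar>u\<bar>^2\<close> did to
        \<open>w^2 + w s^2 = w\<close>.\<close>
      have "(\<Sum>i<n. (x i - u i)\<^sup>2)
          = (\<Sum>i<n. (s\<^sup>2)\<^sup>2 * (x i)\<^sup>2 + (u i - w * x i)\<^sup>2 - 2 * (s\<^sup>2 * (x i * (u i - w * x i))))"
        unfolding s2(1) by (intro sum.cong) (auto simp: power2_eq_square algebra_simps)
      also have "\<dots> = (s\<^sup>2)\<^sup>2 * X + Z - 2 * (s\<^sup>2 * C)"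
        unfolding X_def Z_def C_def by (simp add: sum.distrib sum_subtractf sum_distrib_left sum_negf)
      also have "\<dots> \<le> (s\<^sup>2)\<^sup>2 * real n + (real n * v + real n * \<delta>) + 2 * (real n * \<delta>)"
      proof -
        have "s\<^sup>2 * \<bar>C\<bar> \<le> 1 * (real n * \<delta>)" using C s2 by (intro mult_mono) auto
        moreover have "- (s\<^sup>2 * C) \<le> s\<^sup>2 * \<bar>C\<bar>"
          using abs_ge_minus_self[of "s\<^sup>2 * C"] by (simp only: abs_mult abs_power2)
        moreover have "(s\<^sup>2)\<^sup>2 * X \<le> (s\<^sup>2)\<^sup>2 * real n"
          using \<open>X \<le> real n\<close> by (intro mult_left_mono) auto
        ultimately show ?thesis using Z by linarith
      qed
      also have "(s\<^sup>2)\<^sup>2 * real n + (real n * v + real n * \<delta>) + 2 * (real n * \<delta>)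
          = real n * s\<^sup>2 * (s\<^sup>2 + w) + 3 * (real n * \<delta>)"
        by (simp add: v_def power2_eq_square[of "s\<^sup>2"] distrib_left mult_ac)
      also have "s\<^sup>2 + w = 1" by (simp add: w_def)
      also have "real n * s\<^sup>2 * 1 + 3 * (real n * \<delta>) = real n * (s\<^sup>2 + 3 * \<delta>)"
        by (simp add: distrib_left mult_ac)
      finally show "(\<Sum>i<n. (x i - u i)\<^sup>2) \<le> real n * (s\<^sup>2 + 3 * \<delta>)" .
    qed
    have "sqrt (v / w) ^ card {..<n} * exp ((real n * v - real n * \<delta>) / (2 * v) - (real n * w + 3 * real n * \<delta>) / (2 * w))
         * G.prob E \<le> W.prob E"
      using in_E by (intro measure_PiM_gaussian_change[OF _ \<open>v > 0\<close> \<open>w > 0\<close> E]) auto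
    moreover have "sqrt (v / w) = s" using \<open>w > 0\<close> \<open>0 < s\<close> by (simp add: v_def)
    \<comment> \<open>The main terms \<open>n / 2\<close> cancel, and \<open>K\<close> collects the
      two losses: \<open>1 / (2 v)\<close> from the distance to \<open>w x\<close> and
      \<open>3 / (2 w)\<close> from the length of \<open>u\<close>.\<close>
    moreover have "(real n * v - real n * \<delta>) / (2 * v) - (real n * w + 3 * real n * \<delta>) / (2 * w) = real n * (- K * \<delta>)"
      using \<open>w > 0\<close> \<open>0 < s\<close> unfolding K_def v_def by (simp add: field_simps)
    ultimately have "(s * exp (- K * \<delta>)) ^ n * G.prob E \<le> W.prob E"
      by (simp add: power_mult_distrib exp_of_nat_mult[symmetric])
    moreover have "(s * exp (- K * \<delta>)) ^ n * (1 / 2) \<le> (s * exp (- K * \<delta>)) ^ n * G.prob E"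
      using PE \<open>0 < s\<close> by (intro mult_left_mono) auto
    moreover have "W.prob E \<le> W.prob {u \<in> space ?L. (\<Sum>i<n. (x i - u i)\<^sup>2) \<le> real n * (s\<^sup>2 + 3 * \<delta>)}"
    proof (rule W.finite_measure_mono)
      show "E \<subseteq> {u \<in> space ?L. (\<Sum>i<n. (x i - u i)\<^sup>2) \<le> real n * (s\<^sup>2 + 3 * \<delta>)}"
        using in_E(3) by (auto simp: E_def sp)
      show "{u \<in> space ?L. (\<Sum>i<n. (x i - u i)\<^sup>2) \<le> real n * (s\<^sup>2 + 3 * \<delta>)} \<in> W.events"
        unfolding sets_PiM_gaussian by measurable
    qed
    ultimately show "1 / 2 * (s * exp (- K * \<delta>)) ^ n
        \<le> W.prob {u \<in> space ?L. (\<Sum>i<n. (x i - u i)\<^sup>2) \<le> real n * (s\<^sup>2 + 3 * \<delta>)}"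
      by simp
  qed
qed

section \<open>Covering a ball by smaller balls\<close>

text \<open>First moment method: a random \<open>u\<close> covers at least \<open>p * card N\<close>
  points on average, so some \<open>u\<close> covers that many.\<close>

lemma ex_card_ge_average:
  assumes "prob_space P" "finite N"
    and "\<And>x. x \<in> N \<Longrightarrow> {u \<in> space P. C u x} \<in> sets P"
    and p: "\<And>x. x \<in> N \<Longrightarrow> p \<le> measure P {u \<in> space P. C u x}"
  shows "\<exists>u. p * real (card N) \<le> real (card {x \<in> N. C u x})"
proof (rule ccontr)
  assume "\<not> ?thesis"
  then have less: "real (card {x \<in> N. C u x}) < p * real (card N)" for u by (simp add: not_le)
  interpret prob_space P by fact
  have int: "integrable P (indicator {u \<in> space P. C u x} :: _ \<Rightarrow> real)" if "x \<in> N" for x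
    using assms(3)[OF that] by (simp add: emeasure_eq_measure)
  have count: "(\<Sum>x\<in>N. indicator {u \<in> space P. C u x} u) = real (card {x \<in> N. C u x})"
    if "u \<in> space P" for u
    using that \<open>finite N\<close> by (simp add: indicator_def of_bool_def sum.If_cases Int_def)
  have "p * real (card N) \<le> (\<Sum>x\<in>N. prob {u \<in> space P. C u x})"
    using p sum_bounded_below[of N p "\<lambda>x. prob {u \<in> space P. C u x}"] by (simp add: mult.commute)
  also have "\<dots> = expectation (\<lambda>u. \<Sum>x\<in>N. indicator {u \<in> space P. C u x} u)"
    using int assms(3) by (subst Bochner_Integration.integral_sum) auto
  also have "\<dots> < p * real (card N)"
    using int less count by (intro expectation_less) (auto intro!: Bochner_Integration.integrable_sum)
  finally show False by simp
qed

text \<open>Each new centre is chosen for the points still uncovered and removes at least the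
  fraction \<open>p\<close> of them; this is why \<open>avg\<close> is required for all subsets of
  \<open>N\<close>.\<close>

lemma greedy_cover:
  fixes p :: real
  assumes "finite N" "0 \<le> p" "p \<le> 1"
    and avg: "\<And>N'. N' \<subseteq> N \<Longrightarrow> \<exists>u. p * real (card N') \<le> real (card {x \<in> N'. C u x})"
  shows "\<exists>U. finite U \<and> card U \<le> M \<and> real (card {x \<in> N. \<forall>u\<in>U. \<not> C u x}) \<le> (1 - p) ^ M * real (card N)"
proof (induction M)
  case 0
  show ?case by (intro exI[of _ "{}"]) simp
next
  case (Suc M)
  then obtain U where U: "finite U" "card U \<le> M"
    and le: "real (card {x \<in> N. \<forall>u\<in>U. \<not> C u x}) \<le> (1 - p) ^ M * real (card N)" by blast
  define N' where "N' = {x \<in> N. \<forall>u\<in>U. \<not> C u x}"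
  have "finite N'" using \<open>finite N\<close> by (simp add: N'_def)
  obtain u where u: "p * real (card N') \<le> real (card {x \<in> N'. C u x})"
    using avg[of N'] by (auto simp: N'_def)
  have "{x \<in> N. \<forall>u\<in>insert u U. \<not> C u x} = N' - {x \<in> N'. C u x}" by (auto simp: N'_def)
  moreover have "real (card (N' - {x \<in> N'. C u x})) = real (card N') - real (card {x \<in> N'. C u x})"
    using \<open>finite N'\<close> by (subst card_Diff_subset) (auto intro!: of_nat_diff card_mono)
  ultimately have "real (card {x \<in> N. \<forall>u\<in>insert u U. \<not> C u x}) \<le> (1 - p) * real (card N')"
    using u by (simp add: algebra_simps)
  also have "\<dots> \<le> (1 - p) * ((1 - p) ^ M * real (card N))"
    using le \<open>p \<le> 1\<close> unfolding N'_def by (intro mult_left_mono) auto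
  finally have "real (card {x \<in> N. \<forall>u\<in>insert u U. \<not> C u x}) \<le> (1 - p) ^ Suc M * real (card N)" by simp
  moreover have "card (insert u U) \<le> Suc M" using U by (simp add: card_insert_if)
  ultimately show ?case using U(1) by (intro exI[of _ "insert u U"]) auto
qed

text \<open>Points of the grid of mesh \<rho>, reached by rounding every coordinate towards zero.
  Rounding in this direction does not increase the length, so the net stays inside the ball, where
  \<open>gaussian_cap\<close> applies.\<close>

lemma grid_net:
  fixes \<rho> :: real
  assumes "\<rho> > 0"
  shows "\<exists>N. finite N \<and> real (card N) \<le> (2 * real n / \<rho> + 1) ^ n \<and>
    (\<forall>z\<in>N. (\<Sum>i<n. (z i)\<^sup>2) \<le> real n) \<and>
    (\<forall>x. (\<Sum>i<n. (x i)\<^sup>2) \<le> real n \<longrightarrow> (\<exists>z\<in>N. (\<Sum>i<n. (x i - z i)\<^sup>2) \<le> real n * \<rho>\<^sup>2))"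
proof -
  define K where "K = \<lfloor>real n / \<rho>\<rfloor>"
  have "K \<ge> 0" using \<open>\<rho> > 0\<close> by (simp add: K_def)
  define G where "G = (\<lambda>k. \<rho> * real_of_int k) ` {-K..K}"
  define N where "N = {z \<in> (\<Pi>\<^sub>E i\<in>{..<n}. G). (\<Sum>i<n. (z i)\<^sup>2) \<le> real n}"
  have "finite G" by (simp add: G_def)
  then have fin: "finite (\<Pi>\<^sub>E i\<in>{..<n}. G)" by (intro finite_PiE) auto
  have "real (card G) \<le> real (card {-K..K})"
    unfolding G_def by (intro of_nat_mono card_image_le) auto
  also have "\<dots> = 2 * real_of_int K + 1" using \<open>K \<ge> 0\<close> by simp
  also have "\<dots> \<le> 2 * real n / \<rho> + 1" unfolding K_def using of_int_floor_le[of "real n / \<rho>"] by linarith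
  finally have G: "real (card G) \<le> 2 * real n / \<rho> + 1" .
  have "card N \<le> card (\<Pi>\<^sub>E i\<in>{..<n}. G)" unfolding N_def using fin by (intro card_mono) auto
  also have "\<dots> = card G ^ n" by (simp add: card_PiE)
  finally have "real (card N) \<le> real (card G) ^ n" by (metis of_nat_le_iff of_nat_power)
  also have "\<dots> \<le> (2 * real n / \<rho> + 1) ^ n" using G by (intro power_mono) auto
  finally have card: "real (card N) \<le> (2 * real n / \<rho> + 1) ^ n" .
  moreover have "\<exists>z\<in>N. (\<Sum>i<n. (x i - z i)\<^sup>2) \<le> real n * \<rho>\<^sup>2" if x: "(\<Sum>i<n. (x i)\<^sup>2) \<le> real n" for x
  proof -
    define k where "k i = (if 0 \<le> x i then \<lfloor>\<bar>x i\<bar> / \<rho>\<rfloor> else - \<lfloor>\<bar>x i\<bar> / \<rho>\<rfloor>)" for i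
    define z where "z = (\<lambda>i\<in>{..<n}. \<rho> * real_of_int (k i))"
    have fl: "\<rho> * real_of_int \<lfloor>\<bar>x i\<bar> / \<rho>\<rfloor> \<le> \<bar>x i\<bar>" "\<bar>x i\<bar> \<le> \<rho> * real_of_int \<lfloor>\<bar>x i\<bar> / \<rho>\<rfloor> + \<rho>"
      "0 \<le> \<rho> * real_of_int \<lfloor>\<bar>x i\<bar> / \<rho>\<rfloor>" for i
    proof -
      show "\<rho> * real_of_int \<lfloor>\<bar>x i\<bar> / \<rho>\<rfloor> \<le> \<bar>x i\<bar>"
        using mult_left_mono[OF of_int_floor_le[of "\<bar>x i\<bar> / \<rho>"], of \<rho>] \<open>\<rho> > 0\<close> by simp
      show "\<bar>x i\<bar> \<le> \<rho> * real_of_int \<lfloor>\<bar>x i\<bar> / \<rho>\<rfloor> + \<rho>"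
        using mult_left_mono[OF real_of_int_floor_add_one_ge[of "\<bar>x i\<bar> / \<rho>"], of \<rho>] \<open>\<rho> > 0\<close>
        by (simp add: distrib_left)
      show "0 \<le> \<rho> * real_of_int \<lfloor>\<bar>x i\<bar> / \<rho>\<rfloor>" using \<open>\<rho> > 0\<close> by simp
    qed
    have k_abs: "\<bar>\<rho> * real_of_int (k i)\<bar> \<le> \<bar>x i\<bar>" and k_close: "\<bar>x i - \<rho> * real_of_int (k i)\<bar> \<le> \<rho>" for i
    proof -
      have "\<rho> * real_of_int (k i) = (if 0 \<le> x i then \<rho> * real_of_int \<lfloor>\<bar>x i\<bar> / \<rho>\<rfloor> else - (\<rho> * real_of_int \<lfloor>\<bar>x i\<bar> / \<rho>\<rfloor>))"
        by (simp add: k_def)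
      then show "\<bar>\<rho> * real_of_int (k i)\<bar> \<le> \<bar>x i\<bar>" "\<bar>x i - \<rho> * real_of_int (k i)\<bar> \<le> \<rho>"
        using fl[of i] by (smt (verit))+
    qed
    have x_le: "\<bar>x i\<bar> \<le> real n" if "i < n" for i
    proof -
      have "(x i)\<^sup>2 \<le> (\<Sum>i<n. (x i)\<^sup>2)" using that by (intro member_le_sum) auto
      also have "\<dots> \<le> real n" by (rule x)
      \<comment> \<open>Bounding each entry by \<open>n\<close> instead of \<open>sqrt n\<close> is
        wasteful but harmless: the size of the net stays \<open>exp (O (n log n))\<close>.\<close>
      also have "\<dots> \<le> (real n)\<^sup>2" using that by (simp add: power2_eq_square)
      finally show ?thesis using abs_le_square_iff[of "x i" "real n"] by simp
    qed
    have "k i \<in> {-K..K}" if "i < n" for i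
    proof -
      define F where "F = \<lfloor>\<bar>x i\<bar> / \<rho>\<rfloor>"
      have "F \<le> K"
        unfolding K_def F_def using x_le[OF that] \<open>\<rho> > 0\<close> by (intro floor_mono divide_right_mono) auto
      moreover have "0 \<le> F" using \<open>\<rho> > 0\<close> by (simp add: F_def)
      moreover have "k i = F \<or> k i = - F" by (simp add: k_def F_def)
      ultimately show ?thesis by auto
    qed
    then have "z \<in> (\<Pi>\<^sub>E i\<in>{..<n}. G)" by (auto simp: z_def G_def)
    moreover have "(\<Sum>i<n. (z i)\<^sup>2) \<le> (\<Sum>i<n. (x i)\<^sup>2)"
      using k_abs by (intro sum_mono) (auto simp: z_def abs_le_square_iff[symmetric])
    ultimately have "z \<in> N" using x by (simp add: N_def)
    moreover have "(\<Sum>i<n. (x i - z i)\<^sup>2) \<le> (\<Sum>i<n. \<rho>\<^sup>2)"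
      using k_close \<open>\<rho> > 0\<close> by (intro sum_mono) (auto simp: z_def abs_le_square_iff[symmetric])
    ultimately show ?thesis by auto
  qed
  ultimately show ?thesis
    using fin by (intro exI[of _ N]) (auto simp: N_def)
qed

text \<open>A finite net has only \<open>exp (O (n log n))\<close> points, while the greedy choice leaves a fraction
  \<open>(1 - p) ^ M \<le> exp (- p M)\<close> of it uncovered, and \<open>p M\<close> grows exponentially in \<open>n\<close>.\<close>

lemma ball_covering:
  fixes r R :: real
  assumes "r < 1" "2 powr (- R) < r"
  shows "eventually (\<lambda>n. \<exists>U. finite U \<and> real (card U) + 1 \<le> 2 powr (real n * R) \<and>
    (\<forall>x. (\<Sum>i<n. (x i)\<^sup>2) \<le> real n \<longrightarrow> (\<exists>u\<in>U. (\<Sum>i<n. (x i - u i)\<^sup>2) \<le> real n * r\<^sup>2))) sequentially"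
proof -
  \<comment> \<open>Three radii share the room below \<open>r\<close>: caps have radius
    \<open>s\<close> up to an error, \<open>q\<close> absorbs that error, and \<rho> is the
    resolution of the net, with \<open>q + \<rho> = r\<close>.\<close>
  obtain s where s: "2 powr (- R) < s" "s < r" using assms(2) dense by blast
  have "0 < s" "s < 1" using s(1) powr_gt_zero[of 2 "- R"] s(2) assms(1) by linarith+
  define w where "w = 1 - s\<^sup>2"
  have "w > 0" using \<open>0 < s\<close> \<open>s < 1\<close> by (simp add: w_def abs_square_less_1)
  define K where "K = 3 / (2 * w) + 1 / (2 * w * s\<^sup>2)"
  have "K > 0" unfolding K_def using \<open>w > 0\<close> \<open>0 < s\<close> by (intro add_pos_pos) auto
  define \<rho> where "\<rho> = (r - s) / 2"
  define q where "q = (r + s) / 2"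
  have "\<rho> > 0" "s < q" "q + \<rho> = r" using s(2) by (auto simp: \<rho>_def q_def field_simps)
  have sR: "s * 2 powr R > 1" using s(1) by (simp add: powr_minus field_simps)
  \<comment> \<open>The first entry keeps the cap radius below \<open>q\<close>. The second lets the
    exponential loss \<open>K * \<delta>\<close> use up at most half of the surplus
    \<open>ln (s * 2 powr R)\<close>.\<close>
  define \<delta> where "\<delta> = min ((q\<^sup>2 - s\<^sup>2) / 3) (ln (s * 2 powr R) / (2 * K))"
  have "s\<^sup>2 < q\<^sup>2" using \<open>0 < s\<close> \<open>s < q\<close> by (intro power_strict_mono) auto
  then have "\<delta> > 0" unfolding \<delta>_def using sR \<open>K > 0\<close> by simp
  have "\<delta> \<le> (q\<^sup>2 - s\<^sup>2) / 3" unfolding \<delta>_def by (rule min.cobounded1)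
  then have \<delta>q: "s\<^sup>2 + 3 * \<delta> \<le> q\<^sup>2" by simp
  define W where "W = s * exp (- K * \<delta>) * 2 powr R"
  have "W > 1"
  proof -
    have "K * \<delta> \<le> K * (ln (s * 2 powr R) / (2 * K))" unfolding \<delta>_def using \<open>K > 0\<close> by (intro mult_left_mono) auto
    also have "\<dots> = ln (s * 2 powr R) / 2" using \<open>K > 0\<close> by simp
    also have "\<dots> < ln (s * 2 powr R)" using sR by simp
    finally have "exp (K * \<delta>) < exp (ln (s * 2 powr R))" by simp
    also have "\<dots> = s * 2 powr R" using sR by simp
    finally show ?thesis unfolding W_def by (simp add: exp_minus field_simps)
  qed
  obtain n0 where n0: "\<And>n x. n \<ge> n0 \<Longrightarrow> (\<Sum>i<n. (x i)\<^sup>2) \<le> real n \<Longrightarrow>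
    1 / 2 * (s * exp (- K * \<delta>)) ^ n \<le> measure (\<Pi>\<^sub>M i\<in>{..<n}. gaussian 0 w)
      {u \<in> space (\<Pi>\<^sub>M i\<in>{..<n}. lborel). (\<Sum>i<n. (x i - u i)\<^sup>2) \<le> real n * (s\<^sup>2 + 3 * \<delta>)}"
    using gaussian_cap[OF \<open>0 < s\<close> \<open>s < 1\<close> \<open>\<delta> > 0\<close>] unfolding w_def[symmetric] K_def[symmetric] by blast
  \<comment> \<open>The left side bounds the logarithm of the size of the net; the right side is a
    lower bound for \<open>p * M\<close>.\<close>
  have "eventually (\<lambda>n. real n * ln (2 * real n / \<rho> + 1) < W ^ n / 2 - 1) sequentially"
    using \<open>W > 1\<close> \<open>\<rho> > 0\<close> by real_asymp
  moreover have "eventually (\<lambda>n. n \<ge> max 1 n0) sequentially" by (rule eventually_ge_at_top)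
  ultimately show ?thesis
  proof eventually_elim
    case (elim n)
    then have "n \<ge> 1" "n \<ge> n0" by auto
    let ?G = "\<Pi>\<^sub>M i\<in>{..<n}. gaussian 0 w"
    interpret G: prob_space ?G using \<open>w > 0\<close> by (intro prob_space_PiM prob_space_gaussian)
    have sets_G: "sets ?G = sets (\<Pi>\<^sub>M i\<in>{..<n}. lborel)" by (intro sets_PiM_cong) auto
    have space_G: "space ?G = space (\<Pi>\<^sub>M i\<in>{..<n}. lborel)" by (rule sets_eq_imp_space_eq[OF sets_G])
    obtain N where N: "finite N" "real (card N) \<le> (2 * real n / \<rho> + 1) ^ n"
      "\<And>z. z \<in> N \<Longrightarrow> (\<Sum>i<n. (z i)\<^sup>2) \<le> real n"
      "\<And>x. (\<Sum>i<n. (x i)\<^sup>2) \<le> real n \<Longrightarrow> \<exists>z\<in>N. (\<Sum>i<n. (x i - z i)\<^sup>2) \<le> real n * \<rho>\<^sup>2"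
      using grid_net[OF \<open>\<rho> > 0\<close>, of n] by blast
    define C where "C u x \<longleftrightarrow> (\<Sum>i<n. (x i - u i)\<^sup>2) \<le> real n * (s\<^sup>2 + 3 * \<delta>)" for u x :: "nat \<Rightarrow> real"
    define p where "p = 1 / 2 * (s * exp (- K * \<delta>)) ^ n"
    have pC: "p \<le> G.prob {u \<in> space ?G. C u z}" if "z \<in> N" for z
      unfolding p_def C_def space_G by (rule n0[OF \<open>n \<ge> n0\<close> N(3)[OF that]])
    have "p \<ge> 0" unfolding p_def using \<open>0 < s\<close> by simp
    have "N \<noteq> {}" using N(4)[of "\<lambda>_. 0"] by auto
    then have "p \<le> 1" using pC G.prob_le_1 order_trans by blast
    have meas: "{u \<in> space ?G. C u z} \<in> sets ?G" for z
      unfolding C_def sets_G space_G by measurable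
    \<comment> \<open>One index fewer than are available: the scheme reserves an index for vectors
      outside the covered set.\<close>
    define M where "M = nat \<lfloor>2 powr (real n * R)\<rfloor> - 1"
    have "1 \<le> 2 powr (real n * R)"
    proof -
      have "s * 2 powr R < 1 * 2 powr R" using \<open>s < 1\<close> by (intro mult_strict_right_mono) auto
      with sR have "1 < 2 powr R" by linarith
      then have "2 powr 0 < 2 powr R" by simp
      then have "0 < R" by (subst (asm) powr_less_cancel_iff) auto
      then show ?thesis by (simp add: ge_one_powr_ge_zero)
    qed
    then have M: "real M + 1 \<le> 2 powr (real n * R)" "2 powr (real n * R) - 2 \<le> real M"
      unfolding M_def by linarith+
    obtain U where U: "finite U" "card U \<le> M"
      and U_le: "real (card {x \<in> N. \<forall>u\<in>U. \<not> C u x}) \<le> (1 - p) ^ M * real (card N)"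
    proof -
      have "\<exists>u. p * real (card N') \<le> real (card {x \<in> N'. C u x})" if "N' \<subseteq> N" for N'
        by (rule ex_card_ge_average[OF G.prob_space_axioms finite_subset[OF that N(1)] meas])
          (use pC that in blast)
      from greedy_cover[OF N(1) \<open>p \<ge> 0\<close> \<open>p \<le> 1\<close> this, of M] show thesis
        using that by blast
    qed
    have "W ^ n / 2 - 1 \<le> p * (2 powr (real n * R) - 2)"
    proof -
      have "p * 2 powr (real n * R) = W ^ n / 2"
      proof -
        have "2 powr (real n * R) = (2 powr R) ^ n"
          by (simp add: powr_realpow[symmetric] powr_powr mult.commute)
        then show ?thesis by (simp add: p_def W_def power_mult_distrib)
      qed
      moreover have "p \<le> 1 / 2"
        using \<open>0 < s\<close> \<open>s < 1\<close> \<open>K > 0\<close> \<open>\<delta> > 0\<close> unfolding p_def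
        by (simp add: power_le_one mult_le_one)
      ultimately show ?thesis by (simp add: right_diff_distrib)
    qed
    also have "\<dots> \<le> p * real M" using M(2) \<open>p \<ge> 0\<close> by (intro mult_left_mono) auto
    finally have pM: "real n * ln (2 * real n / \<rho> + 1) < p * real M" using elim(1) by linarith
    have base_pos: "2 * real n / \<rho> + 1 > 0" using \<open>\<rho> > 0\<close> by (intro add_nonneg_pos) auto
    \<comment> \<open>By \<open>1 - p \<le> exp (- p)\<close> fewer than one point of the net is
      left uncovered, hence none.\<close>
    have "(1 - p) ^ M * real (card N) \<le> exp (- p) ^ M * (2 * real n / \<rho> + 1) ^ n"
      using \<open>p \<le> 1\<close> N(2) exp_ge_add_one_self[of "- p"] by (intro mult_mono power_mono) auto
    also have "\<dots> = exp (real n * ln (2 * real n / \<rho> + 1) - p * real M)"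
      using base_pos by (simp add: exp_diff exp_of_nat_mult exp_minus exp_of_nat2_mult field_simps)
    also have "\<dots> < 1" using pM by simp
    finally have "real (card {x \<in> N. \<forall>u\<in>U. \<not> C u x}) < 1" using U_le by linarith
    then have "{x \<in> N. \<forall>u\<in>U. \<not> C u x} = {}" using N(1) by simp
    then have cov: "\<exists>u\<in>U. C u z" if "z \<in> N" for z using that by blast
    show ?case
    proof (intro exI[of _ U] conjI allI impI)
      show "real (card U) + 1 \<le> 2 powr (real n * R)" using U(2) M(1) by linarith
      fix x :: "nat \<Rightarrow> real" assume "(\<Sum>i<n. (x i)\<^sup>2) \<le> real n"
      then obtain z where z: "z \<in> N" "(\<Sum>i<n. (x i - z i)\<^sup>2) \<le> real n * \<rho>\<^sup>2" using N(4) by blast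
      obtain u where u: "u \<in> U" "C u z" using cov z(1) by blast
      have "L2_set (\<lambda>i. x i - u i) {..<n} = L2_set (\<lambda>i. (x i - z i) + (z i - u i)) {..<n}" by simp
      also have "\<dots> \<le> L2_set (\<lambda>i. x i - z i) {..<n} + L2_set (\<lambda>i. z i - u i) {..<n}"
        by (rule L2_set_triangle_ineq)
      also have "L2_set (\<lambda>i. x i - z i) {..<n} \<le> sqrt (real n * \<rho>\<^sup>2)"
        unfolding L2_set_def using z(2) by simp
      also have "L2_set (\<lambda>i. z i - u i) {..<n} \<le> sqrt (real n * q\<^sup>2)"
      proof -
        have "(\<Sum>i<n. (z i - u i)\<^sup>2) \<le> real n * q\<^sup>2"
          using u(2) \<delta>q mult_left_mono[OF \<delta>q, of "real n"] unfolding C_def by linarith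
        then show ?thesis unfolding L2_set_def by simp
      qed
      also have "sqrt (real n * \<rho>\<^sup>2) + sqrt (real n * q\<^sup>2) = sqrt (real n) * r"
        using \<open>\<rho> > 0\<close> \<open>s < q\<close> \<open>0 < s\<close> \<open>q + \<rho> = r\<close> by (simp add: real_sqrt_mult ring_distribs[symmetric] add.commute)
      finally have "L2_set (\<lambda>i. x i - u i) {..<n} \<le> sqrt (real n) * r" by simp
      then have "(L2_set (\<lambda>i. x i - u i) {..<n})\<^sup>2 \<le> (sqrt (real n) * r)\<^sup>2"
        by (intro power_mono) auto
      then have "(\<Sum>i<n. (x i - u i)\<^sup>2) \<le> real n * r\<^sup>2"
        by (simp add: L2_set_def power_mult_distrib sum_nonneg)
      then show "\<exists>u\<in>U. (\<Sum>i<n. (x i - u i)\<^sup>2) \<le> real n * r\<^sup>2" using u(1) by blast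
    qed (rule U(1))
  qed
qed

section \<open>A universal scheme\<close>

lemma space_PiM_real:
  assumes "sets P = sets borel"
  shows "sets (\<Pi>\<^sub>M i\<in>I. P) = sets (\<Pi>\<^sub>M i\<in>I. borel :: real measure)"
    and "space (\<Pi>\<^sub>M i\<in>I. P) = space (\<Pi>\<^sub>M i\<in>I. borel :: real measure)"
proof -
  show "sets (\<Pi>\<^sub>M i\<in>I. P) = sets (\<Pi>\<^sub>M i\<in>I. borel :: real measure)"
    using assms by (intro sets_PiM_cong) auto
  then show "space (\<Pi>\<^sub>M i\<in>I. P) = space (\<Pi>\<^sub>M i\<in>I. borel :: real measure)"
    by (rule sets_eq_imp_space_eq)
qed

lemma answer_set_measurable:
  assumes "id_system R n T g" "sets PX = sets borel" "sets PY = sets borel"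
  shows "{(x, y) \<in> space ((\<Pi>\<^sub>M i\<in>{..<n}. PX) \<Otimes>\<^sub>M (\<Pi>\<^sub>M i\<in>{..<n}. PY)). g (T x) y = a}
    \<in> sets ((\<Pi>\<^sub>M i\<in>{..<n}. PX) \<Otimes>\<^sub>M (\<Pi>\<^sub>M i\<in>{..<n}. PY))" (is "_ \<in> sets ?M")
proof -
  have T: "T \<in> Rvec n \<rightarrow>\<^sub>M count_space (indices R n)"
    and g: "(\<lambda>(i, y). g i y) \<in> count_space (indices R n) \<Otimes>\<^sub>M Rvec n \<rightarrow>\<^sub>M count_space UNIV"
    using assms(1) by (auto simp: id_system_def)
  have eq: "sets ?M = sets (Rvec n \<Otimes>\<^sub>M Rvec n)"
    by (intro sets_pair_measure_cong space_PiM_real assms)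
  have "(\<lambda>(x, y). (T x, y)) \<in> Rvec n \<Otimes>\<^sub>M Rvec n \<rightarrow>\<^sub>M count_space (indices R n) \<Otimes>\<^sub>M Rvec n"
    using T by measurable
  from measurable_comp[OF this g]
  have "(\<lambda>(x, y). g (T x) y) \<in> Rvec n \<Otimes>\<^sub>M Rvec n \<rightarrow>\<^sub>M count_space UNIV"
    by (simp add: comp_def split_beta')
  then have "(\<lambda>(x, y). g (T x) y) -` {a} \<inter> space (Rvec n \<Otimes>\<^sub>M Rvec n) \<in> sets (Rvec n \<Otimes>\<^sub>M Rvec n)"
    by (rule measurable_sets) simp
  also have "(\<lambda>(x, y). g (T x) y) -` {a} \<inter> space (Rvec n \<Otimes>\<^sub>M Rvec n) = {(x, y) \<in> space ?M. g (T x) y = a}"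
    using sets_eq_imp_space_eq[OF eq] by auto
  finally show ?thesis by (simp only: eq)
qed

text \<open>Index \<open>1\<close> is sent for the vectors outside \<open>A\<close> and is always answered by \<open>Maybe\<close>;
  index \<open>i + 2\<close> stands for the cell \<open>C i\<close>, and \<open>N i\<close> is the set on which it is answered by \<open>No\<close>.\<close>

lemma quantizer_scheme:
  fixes A :: "(nat \<Rightarrow> real) set" and C N :: "nat \<Rightarrow> (nat \<Rightarrow> real) set"
  assumes m: "real m + 1 \<le> 2 powr (real n * R)"
    and A: "A \<in> sets (Rvec n)" and C: "\<And>i. i < m \<Longrightarrow> C i \<in> sets (Rvec n)"
    and N: "\<And>i. i < m \<Longrightarrow> N i \<in> sets (Rvec n)"
    and cov: "A \<subseteq> (\<Union>i<m. C i)"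
    and far: "\<And>i x y. i < m \<Longrightarrow> x \<in> A \<Longrightarrow> x \<in> C i \<Longrightarrow> y \<in> N i \<Longrightarrow> D < distortion n x y"
  shows "\<exists>T g. id_system R n T g \<and> admissible D n T g \<and>
    (\<forall>PX PY \<epsilon>. prob_space PX \<longrightarrow> prob_space PY \<longrightarrow> sets PX = sets borel \<longrightarrow> sets PY = sets borel \<longrightarrow>
      0 \<le> \<epsilon> \<longrightarrow> (\<forall>i<m. measure (\<Pi>\<^sub>M i\<in>{..<n}. PY) (space (Rvec n) - N i) \<le> \<epsilon>) \<longrightarrow>
      maybe_prob PX PY n T g \<le> measure (\<Pi>\<^sub>M i\<in>{..<n}. PX) (space (Rvec n) - A) + \<epsilon>)"
proof -
  \<comment> \<open>Cells may overlap; the least index of a cell containing \<open>x\<close> is a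
    measurable choice. Outside \<open>A\<close> the index is 1.\<close>
  define T where "T x = (if x \<in> A then (LEAST i. i < m \<and> x \<in> C i) + 2 else 1)" for x
  define g where "g i y = (if 2 \<le> i \<and> i < m + 2 \<and> y \<in> N (i - 2) then No else Maybe)" for i y
  have T_in: "T x = (LEAST i. i < m \<and> x \<in> C i) + 2" "T x - 2 < m" "x \<in> C (T x - 2)" if "x \<in> A" for x
  proof -
    have "\<exists>i. i < m \<and> x \<in> C i" using cov that by auto
    then have "(LEAST i. i < m \<and> x \<in> C i) < m \<and> x \<in> C (LEAST i. i < m \<and> x \<in> C i)" by (rule LeastI_ex)
    then show "T x = (LEAST i. i < m \<and> x \<in> C i) + 2" "T x - 2 < m" "x \<in> C (T x - 2)"
      using that by (auto simp: T_def)
  qed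
  have idx: "i \<in> indices R n" if "1 \<le> i" "i \<le> m + 1" for i
    using that m by (auto simp: indices_def)
  have sys: "id_system R n T g"
    unfolding id_system_def
  proof
    have "T \<in> Rvec n \<rightarrow>\<^sub>M count_space UNIV"
    proof -
      have cell: "Measurable.pred (Rvec n) (\<lambda>x. i < m \<and> x \<in> C i)" for i
        using C[of i] by (cases "i < m") auto
      have "(\<lambda>x. LEAST i. i < m \<and> x \<in> C i) \<in> Rvec n \<rightarrow>\<^sub>M count_space UNIV"
        by (rule measurable_Least) (rule cell)
      then have L: "(\<lambda>x. (LEAST i. i < m \<and> x \<in> C i) + 2) \<in> Rvec n \<rightarrow>\<^sub>M count_space UNIV"
        by (rule measurable_compose) simp
      have one: "(\<lambda>x. 1) \<in> Rvec n \<rightarrow>\<^sub>M (count_space UNIV :: nat measure)" by (rule measurable_const) simp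
      have "{x \<in> space (Rvec n). x \<in> A} \<in> sets (Rvec n)"
        using A sets.sets_into_space[OF A] by (simp add: Int_absorb1 Int_def[symmetric])
      from measurable_If[OF L one this] show ?thesis unfolding T_def .
    qed
    moreover have "T \<in> space (Rvec n) \<rightarrow> indices R n"
    proof
      fix x show "T x \<in> indices R n"
      proof (cases "x \<in> A")
        case True
        then show ?thesis using T_in[of x] by (intro idx) auto
      qed (auto simp: T_def intro: idx)
    qed
    ultimately have "T \<in> Rvec n \<rightarrow>\<^sub>M restrict_space (count_space UNIV) (indices R n)"
      by (intro measurable_restrict_space2)
    then show "T \<in> Rvec n \<rightarrow>\<^sub>M count_space (indices R n)"
      by (simp add: restrict_count_space)
    have "g i \<in> Rvec n \<rightarrow>\<^sub>M count_space UNIV" for i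
    proof (cases "2 \<le> i \<and> i < m + 2")
      case True
      then have [measurable]: "N (i - 2) \<in> sets (Rvec n)" by (intro N) auto
      have "g i = (\<lambda>y. if y \<in> N (i - 2) then No else Maybe)" using True by (auto simp: g_def)
      then show ?thesis by simp
    next
      case False
      then have "g i = (\<lambda>y. Maybe)" by (auto simp: g_def)
      then show ?thesis by simp
    qed
    then show "(\<lambda>(i, y). g i y) \<in> count_space (indices R n) \<Otimes>\<^sub>M Rvec n \<rightarrow>\<^sub>M count_space UNIV"
      by (intro measurable_pair_measure_countable1) auto
  qed
  have adm: "admissible D n T g"
    unfolding admissible_def
  proof (intro ballI impI, rule ccontr)
    fix x y assume d: "distortion n x y \<le> D" and "g (T x) y \<noteq> Maybe"
    then have "T x \<noteq> 1" "y \<in> N (T x - 2)" by (auto simp: g_def split: if_splits)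
    then have "x \<in> A" by (auto simp: T_def split: if_splits)
    from far[OF T_in(2)[OF this] this T_in(3)[OF this] \<open>y \<in> N (T x - 2)\<close>] d show False by simp
  qed
  have bound: "maybe_prob PX PY n T g \<le> measure (\<Pi>\<^sub>M i\<in>{..<n}. PX) (space (Rvec n) - A) + \<epsilon>"
    if "prob_space PX" "prob_space PY" and PX: "sets PX = sets borel" and PY: "sets PY = sets borel"
      and "0 \<le> \<epsilon>" and small: "\<forall>i<m. measure (\<Pi>\<^sub>M i\<in>{..<n}. PY) (space (Rvec n) - N i) \<le> \<epsilon>"
    for PX PY \<epsilon>
  proof -
    let ?X = "\<Pi>\<^sub>M i\<in>{..<n}. PX" and ?Y = "\<Pi>\<^sub>M i\<in>{..<n}. PY"
    interpret X: prob_space ?X using \<open>prob_space PX\<close> by (intro prob_space_PiM)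
    interpret Y: prob_space ?Y using \<open>prob_space PY\<close> by (intro prob_space_PiM)
    interpret XY: pair_prob_space ?X ?Y by unfold_locales
    note X_eq = space_PiM_real[OF PX, of "{..<n}"] and Y_eq = space_PiM_real[OF PY, of "{..<n}"]
    define S where "S = {(x, y) \<in> space (?X \<Otimes>\<^sub>M ?Y). g (T x) y = Maybe}"
    have S: "S \<in> sets (?X \<Otimes>\<^sub>M ?Y)"
      unfolding S_def by (rule answer_set_measurable[OF sys PX PY])
    have Ac: "space (Rvec n) - A \<in> sets ?X" using A by (simp add: X_eq)
    have "emeasure (?X \<Otimes>\<^sub>M ?Y) S = (\<integral>\<^sup>+x. emeasure ?Y (Pair x -` S) \<partial>?X)"
      by (rule Y.emeasure_pair_measure_alt[OF S])
    \<comment> \<open>Conditioning on \<open>x\<close> fixes the index, so only one set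
      \<open>N i\<close> enters and \<epsilon> is not multiplied by the number of cells.\<close>
    also have "\<dots> \<le> (\<integral>\<^sup>+x. indicator (space (Rvec n) - A) x + ennreal \<epsilon> \<partial>?X)"
    proof (rule nn_integral_mono)
      fix x assume x: "x \<in> space ?X"
      show "emeasure ?Y (Pair x -` S) \<le> indicator (space (Rvec n) - A) x + ennreal \<epsilon>"
      proof (cases "x \<in> A")
        case True
        have "Pair x -` S \<subseteq> space (Rvec n) - N (T x - 2)"
          using T_in[OF True] by (auto simp: S_def g_def space_pair_measure Y_eq split: if_splits)
        then have "emeasure ?Y (Pair x -` S) \<le> emeasure ?Y (space (Rvec n) - N (T x - 2))"
          using N[OF T_in(2)[OF True]] by (intro emeasure_mono) (auto simp: Y_eq)
        also have "\<dots> \<le> ennreal \<epsilon>"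
          using small T_in(2)[OF True] \<open>0 \<le> \<epsilon>\<close> by (simp add: Y.emeasure_eq_measure)
        finally show ?thesis using True by simp
      next
        case False
        then have "indicator (space (Rvec n) - A) x = (1 :: ennreal)" using x by (simp add: X_eq)
        moreover have "emeasure ?Y (Pair x -` S) \<le> 1" by (rule Y.measure_le_1)
        ultimately show ?thesis by (simp add: add_increasing2)
      qed
    qed
    also have "\<dots> = emeasure ?X (space (Rvec n) - A) + ennreal \<epsilon>"
      using Ac by (subst nn_integral_add) (auto simp: X.emeasure_space_1)
    finally have "measure (?X \<Otimes>\<^sub>M ?Y) S \<le> measure ?X (space (Rvec n) - A) + \<epsilon>"
      using \<open>0 \<le> \<epsilon>\<close> by (simp add: XY.emeasure_eq_measure X.emeasure_eq_measure ennreal_plus[symmetric] del: ennreal_plus)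
    then show ?thesis unfolding maybe_prob_def S_def Let_def .
  qed
  show ?thesis
    by (rule exI[of _ T], rule exI[of _ g]) (use sys adm bound in blast)
qed

text \<open>The scheme without cells always answers \<open>Maybe\<close>; it needs a single index.
  It fills the blocklengths that are too short for the covering.\<close>

lemma trivial_system:
  assumes "R \<ge> 0"
  shows "\<exists>T g. id_system R n T g \<and> admissible D n T g"
  using quantizer_scheme[of 0 n R "{}" "\<lambda>_. {}" "\<lambda>_. {}" D] assms
  by (fastforce intro: ge_one_powr_ge_zero)

text \<open>Scaling of the covering. A centre longer than \<open>2 c sqrt n\<close> may be dropped,
  since its ball of radius \<open>r c sqrt n\<close> with \<open>r < 1\<close> misses the ball to be
  covered. The bound on the centres is what makes Chebyshev's inequality usable for inner products
  with them.\<close>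

lemma ball_covering_bounded:
  fixes c r R :: real
  assumes "c > 0" "r < 1" "2 powr (- R) < r"
  shows "eventually (\<lambda>n. \<exists>U. finite U \<and> real (card U) + 1 \<le> 2 powr (real n * R) \<and>
    (\<forall>u\<in>U. (\<Sum>i<n. (u i)\<^sup>2) \<le> real n * (2 * c)\<^sup>2) \<and>
    (\<forall>x. (\<Sum>i<n. (x i)\<^sup>2) \<le> real n * c\<^sup>2 \<longrightarrow> (\<exists>u\<in>U. (\<Sum>i<n. (x i - u i)\<^sup>2) \<le> real n * (r * c)\<^sup>2))) sequentially"
  using ball_covering[OF assms(2,3)]
proof eventually_elim
  case (elim n)
  then obtain U where U: "finite U" "real (card U) + 1 \<le> 2 powr (real n * R)"
    and cov: "\<And>x. (\<Sum>i<n. (x i)\<^sup>2) \<le> real n \<Longrightarrow> \<exists>u\<in>U. (\<Sum>i<n. (x i - u i)\<^sup>2) \<le> real n * r\<^sup>2" by blast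
  have "r > 0" using assms(3) powr_gt_zero[of 2 "- R"] by linarith
  define V where "V = {v \<in> (\<lambda>u i. c * u i) ` U. (\<Sum>i<n. (v i)\<^sup>2) \<le> real n * (2 * c)\<^sup>2}"
  have "finite V" using U(1) by (simp add: V_def)
  have "card V \<le> card ((\<lambda>u i. c * u i) ` U)" unfolding V_def using U(1) by (intro card_mono) auto
  also have "\<dots> \<le> card U" using U(1) by (rule card_image_le)
  finally have "real (card V) + 1 \<le> 2 powr (real n * R)" using U(2) by linarith
  moreover have "\<exists>v\<in>V. (\<Sum>i<n. (x i - v i)\<^sup>2) \<le> real n * (r * c)\<^sup>2"
    if x: "(\<Sum>i<n. (x i)\<^sup>2) \<le> real n * c\<^sup>2" for x
  proof -
    have "(\<Sum>i<n. (x i / c)\<^sup>2) \<le> real n"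
      using x \<open>c > 0\<close> by (simp add: power_divide sum_divide_distrib[symmetric] pos_divide_le_eq)
    from cov[OF this] obtain u where u: "u \<in> U" "(\<Sum>i<n. (x i / c - u i)\<^sup>2) \<le> real n * r\<^sup>2" by blast
    have "x i - c * u i = c * (x i / c - u i)" for i using \<open>c > 0\<close> by (simp add: right_diff_distrib)
    then have "(\<Sum>i<n. (x i - c * u i)\<^sup>2) = c\<^sup>2 * (\<Sum>i<n. (x i / c - u i)\<^sup>2)"
      by (simp add: power_mult_distrib sum_distrib_left)
    also have "\<dots> \<le> c\<^sup>2 * (real n * r\<^sup>2)" using u(2) by (intro mult_left_mono) auto
    finally have close: "(\<Sum>i<n. (x i - c * u i)\<^sup>2) \<le> real n * (r * c)\<^sup>2"
      by (simp add: power_mult_distrib mult_ac)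
    have "L2_set (\<lambda>i. c * u i) {..<n} = L2_set (\<lambda>i. (c * u i - x i) + x i) {..<n}" by simp
    also have "\<dots> \<le> L2_set (\<lambda>i. c * u i - x i) {..<n} + L2_set x {..<n}" by (rule L2_set_triangle_ineq)
    also have "L2_set (\<lambda>i. c * u i - x i) {..<n} \<le> sqrt (real n * (r * c)\<^sup>2)"
      unfolding L2_set_def using close by (simp add: power2_commute)
    also have "\<dots> \<le> sqrt (real n * c\<^sup>2)"
      using \<open>r > 0\<close> \<open>r < 1\<close> \<open>c > 0\<close> by (auto simp: power_mult_distrib power_le_one intro!: mult_left_mono mult_left_le_one_le)
    also have "L2_set x {..<n} \<le> sqrt (real n * c\<^sup>2)"
      unfolding L2_set_def using x by simp
    also have "sqrt (real n * c\<^sup>2) + sqrt (real n * c\<^sup>2) = sqrt (real n * (2 * c)\<^sup>2)"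
      using \<open>c > 0\<close> by (simp add: real_sqrt_mult)
    finally have "(\<Sum>i<n. (c * u i)\<^sup>2) \<le> real n * (2 * c)\<^sup>2" by (simp add: L2_set_def)
    then have "(\<lambda>i. c * u i) \<in> V" using u(1) by (auto simp: V_def)
    with close show ?thesis by (intro bexI[of _ "\<lambda>i. c * u i"])
  qed
  ultimately show ?case
    using \<open>finite V\<close> by (intro exI[of _ V]) (auto simp: V_def)
qed

lemma weak_law_sum_squares:
  fixes \<sigma> \<delta> :: real
  assumes "prob_space P" and borel: "sets P = sets borel"
    and int: "integrable P (\<lambda>x. x\<^sup>2)" and sq: "(\<integral>x. x\<^sup>2 \<partial>P) = \<sigma>\<^sup>2" and "\<sigma> > 0" "\<delta> > 0"
  shows "(\<lambda>n. measure (\<Pi>\<^sub>M i\<in>{..<n}. P) (space (Rvec n) - {x \<in> space (Rvec n).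
        \<bar>(\<Sum>i<n. (x i)\<^sup>2) - real n * \<sigma>\<^sup>2\<bar> < real n * (\<sigma>\<^sup>2 * \<delta>)})) \<longlonglongrightarrow> 0"
proof -
  have "{x \<in> space (\<Pi>\<^sub>M i\<in>{..<n}. P). real n * (\<sigma>\<^sup>2 * \<delta>) \<le> \<bar>(\<Sum>i<n. (x i)\<^sup>2) - real n * \<sigma>\<^sup>2\<bar>}
    = space (Rvec n) - {x \<in> space (Rvec n). \<bar>(\<Sum>i<n. (x i)\<^sup>2) - real n * \<sigma>\<^sup>2\<bar> < real n * (\<sigma>\<^sup>2 * \<delta>)}" for n
    unfolding space_PiM_real(2)[OF borel] by auto
  with weak_law_PiM[OF assms(1) int, of "\<sigma>\<^sup>2 * \<delta>"] sq \<open>\<sigma> > 0\<close> \<open>\<delta> > 0\<close> show ?thesis by simp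
qed

text \<open>The order of quantifiers is the point: covering, slacks and the threshold
  \<open>n0\<close> are all fixed before \<open>PX\<close> and \<open>PY\<close> appear. The laws
  enter only the speed with which the error bound tends to 0.\<close>

lemma universal_achievability:
  fixes \<sigma>X \<sigma>Y D R :: real
  assumes "\<sigma>X > 0" "\<sigma>Y > 0" "R > 0" and \<kappa>: "2 powr (- R) < (\<sigma>X\<^sup>2 + \<sigma>Y\<^sup>2 - D) / (2 * \<sigma>X * \<sigma>Y)"
  shows "\<exists>T g. admissible_systems D R T g \<and>
           (\<forall>PX PY. real_distribution PX \<and> has_mean_variance PX 0 (\<sigma>X\<^sup>2) \<and>
                    real_distribution PY \<and> has_mean_variance PY 0 (\<sigma>Y\<^sup>2) \<longrightarrow>
              (\<lambda>n. maybe_prob PX PY n (T n) (g n)) \<longlonglongrightarrow> 0)"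
proof -
  define k where "k = (\<sigma>X\<^sup>2 + \<sigma>Y\<^sup>2 - D) / (2 * \<sigma>X * \<sigma>Y)"
  define P where "P = \<sigma>X * \<sigma>Y"
  define Q where "Q = \<sigma>X\<^sup>2 + \<sigma>Y\<^sup>2"
  have "P > 0" "Q > 0" using assms(1,2) by (auto simp: P_def Q_def intro: add_pos_pos)
  have Pk: "2 * (P * k) = Q - D" using assms(1,2) by (simp add: P_def Q_def k_def)
  have "2 powr (- R) < 2 powr 0" using \<open>R > 0\<close> by (intro powr_less_mono) auto
  \<comment> \<open>\<open>k\<close> exceeds 1 when \<open>D < (\<sigma>X - \<sigma>Y)^2\<close>,
    but the covering lemma wants a radius below 1.\<close>
  then have "2 powr (- R) < min 1 k" using \<kappa> by (simp add: k_def)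
  then obtain r where r: "2 powr (- R) < r" "r < min 1 k" using dense by blast
  then have "r < 1" "r < k" by auto
  have "r > 0" using r(1) powr_gt_zero[of 2 "- R"] by linarith
  \<comment> \<open>The room between \<open>2 * P * r\<close> and \<open>Q - D\<close> is
    \<open>2 * P * (k - r)\<close>. One half goes to \<delta>, for the deviations of the two
    lengths, the other to \<tau>, for the inner product of \<open>y\<close> with the centre.\<close>
  define \<delta> where "\<delta> = P * (k - r) / (Q + 2 * P)"
  have "\<delta> > 0" unfolding \<delta>_def using \<open>r < k\<close> \<open>P > 0\<close> \<open>Q > 0\<close> by simp
  define \<tau> where "\<tau> = P * (k - r) / 2"
  have "\<tau> > 0" unfolding \<tau>_def using \<open>r < k\<close> \<open>P > 0\<close> by simp
  have gap: "2 * \<tau> + \<delta> * Q + 2 * (P * r) * (1 + \<delta>) \<le> Q - D"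
  proof -
    have "\<delta> * (Q + 2 * P) = P * (k - r)" unfolding \<delta>_def using \<open>P > 0\<close> \<open>Q > 0\<close> by simp
    moreover have "\<delta> * (P * r) \<le> \<delta> * (P * 1)"
      using \<open>\<delta> > 0\<close> \<open>P > 0\<close> \<open>r < 1\<close> by (intro mult_left_mono) auto
    moreover have "2 * \<tau> = P * k - P * r" by (simp add: \<tau>_def right_diff_distrib)
    ultimately show ?thesis using Pk by (simp add: algebra_simps)
  qed
  define c where "c = \<sigma>X * sqrt (1 + \<delta>)"
  define d where "d = \<sigma>Y * sqrt (1 + \<delta>)"
  have "c > 0" "d > 0" using assms(1,2) \<open>\<delta> > 0\<close> by (simp_all add: c_def d_def)
  have c2: "c\<^sup>2 = \<sigma>X\<^sup>2 * (1 + \<delta>)" and d2: "d\<^sup>2 = \<sigma>Y\<^sup>2 * (1 + \<delta>)" and cd: "c * d = P * (1 + \<delta>)"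
    using \<open>\<delta> > 0\<close> by (simp_all add: c_def d_def P_def power_mult_distrib)
  define AX where "AX n = {x \<in> space (Rvec n). \<bar>(\<Sum>i<n. (x i)\<^sup>2) - real n * \<sigma>X\<^sup>2\<bar> < real n * (\<sigma>X\<^sup>2 * \<delta>)}" for n
  define AY where "AY n = {y \<in> space (Rvec n). \<bar>(\<Sum>i<n. (y i)\<^sup>2) - real n * \<sigma>Y\<^sup>2\<bar> < real n * (\<sigma>Y\<^sup>2 * \<delta>)}" for n
  have AX: "AX n \<in> sets (Rvec n)" and AY: "AY n \<in> sets (Rvec n)" for n
    unfolding AX_def AY_def by measurable
  have AXD: "real n * \<sigma>X\<^sup>2 - real n * (\<sigma>X\<^sup>2 * \<delta>) < (\<Sum>i<n. (x i)\<^sup>2)" "(\<Sum>i<n. (x i)\<^sup>2) \<le> real n * c\<^sup>2"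
    if "x \<in> AX n" for x n
  proof -
    have "\<bar>(\<Sum>i<n. (x i)\<^sup>2) - real n * \<sigma>X\<^sup>2\<bar> < real n * (\<sigma>X\<^sup>2 * \<delta>)" using that by (simp add: AX_def)
    moreover have "real n * c\<^sup>2 = real n * \<sigma>X\<^sup>2 + real n * (\<sigma>X\<^sup>2 * \<delta>)" by (simp add: c2 distrib_left)
    ultimately show "real n * \<sigma>X\<^sup>2 - real n * (\<sigma>X\<^sup>2 * \<delta>) < (\<Sum>i<n. (x i)\<^sup>2)" "(\<Sum>i<n. (x i)\<^sup>2) \<le> real n * c\<^sup>2"
      by linarith+
  qed
  have AYD: "real n * \<sigma>Y\<^sup>2 - real n * (\<sigma>Y\<^sup>2 * \<delta>) < (\<Sum>i<n. (y i)\<^sup>2)" "(\<Sum>i<n. (y i)\<^sup>2) \<le> real n * d\<^sup>2"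
    if "y \<in> AY n" for y n
  proof -
    have "\<bar>(\<Sum>i<n. (y i)\<^sup>2) - real n * \<sigma>Y\<^sup>2\<bar> < real n * (\<sigma>Y\<^sup>2 * \<delta>)" using that by (simp add: AY_def)
    moreover have "real n * d\<^sup>2 = real n * \<sigma>Y\<^sup>2 + real n * (\<sigma>Y\<^sup>2 * \<delta>)" by (simp add: d2 distrib_left)
    ultimately show "real n * \<sigma>Y\<^sup>2 - real n * (\<sigma>Y\<^sup>2 * \<delta>) < (\<Sum>i<n. (y i)\<^sup>2)" "(\<Sum>i<n. (y i)\<^sup>2) \<le> real n * d\<^sup>2"
      by linarith+
  qed
  \<comment> \<open>A bound for all admissible pairs of laws at once, so that a system can be chosen
    for each \<open>n\<close> without knowing the laws.\<close>
  define good where "good n T g \<longleftrightarrow> (\<forall>PX PY. real_distribution PX \<and> has_mean_variance PX 0 (\<sigma>X\<^sup>2) \<and>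
      real_distribution PY \<and> has_mean_variance PY 0 (\<sigma>Y\<^sup>2) \<longrightarrow>
      maybe_prob PX PY n T g \<le> measure (\<Pi>\<^sub>M i\<in>{..<n}. PX) (space (Rvec n) - AX n)
        + (measure (\<Pi>\<^sub>M i\<in>{..<n}. PY) (space (Rvec n) - AY n) + \<sigma>Y\<^sup>2 * (2 * c)\<^sup>2 / \<tau>\<^sup>2 * (1 / real n)))" for n T g
  have scheme: "\<exists>T g. id_system R n T g \<and> admissible D n T g \<and> good n T g"
    if "n > 0" and U: "finite U" "real (card U) + 1 \<le> 2 powr (real n * R)"
      and U_le: "\<And>u. u \<in> U \<Longrightarrow> (\<Sum>i<n. (u i)\<^sup>2) \<le> real n * (2 * c)\<^sup>2"
      and cov: "\<And>x. (\<Sum>i<n. (x i)\<^sup>2) \<le> real n * c\<^sup>2 \<Longrightarrow> \<exists>u\<in>U. (\<Sum>i<n. (x i - u i)\<^sup>2) \<le> real n * (r * c)\<^sup>2"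
    for n :: nat and U
  proof -
    obtain h where h: "bij_betw h {0..<card U} U" using ex_bij_betw_nat_finite[OF U(1)] ..
    define C where "C i = {x \<in> space (Rvec n). (\<Sum>j<n. (x j - h i j)\<^sup>2) \<le> real n * (r * c)\<^sup>2}" for i
    \<comment> \<open>One-sided: only a large positive inner product could bring \<open>y\<close>
      close to the cell.\<close>
    define B where "B i = {y \<in> space (Rvec n). (\<Sum>j<n. h i j * y j) < real n * \<tau>}" for i
    have CB: "C i \<in> sets (Rvec n)" "B i \<in> sets (Rvec n)" for i
      unfolding C_def B_def by measurable
    have cover: "AX n \<subseteq> (\<Union>i<card U. C i)"
    proof
      fix x assume x: "x \<in> AX n"
      from cov[OF AXD(2)[OF x]] obtain u where "u \<in> U" "(\<Sum>i<n. (x i - u i)\<^sup>2) \<le> real n * (r * c)\<^sup>2" by blast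
      moreover have "u \<in> h ` {0..<card U}" using \<open>u \<in> U\<close> h by (simp add: bij_betw_def)
      then obtain i where "i < card U" "u = h i" by auto
      ultimately show "x \<in> (\<Union>i<card U. C i)" using x by (auto simp: C_def AX_def)
    qed
    have far: "D < distortion n x y" if "x \<in> AX n" "x \<in> C i" "y \<in> AY n \<inter> B i" for i x y
    proof -
      note x = AXD(1)[OF that(1)]
      have "y \<in> AY n" using that(3) by simp
      note y = AYD[OF this]
      have hy: "(\<Sum>j<n. h i j * y j) < real n * \<tau>" using that(3) by (simp add: B_def)
      \<comment> \<open>The inner product of \<open>x\<close> and \<open>y\<close> is split at the
        centre. The part with the centre is small for typical \<open>y\<close>; the remainder is
        bounded in the worst case by Cauchy--Schwarz and the radius of the cell.\<close>
      have "(\<Sum>j<n. (x j - h i j) * y j) \<le> (\<Sum>j<n. \<bar>x j - h i j\<bar> * \<bar>y j\<bar>)"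
        by (intro sum_mono) (metis abs_ge_self abs_mult)
      also have "\<dots> \<le> L2_set (\<lambda>j. x j - h i j) {..<n} * L2_set y {..<n}" by (rule L2_set_mult_ineq)
      also have "\<dots> \<le> sqrt (real n * (r * c)\<^sup>2) * sqrt (real n * d\<^sup>2)"
        using that(2) y(2) unfolding L2_set_def C_def by (intro mult_mono) (auto intro: sum_nonneg)
      also have "\<dots> = real n * (r * (c * d))"
        using \<open>r > 0\<close> \<open>c > 0\<close> \<open>d > 0\<close> by (simp add: real_sqrt_mult mult_ac)
      also have "\<dots> = real n * (P * r * (1 + \<delta>))" unfolding cd by (simp add: mult_ac)
      finally have xhy: "(\<Sum>j<n. (x j - h i j) * y j) \<le> real n * (P * r * (1 + \<delta>))" .
      have "(\<Sum>j<n. (x j - y j)\<^sup>2) = (\<Sum>j<n. (x j)\<^sup>2 + (y j)\<^sup>2 - 2 * (h i j * y j) - 2 * ((x j - h i j) * y j))"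
        by (intro sum.cong) (auto simp: power2_eq_square algebra_simps)
      also have "\<dots> = (\<Sum>j<n. (x j)\<^sup>2) + (\<Sum>j<n. (y j)\<^sup>2) - 2 * (\<Sum>j<n. h i j * y j) - 2 * (\<Sum>j<n. (x j - h i j) * y j)"
        by (simp add: sum.distrib sum_subtractf sum_distrib_left)
      also have "\<dots> > real n * (Q - D - (2 * \<tau> + \<delta> * Q + 2 * (P * r) * (1 + \<delta>)) + D)"
      proof -
        have "real n * (Q - D - (2 * \<tau> + \<delta> * Q + 2 * (P * r) * (1 + \<delta>)) + D)
            = (real n * \<sigma>X\<^sup>2 - real n * (\<sigma>X\<^sup>2 * \<delta>)) + (real n * \<sigma>Y\<^sup>2 - real n * (\<sigma>Y\<^sup>2 * \<delta>))
              - 2 * (real n * \<tau>) - 2 * (real n * (P * r * (1 + \<delta>)))"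
          unfolding Q_def by (simp add: algebra_simps)
        then show ?thesis using x y(1) hy xhy by linarith
      qed
      finally have "real n * (Q - D - (2 * \<tau> + \<delta> * Q + 2 * (P * r) * (1 + \<delta>)) + D) < (\<Sum>j<n. (x j - y j)\<^sup>2)" .
      moreover have "real n * D \<le> real n * (Q - D - (2 * \<tau> + \<delta> * Q + 2 * (P * r) * (1 + \<delta>)) + D)"
        using gap by (intro mult_left_mono) auto
      ultimately have "real n * D < (\<Sum>j<n. (x j - y j)\<^sup>2)" by linarith
      then show ?thesis
        using \<open>n > 0\<close> by (simp add: distortion_def L2_set_def sum_nonneg pos_less_divide_eq mult.commute)
    qed
    have "\<exists>T g. id_system R n T g \<and> admissible D n T g \<and>
      (\<forall>PX PY \<epsilon>. prob_space PX \<longrightarrow> prob_space PY \<longrightarrow> sets PX = sets borel \<longrightarrow> sets PY = sets borel \<longrightarrow>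
        0 \<le> \<epsilon> \<longrightarrow> (\<forall>i<card U. measure (\<Pi>\<^sub>M i\<in>{..<n}. PY) (space (Rvec n) - AY n \<inter> B i) \<le> \<epsilon>) \<longrightarrow>
        maybe_prob PX PY n T g \<le> measure (\<Pi>\<^sub>M i\<in>{..<n}. PX) (space (Rvec n) - AX n) + \<epsilon>)"
      by (rule quantizer_scheme[OF U(2) AX _ _ cover]) (use CB AY far in auto)
    then obtain T g where Tg: "id_system R n T g" "admissible D n T g"
      and bd: "\<And>PX PY \<epsilon>. prob_space PX \<Longrightarrow> prob_space PY \<Longrightarrow> sets PX = sets borel \<Longrightarrow> sets PY = sets borel \<Longrightarrow>
      0 \<le> \<epsilon> \<Longrightarrow> (\<forall>i<card U. measure (\<Pi>\<^sub>M i\<in>{..<n}. PY) (space (Rvec n) - AY n \<inter> B i) \<le> \<epsilon>) \<Longrightarrow>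
      maybe_prob PX PY n T g \<le> measure (\<Pi>\<^sub>M i\<in>{..<n}. PX) (space (Rvec n) - AX n) + \<epsilon>"
      by blast
    have "good n T g"
      unfolding good_def
    proof (intro allI impI, elim conjE)
      fix PX PY
      assume "real_distribution PX" "has_mean_variance PX 0 (\<sigma>X\<^sup>2)"
        and "real_distribution PY" and mv: "has_mean_variance PY 0 (\<sigma>Y\<^sup>2)"
      interpret X: real_distribution PX by fact
      interpret Y: real_distribution PY by fact
      let ?Y = "\<Pi>\<^sub>M i\<in>{..<n}. PY"
      interpret YY: prob_space ?Y by (intro prob_space_PiM) (rule Y.prob_space_axioms)
      note Y_eq = space_PiM_real[OF Y.events_eq_borel, of "{..<n}"]
      show "maybe_prob PX PY n T g \<le> measure (\<Pi>\<^sub>M i\<in>{..<n}. PX) (space (Rvec n) - AX n)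
        + (measure ?Y (space (Rvec n) - AY n) + \<sigma>Y\<^sup>2 * (2 * c)\<^sup>2 / \<tau>\<^sup>2 * (1 / real n))"
      proof (rule bd[OF X.prob_space_axioms Y.prob_space_axioms X.events_eq_borel Y.events_eq_borel], goal_cases)
        case 2
        show ?case
        proof (intro allI impI)
          fix i assume "i < card U"
          then have "h i \<in> U" using h by (auto simp: bij_betw_def)
          define E where "E = {y \<in> space ?Y. real n * \<tau> \<le> \<bar>\<Sum>j<n. h i j * y j\<bar>}"
          \<comment> \<open>The bound depends on the centre only through its length, so it is the
            same for all cells.\<close>
          have "measure ?Y E \<le> (\<sigma>Y\<^sup>2 * (real n * (2 * c)\<^sup>2)) / (real n * \<tau>)\<^sup>2"
            unfolding E_def
          proof (rule chebyshev_PiM)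
            have "(\<Sum>j<n. \<integral>y. (h i j * y)\<^sup>2 \<partial>PY) = \<sigma>Y\<^sup>2 * (\<Sum>j<n. (h i j)\<^sup>2)"
              using mv by (simp add: has_mean_variance_def power_mult_distrib sum_distrib_left mult.commute)
            also have "\<dots> \<le> \<sigma>Y\<^sup>2 * (real n * (2 * c)\<^sup>2)"
              using U_le[OF \<open>h i \<in> U\<close>] by (intro mult_left_mono) auto
            finally show "(\<Sum>j<n. \<integral>y. (h i j * y)\<^sup>2 \<partial>PY) \<le> \<sigma>Y\<^sup>2 * (real n * (2 * c)\<^sup>2)" .
          qed (use mv \<open>n > 0\<close> \<open>\<tau> > 0\<close> Y.prob_space_axioms in \<open>auto simp: has_mean_variance_def power_mult_distrib\<close>)
          also have "\<dots> = \<sigma>Y\<^sup>2 * (2 * c)\<^sup>2 / \<tau>\<^sup>2 * (1 / real n)"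
            using \<open>n > 0\<close> by (simp add: power_mult_distrib power2_eq_square mult_ac)
          finally have E: "measure ?Y E \<le> \<sigma>Y\<^sup>2 * (2 * c)\<^sup>2 / \<tau>\<^sup>2 * (1 / real n)" .
          have Es: "E \<in> sets ?Y" "space (Rvec n) - AY n \<in> sets ?Y"
          proof -
            have "E = {y \<in> space (Rvec n). real n * \<tau> \<le> \<bar>\<Sum>j<n. h i j * y j\<bar>}" by (simp add: E_def Y_eq)
            also have "\<dots> \<in> sets (Rvec n)" by measurable
            finally show "E \<in> sets ?Y" by (simp add: Y_eq)
            show "space (Rvec n) - AY n \<in> sets ?Y" using AY by (simp add: Y_eq)
          qed
          have "measure ?Y (space (Rvec n) - AY n \<inter> B i) \<le> measure ?Y ((space (Rvec n) - AY n) \<union> E)"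
            using Es by (intro YY.finite_measure_mono) (auto simp: E_def B_def Y_eq)
          also have "\<dots> \<le> measure ?Y (space (Rvec n) - AY n) + measure ?Y E"
            using Es by (intro measure_Un_le)
          finally show "measure ?Y (space (Rvec n) - AY n \<inter> B i)
              \<le> measure ?Y (space (Rvec n) - AY n) + \<sigma>Y\<^sup>2 * (2 * c)\<^sup>2 / \<tau>\<^sup>2 * (1 / real n)"
            using E by linarith
        qed
      qed simp
    qed
    with Tg show ?thesis by blast
  qed
  have "eventually (\<lambda>n. \<exists>T g. id_system R n T g \<and> admissible D n T g \<and> good n T g) sequentially"
    using ball_covering_bounded[OF \<open>c > 0\<close> \<open>r < 1\<close> r(1)] eventually_gt_at_top[of 0]
    by eventually_elim (use scheme in blast)
  then obtain n0 where n0: "\<And>n. n \<ge> n0 \<Longrightarrow> \<exists>T g. id_system R n T g \<and> admissible D n T g \<and> good n T g"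
    by (auto simp: eventually_sequentially)
  \<comment> \<open>Trivial systems below \<open>n0\<close> make the family total, since
    admissibility is demanded at every blocklength.\<close>
  have "\<exists>Tg. id_system R n (fst Tg) (snd Tg) \<and> admissible D n (fst Tg) (snd Tg) \<and> (n \<ge> n0 \<longrightarrow> good n (fst Tg) (snd Tg))" for n
    using n0[of n] trivial_system[of R n D] \<open>R > 0\<close> by (cases "n \<ge> n0") auto
  then obtain Tg where Tg: "\<And>n. id_system R n (fst (Tg n)) (snd (Tg n))"
      "\<And>n. admissible D n (fst (Tg n)) (snd (Tg n))" "\<And>n. n \<ge> n0 \<Longrightarrow> good n (fst (Tg n)) (snd (Tg n))"
    by metis
  show ?thesis
  proof (rule exI[of _ "\<lambda>n. fst (Tg n)"], rule exI[of _ "\<lambda>n. snd (Tg n)"], intro conjI allI impI)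
    show "admissible_systems D R (\<lambda>n. fst (Tg n)) (\<lambda>n. snd (Tg n))"
      unfolding admissible_systems_def using Tg by blast
    fix PX PY
    assume *: "real_distribution PX \<and> has_mean_variance PX 0 (\<sigma>X\<^sup>2) \<and>
      real_distribution PY \<and> has_mean_variance PY 0 (\<sigma>Y\<^sup>2)"
    have lim: "(\<lambda>n. measure (\<Pi>\<^sub>M i\<in>{..<n}. P) (space (Rvec n) - {x \<in> space (Rvec n).
        \<bar>(\<Sum>i<n. (x i)\<^sup>2) - real n * \<sigma>\<^sup>2\<bar> < real n * (\<sigma>\<^sup>2 * \<delta>)})) \<longlonglongrightarrow> 0"
      if "real_distribution P" "has_mean_variance P 0 (\<sigma>\<^sup>2)" "\<sigma> > 0" for P and \<sigma> :: real
    proof -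
      interpret real_distribution P by fact
      show ?thesis
        using that(2,3) \<open>\<delta> > 0\<close>
        by (intro weak_law_sum_squares prob_space_axioms events_eq_borel) (simp_all add: has_mean_variance_def)
    qed
    have "(\<lambda>n. measure (\<Pi>\<^sub>M i\<in>{..<n}. PX) (space (Rvec n) - AX n)
        + (measure (\<Pi>\<^sub>M i\<in>{..<n}. PY) (space (Rvec n) - AY n) + \<sigma>Y\<^sup>2 * (2 * c)\<^sup>2 / \<tau>\<^sup>2 * (1 / real n)))
        \<longlonglongrightarrow> 0 + (0 + \<sigma>Y\<^sup>2 * (2 * c)\<^sup>2 / \<tau>\<^sup>2 * 0)"
      unfolding AX_def AY_def using * assms(1,2) by (intro tendsto_add tendsto_mult tendsto_const lim lim_1_over_n) auto
    then have up: "(\<lambda>n. measure (\<Pi>\<^sub>M i\<in>{..<n}. PX) (space (Rvec n) - AX n)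
        + (measure (\<Pi>\<^sub>M i\<in>{..<n}. PY) (space (Rvec n) - AY n) + \<sigma>Y\<^sup>2 * (2 * c)\<^sup>2 / \<tau>\<^sup>2 * (1 / real n)))
        \<longlonglongrightarrow> 0" by simp
    show "(\<lambda>n. maybe_prob PX PY n (fst (Tg n)) (snd (Tg n))) \<longlonglongrightarrow> 0"
    proof (rule tendsto_sandwich[OF _ _ tendsto_const up])
      show "eventually (\<lambda>n. 0 \<le> maybe_prob PX PY n (fst (Tg n)) (snd (Tg n))) sequentially"
        by (simp add: maybe_prob_def Let_def)
      show "eventually (\<lambda>n. maybe_prob PX PY n (fst (Tg n)) (snd (Tg n))
          \<le> measure (\<Pi>\<^sub>M i\<in>{..<n}. PX) (space (Rvec n) - AX n)
        + (measure (\<Pi>\<^sub>M i\<in>{..<n}. PY) (space (Rvec n) - AY n) + \<sigma>Y\<^sup>2 * (2 * c)\<^sup>2 / \<tau>\<^sup>2 * (1 / real n))) sequentially"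
        using eventually_ge_at_top[of n0]
      proof eventually_elim
        case (elim n)
        from Tg(3)[OF this] * show ?case unfolding good_def by blast
      qed
    qed
  qed
qed

section \<open>The converse for Gaussian sources\<close>

lemma box_bounded_indicator:
  fixes A :: "('i \<Rightarrow> real) set"
  assumes "finite I" "A \<in> sets (\<Pi>\<^sub>M i\<in>I. lborel)" and b: "\<And>x. x \<in> A \<Longrightarrow> (\<Sum>i\<in>I. (x i)\<^sup>2) \<le> b"
  shows "box_bounded I (indicator A)"
proof -
  have "\<bar>x i\<bar> \<le> sqrt b" if "x \<in> A" "i \<in> I" for x i
  proof -
    have "(x i)\<^sup>2 \<le> (\<Sum>i\<in>I. (x i)\<^sup>2)" using \<open>i \<in> I\<close> \<open>finite I\<close> by (intro member_le_sum) auto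
    also have "\<dots> \<le> b" by (rule b[OF \<open>x \<in> A\<close>])
    finally show ?thesis by (simp add: real_le_rsqrt)
  qed
  then have "\<forall>x\<in>space (\<Pi>\<^sub>M i\<in>I. lborel). 0 \<le> (indicator A x :: real) \<and> indicator A x \<le> (1 :: real) \<and>
      (indicator A x \<noteq> (0 :: real) \<longrightarrow> (\<forall>i\<in>I. \<bar>x i\<bar> \<le> sqrt b))"
    by (auto simp: indicator_def)
  moreover have "(indicator A :: _ \<Rightarrow> real) \<in> borel_measurable (\<Pi>\<^sub>M i\<in>I. lborel)"
    using assms(2) by (rule borel_measurable_indicator)
  ultimately show ?thesis
    unfolding box_bounded_def by metis
qed

lemma emeasure_PiM_lborel_bounded:
  fixes A :: "('i \<Rightarrow> real) set"
  assumes "finite I" "A \<in> sets (\<Pi>\<^sub>M i\<in>I. lborel)" "\<And>x. x \<in> A \<Longrightarrow> (\<Sum>i\<in>I. (x i)\<^sup>2) \<le> b"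
  shows "emeasure (\<Pi>\<^sub>M i\<in>I. lborel) A = ennreal (measure (\<Pi>\<^sub>M i\<in>I. lborel) A)"
proof -
  have "integrable (\<Pi>\<^sub>M i\<in>I. lborel) (indicator A :: _ \<Rightarrow> real)"
    using assms by (intro box_bounded_integrable box_bounded_indicator)
  then have "emeasure (\<Pi>\<^sub>M i\<in>I. lborel) A < \<infinity>" using assms(2) by (simp add: integrable_indicator_iff)
  then show ?thesis by (simp add: emeasure_eq_ennreal_measure)
qed

text \<open>Outside the inner ball the Gaussian density is at most the inverse of the
  \<open>n\<close>-th power factor. Up to \<delta>, that factor is \<open>exp\<close> of
  \<open>n\<close> times the differential entropy of \<open>N(0, \<sigma>^2)\<close>.\<close>

lemma volume_ge_gaussian:
  fixes A :: "(nat \<Rightarrow> real) set"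
  assumes "\<sigma> > 0" and A: "A \<in> sets (\<Pi>\<^sub>M i\<in>{..<n}. lborel)"
    and low: "\<And>x. x \<in> A \<Longrightarrow> real n * (\<sigma>\<^sup>2 * (1 - \<delta>)) \<le> (\<Sum>i<n. (x i)\<^sup>2)"
    and up: "\<And>x. x \<in> A \<Longrightarrow> (\<Sum>i<n. (x i)\<^sup>2) \<le> b"
  shows "measure (\<Pi>\<^sub>M i\<in>{..<n}. gaussian 0 (\<sigma>\<^sup>2)) A * (sqrt (2 * pi) * \<sigma> * exp ((1 - \<delta>) / 2)) ^ n
    \<le> measure (\<Pi>\<^sub>M i\<in>{..<n}. lborel) A"
proof -
  let ?L = "\<Pi>\<^sub>M i\<in>{..<n}. (lborel :: real measure)"
  interpret G: prob_space "\<Pi>\<^sub>M i\<in>{..<n}. gaussian 0 (\<sigma>\<^sup>2)"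
    using \<open>\<sigma> > 0\<close> by (intro prob_space_PiM prob_space_gaussian) simp
  define c where "c = sqrt (2 * pi) * \<sigma> * exp ((1 - \<delta>) / 2)"
  have "c > 0" using \<open>\<sigma> > 0\<close> by (simp add: c_def)
  have "emeasure (\<Pi>\<^sub>M i\<in>{..<n}. gaussian 0 (\<sigma>\<^sup>2)) A
      \<le> ennreal ((1 / sqrt (2 * pi * \<sigma>\<^sup>2)) ^ card {..<n} * exp (- (real n * (\<sigma>\<^sup>2 * (1 - \<delta>))) / (2 * \<sigma>\<^sup>2))) * emeasure ?L A"
    using \<open>\<sigma> > 0\<close> low by (intro emeasure_PiM_gaussian_le[where m="\<lambda>_. 0"] A) auto
  also have "(1 / sqrt (2 * pi * \<sigma>\<^sup>2)) ^ card {..<n} * exp (- (real n * (\<sigma>\<^sup>2 * (1 - \<delta>))) / (2 * \<sigma>\<^sup>2)) = 1 / c ^ n"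
  proof -
    have "- (real n * (\<sigma>\<^sup>2 * (1 - \<delta>))) / (2 * \<sigma>\<^sup>2) = real n * (- ((1 - \<delta>) / 2))"
      using \<open>\<sigma> > 0\<close> by simp
    then have "exp (- (real n * (\<sigma>\<^sup>2 * (1 - \<delta>))) / (2 * \<sigma>\<^sup>2)) = (1 / exp ((1 - \<delta>) / 2)) ^ n"
      by (simp only: exp_of_nat_mult exp_minus inverse_eq_divide)
    moreover have "sqrt (2 * pi * \<sigma>\<^sup>2) = sqrt (2 * pi) * \<sigma>" using \<open>\<sigma> > 0\<close> by (simp add: real_sqrt_mult)
    ultimately show ?thesis by (simp add: c_def power_divide power_mult_distrib)
  qed
  also have "emeasure ?L A = ennreal (measure ?L A)"
    using A up by (intro emeasure_PiM_lborel_bounded) auto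
  finally have "G.prob A \<le> 1 / c ^ n * measure ?L A"
    using \<open>c > 0\<close> by (simp add: G.emeasure_eq_measure ennreal_mult[symmetric])
  then show ?thesis using \<open>c > 0\<close> unfolding c_def[symmetric] by (simp add: pos_le_divide_eq)
qed

text \<open>A Gaussian measure of variance \<open>v\<close> has total mass 1, and on the ball its
  density is at least the inverse of the right-hand side. The bound has the same form as in
  \<open>volume_ge_gaussian\<close>, so \<open>sqrt (2 * pi)\<close> cancels when the two are
  compared.\<close>

lemma volume_ball_le:
  assumes "v > 0"
  shows "measure (\<Pi>\<^sub>M i\<in>{..<n}. lborel) {x \<in> space (\<Pi>\<^sub>M i\<in>{..<n}. lborel). (\<Sum>i<n. (x i)\<^sup>2) \<le> real n * v}
    \<le> (sqrt (2 * pi) * sqrt v * exp (1 / 2)) ^ n"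
proof -
  let ?L = "\<Pi>\<^sub>M i\<in>{..<n}. (lborel :: real measure)"
  define A where "A = {x \<in> space ?L. (\<Sum>i<n. (x i)\<^sup>2) \<le> real n * v}"
  have A: "A \<in> sets ?L" unfolding A_def by measurable
  interpret G: prob_space "\<Pi>\<^sub>M i\<in>{..<n}. gaussian 0 v"
    using \<open>v > 0\<close> by (intro prob_space_PiM prob_space_gaussian)
  define c where "c = sqrt (2 * pi) * sqrt v * exp (1 / 2)"
  have "c > 0" using \<open>v > 0\<close> by (simp add: c_def)
  have "ennreal ((1 / sqrt (2 * pi * v)) ^ card {..<n} * exp (- (real n * v) / (2 * v))) * emeasure ?L A
      \<le> emeasure (\<Pi>\<^sub>M i\<in>{..<n}. gaussian 0 v) A"
    using \<open>v > 0\<close> by (intro emeasure_PiM_gaussian_ge[where m="\<lambda>_. 0"] A) (auto simp: A_def)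
  also have "\<dots> \<le> 1" by (rule G.measure_le_1)
  also have "(1 / sqrt (2 * pi * v)) ^ card {..<n} * exp (- (real n * v) / (2 * v)) = 1 / c ^ n"
  proof -
    have "- (real n * v) / (2 * v) = real n * (- (1 / 2))" using \<open>v > 0\<close> by simp
    then have "exp (- (real n * v) / (2 * v)) = (1 / exp (1 / 2)) ^ n"
      by (simp only: exp_of_nat_mult exp_minus inverse_eq_divide)
    then show ?thesis by (simp add: c_def power_divide power_mult_distrib real_sqrt_mult)
  qed
  also have "emeasure ?L A = ennreal (measure ?L A)"
    using A by (intro emeasure_PiM_lborel_bounded[where b="real n * v"]) (auto simp: A_def)
  finally have "1 / c ^ n * measure ?L A \<le> 1"
    using \<open>c > 0\<close> by (simp add: ennreal_mult[symmetric])
  then show ?thesis using \<open>c > 0\<close> unfolding A_def c_def[symmetric] by (simp add: pos_divide_le_eq)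
qed

text \<open>The Brunn--Minkowski inequality, applied to \<open>s A + t B\<close>, with \<open>s = p / \<sigma>X\<close> and \<open>t = 1 / \<sigma>Y\<close>: the
  exponent \<open>\<theta> = p Q / (1 + p Q)\<close> makes the multiplicative form as strong as the additive one.\<close>

lemma gaussian_expansion:
  fixes A B :: "(nat \<Rightarrow> real) set" and \<sigma>X \<sigma>Y \<delta> p Q v :: real
  assumes "n > 0" "\<sigma>X > 0" "\<sigma>Y > 0" "v > 0" "p > 0" "Q > 0"
    and A: "A \<in> sets (\<Pi>\<^sub>M i\<in>{..<n}. lborel)" and B: "B \<in> sets (\<Pi>\<^sub>M i\<in>{..<n}. lborel)"
    and A_low: "\<And>x. x \<in> A \<Longrightarrow> real n * (\<sigma>X\<^sup>2 * (1 - \<delta>)) \<le> (\<Sum>i<n. (x i)\<^sup>2)"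
    and A_up: "\<And>x. x \<in> A \<Longrightarrow> (\<Sum>i<n. (x i)\<^sup>2) \<le> a"
    and B_low: "\<And>y. y \<in> B \<Longrightarrow> real n * (\<sigma>Y\<^sup>2 * (1 - \<delta>)) \<le> (\<Sum>i<n. (y i)\<^sup>2)"
    and B_up: "\<And>y. y \<in> B \<Longrightarrow> (\<Sum>i<n. (y i)\<^sup>2) \<le> b"
    and AB: "\<And>x y. x \<in> A \<Longrightarrow> y \<in> B \<Longrightarrow> (\<Sum>i<n. (p / \<sigma>X * x i + 1 / \<sigma>Y * y i)\<^sup>2) \<le> real n * v"
    and PA: "Q ^ n / 4 \<le> measure (\<Pi>\<^sub>M i\<in>{..<n}. gaussian 0 (\<sigma>X\<^sup>2)) A"
    and PB: "1 / 2 \<le> measure (\<Pi>\<^sub>M i\<in>{..<n}. gaussian 0 (\<sigma>Y\<^sup>2)) B"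
  shows "ln (1 + p * Q) \<le> \<delta> / 2 + ln 4 / real n + ln v / 2"
proof -
  let ?L = "\<Pi>\<^sub>M i\<in>{..<n}. (lborel :: real measure)"
  define C where "C = {x \<in> space ?L. (\<Sum>i<n. (x i)\<^sup>2) \<le> real n * v}"
  have C: "C \<in> sets ?L" unfolding C_def by measurable
  \<comment> \<open>The lower bounds on the volumes are those of sets whose scaled radii
    \<open>s * Q * \<sigma>X\<close> and \<open>t * \<sigma>Y\<close> are \<open>p * Q\<close> and
    \<open>1\<close>. With \<theta> the share of the first,
    \<open>(s / \<theta>) * Q * \<sigma>X\<close> and
    \<open>(t / (1 - \<theta>)) * \<sigma>Y\<close> both equal \<open>1 + p * Q\<close>, the
    equality case of the means inequality.\<close>
  define \<theta> where "\<theta> = p * Q / (1 + p * Q)"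
  have "p * Q > 0" using assms by simp
  have \<theta>: "0 < \<theta>" "\<theta> < 1" "1 - \<theta> = 1 / (1 + p * Q)"
    using \<open>p * Q > 0\<close> by (auto simp: \<theta>_def field_simps)
  define s where "s = p / \<sigma>X"
  define t where "t = 1 / \<sigma>Y"
  have "s > 0" "t > 0" using assms by (simp_all add: s_def t_def)
  have s\<theta>: "s / \<theta> = (1 + p * Q) / (Q * \<sigma>X)" and t\<theta>: "t / (1 - \<theta>) = (1 + p * Q) / \<sigma>Y"
    using assms \<open>p * Q > 0\<close> unfolding s_def t_def \<theta>(3) by (simp_all add: \<theta>_def)
  define c where "c = (s / \<theta>) powr \<theta> * (t / (1 - \<theta>)) powr (1 - \<theta>)"
  have "c > 0" unfolding c_def using \<open>s > 0\<close> \<open>t > 0\<close> \<theta>(1,2) by simp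
  define e where "e = exp ((1 - \<delta>) / 2)"
  define gX where "gX = sqrt (2 * pi) * \<sigma>X * e"
  define gY where "gY = sqrt (2 * pi) * \<sigma>Y * e"
  define gC where "gC = sqrt (2 * pi) * sqrt v * exp (1 / 2)"
  have g_pos: "gX > 0" "gY > 0" "gC > 0" using assms by (simp_all add: gX_def gY_def gC_def e_def)
  have "Q ^ n / 4 * gX ^ n \<le> measure (\<Pi>\<^sub>M i\<in>{..<n}. gaussian 0 (\<sigma>X\<^sup>2)) A * gX ^ n"
    using PA g_pos by (intro mult_right_mono) auto
  also have "\<dots> \<le> measure ?L A"
    unfolding gX_def e_def by (rule volume_ge_gaussian[OF \<open>\<sigma>X > 0\<close> A A_low A_up])
  finally have LA: "(Q * gX) ^ n / 4 \<le> measure ?L A" by (simp add: power_mult_distrib)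
  have "1 / 2 * gY ^ n \<le> measure (\<Pi>\<^sub>M i\<in>{..<n}. gaussian 0 (\<sigma>Y\<^sup>2)) B * gY ^ n"
    using PB g_pos by (intro mult_right_mono) auto
  also have "\<dots> \<le> measure ?L B"
    unfolding gY_def e_def by (rule volume_ge_gaussian[OF \<open>\<sigma>Y > 0\<close> B B_low B_up])
  finally have LB: "gY ^ n / 2 \<le> measure ?L B" by simp
  have LC: "measure ?L C \<le> gC ^ n" unfolding C_def gC_def by (rule volume_ball_le[OF \<open>v > 0\<close>])
  have "c ^ card {..<n} * ((\<integral>x. indicator A x \<partial>?L) powr \<theta> * (\<integral>x. indicator B x \<partial>?L) powr (1 - \<theta>))
      \<le> (\<integral>x. indicator C x \<partial>?L)"
    unfolding c_def
  proof (rule prekopa_leindler)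
    show "box_bounded {..<n} (indicator A)" using A A_up by (intro box_bounded_indicator) auto
    show "box_bounded {..<n} (indicator B)" using B B_up by (intro box_bounded_indicator) auto
    show "box_bounded {..<n} (indicator C)" using C
      by (intro box_bounded_indicator[where b="real n * v"]) (auto simp: C_def)
    fix x y assume "x \<in> space ?L" "y \<in> space ?L"
    have "(\<lambda>i\<in>{..<n}. s * x i + t * y i) \<in> C" if "x \<in> A" "y \<in> B"
      using AB[OF that] by (auto simp: C_def s_def t_def space_PiM)
    then show "indicator A x powr \<theta> * indicator B y powr (1 - \<theta>)
        \<le> (indicator C (\<lambda>i\<in>{..<n}. s * x i + t * y i) :: real)"
      by (auto simp: indicator_def)
  qed (use \<open>s > 0\<close> \<open>t > 0\<close> \<theta>(1,2) in auto)
  then have pl: "c ^ n * (measure ?L A powr \<theta> * measure ?L B powr (1 - \<theta>)) \<le> measure ?L C"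
    using A B C by simp
  have "c ^ n * (((Q * gX) ^ n / 4) powr \<theta> * (gY ^ n / 2) powr (1 - \<theta>))
      \<le> c ^ n * (measure ?L A powr \<theta> * measure ?L B powr (1 - \<theta>))"
    using LA LB \<theta>(1,2) g_pos \<open>c > 0\<close> \<open>Q > 0\<close> by (intro mult_left_mono mult_mono powr_mono2) auto
  also have "\<dots> \<le> gC ^ n" using pl LC by linarith
  finally have "ln (c ^ n * (((Q * gX) ^ n / 4) powr \<theta> * (gY ^ n / 2) powr (1 - \<theta>))) \<le> ln (gC ^ n)"
    using g_pos \<open>c > 0\<close> \<open>Q > 0\<close> by (intro ln_mono) auto
  also have "ln (c ^ n * (((Q * gX) ^ n / 4) powr \<theta> * (gY ^ n / 2) powr (1 - \<theta>)))
      = real n * ln c + (\<theta> * (real n * (ln Q + ln gX) - ln 4) + (1 - \<theta>) * (real n * ln gY - ln 2))"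
    using g_pos \<open>c > 0\<close> \<open>Q > 0\<close> by (simp add: ln_mult ln_div ln_realpow ln_powr)
  also have "ln (gC ^ n) = real n * ln gC" using g_pos by (simp add: ln_realpow)
  finally have 1: "real n * ln c + (\<theta> * (real n * (ln Q + ln gX) - ln 4) + (1 - \<theta>) * (real n * ln gY - ln 2))
      \<le> real n * ln gC" .
  have ln_g: "ln gX = ln (sqrt (2 * pi)) + ln \<sigma>X + (1 - \<delta>) / 2" "ln gY = ln (sqrt (2 * pi)) + ln \<sigma>Y + (1 - \<delta>) / 2"
    "ln gC = ln (sqrt (2 * pi)) + ln v / 2 + 1 / 2"
    using assms by (simp_all add: gX_def gY_def gC_def e_def ln_mult ln_sqrt)
  have ln_c: "ln c = ln (1 + p * Q) - \<theta> * (ln Q + ln \<sigma>X) - (1 - \<theta>) * ln \<sigma>Y"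
  proof -
    have pQ1: "0 < 1 + p * Q" "1 + p * Q \<noteq> 0" using \<open>p * Q > 0\<close> by linarith+
    have "ln c = \<theta> * ln (s / \<theta>) + (1 - \<theta>) * ln (t / (1 - \<theta>))"
      unfolding c_def using \<open>s > 0\<close> \<open>t > 0\<close> \<theta>(1,2) by (simp add: ln_mult ln_powr)
    also have "ln (s / \<theta>) = ln (1 + p * Q) - (ln Q + ln \<sigma>X)"
      unfolding s\<theta> using \<open>Q > 0\<close> \<open>\<sigma>X > 0\<close> pQ1 by (simp add: ln_div ln_mult)
    also have "ln (t / (1 - \<theta>)) = ln (1 + p * Q) - ln \<sigma>Y"
      unfolding t\<theta> using \<open>\<sigma>Y > 0\<close> pQ1 by (simp add: ln_div)
    finally show ?thesis by (simp add: algebra_simps)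
  qed
  have "real n * ln c + (\<theta> * (real n * (ln Q + ln gX) - ln 4) + (1 - \<theta>) * (real n * ln gY - ln 2))
      = real n * (ln (1 + p * Q) + ln (sqrt (2 * pi)) + (1 - \<delta>) / 2) - (\<theta> * ln 4 + (1 - \<theta>) * ln 2)"
    unfolding ln_c ln_g by (simp add: algebra_simps add_divide_distrib diff_divide_distrib)
  with 1 have "real n * (ln (1 + p * Q) + ln (sqrt (2 * pi)) + (1 - \<delta>) / 2) - (\<theta> * ln 4 + (1 - \<theta>) * ln 2)
      \<le> real n * (ln (sqrt (2 * pi)) + ln v / 2 + 1 / 2)" unfolding ln_g by simp
  \<comment> \<open>The factors 1/4 and 1/2 in the measures of \<open>A\<close> and \<open>B\<close>
    together cost at most \<open>ln 4\<close>, which vanishes after division by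
    \<open>n\<close>.\<close>
  moreover have "\<theta> * ln 4 + (1 - \<theta>) * ln 2 \<le> \<theta> * ln 4 + (1 - \<theta>) * ln (4::real)"
    using \<theta>(1,2) by (intro add_left_mono mult_left_mono) auto
  ultimately have "real n * (ln (1 + p * Q) - \<delta> / 2 - ln v / 2) \<le> ln 4"
    by (simp add: algebra_simps add_divide_distrib diff_divide_distrib)
  then have "ln (1 + p * Q) - \<delta> / 2 - ln v / 2 \<le> ln 4 / real n"
    using \<open>n > 0\<close> by (simp add: pos_le_divide_eq mult.commute)
  then show ?thesis by linarith
qed

section \<open>Averaging over the indices of a system\<close>

lemma
  shows finite_indices: "finite (indices R n)"
    and card_indices_le: "real (card (indices R n)) \<le> 2 powr (real n * R)"
proof -
  have eq: "indices R n = {1..nat \<lfloor>2 powr (real n * R)\<rfloor>}"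
    by (auto simp: indices_def le_nat_iff le_floor_iff)
  show "finite (indices R n)" unfolding eq by simp
  have "real (nat \<lfloor>2 powr (real n * R)\<rfloor>) \<le> 2 powr (real n * R)" by simp
  then show "real (card (indices R n)) \<le> 2 powr (real n * R)" unfolding eq by simp
qed

text \<open>If every index failed one of the two bounds, the product cells would have total measure
  at most \<open>1/4 + 1/2\<close>; but they carry all pairs that are typical and answered by
  \<open>No\<close>, of measure above 3/4.\<close>

lemma large_cell:
  assumes sys: "id_system R n T g" and "prob_space PX" "prob_space PY" and PX: "sets PX = sets borel" and PY: "sets PY = sets borel"
    and A: "A \<in> sets (Rvec n)" and B: "B \<in> sets (Rvec n)"
    and small: "measure (\<Pi>\<^sub>M i\<in>{..<n}. PX) (space (Rvec n) - A) + measure (\<Pi>\<^sub>M i\<in>{..<n}. PY) (space (Rvec n) - B)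
      + maybe_prob PX PY n T g < 1 / 4"
  shows "\<exists>i. {x \<in> A. T x = i} \<in> sets (Rvec n) \<and> {y \<in> B. g i y = No} \<in> sets (Rvec n) \<and>
    (2 powr (- R)) ^ n / 4 \<le> measure (\<Pi>\<^sub>M i\<in>{..<n}. PX) {x \<in> A. T x = i} \<and>
    1 / 2 \<le> measure (\<Pi>\<^sub>M i\<in>{..<n}. PY) {y \<in> B. g i y = No}"
proof (rule ccontr)
  assume contr: "\<not> ?thesis"
  let ?X = "\<Pi>\<^sub>M i\<in>{..<n}. PX" and ?Y = "\<Pi>\<^sub>M i\<in>{..<n}. PY"
  interpret X: prob_space ?X using \<open>prob_space PX\<close> by (intro prob_space_PiM)
  interpret Y: prob_space ?Y using \<open>prob_space PY\<close> by (intro prob_space_PiM)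
  interpret XY: pair_prob_space ?X ?Y by unfold_locales
  note X_eq = space_PiM_real[OF PX, of "{..<n}"] and Y_eq = space_PiM_real[OF PY, of "{..<n}"]
  let ?I = "indices R n"
  define q where "q = (2 powr (- R)) ^ n"
  have card: "real (card ?I) * q \<le> 1"
  proof -
    have "real (card ?I) * q \<le> 2 powr (real n * R) * q"
      using card_indices_le[where R=R and n=n] by (intro mult_right_mono) (auto simp: q_def)
    also have "\<dots> = 1" by (simp add: q_def powr_realpow[symmetric] powr_powr powr_add[symmetric] mult.commute)
    finally show ?thesis .
  qed
  have T: "T \<in> Rvec n \<rightarrow>\<^sub>M count_space ?I"
    and g: "(\<lambda>(i, y). g i y) \<in> count_space ?I \<Otimes>\<^sub>M Rvec n \<rightarrow>\<^sub>M count_space UNIV"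
    using sys by (auto simp: id_system_def)
  define Ai where "Ai i = {x \<in> A. T x = i}" for i
  define Bi where "Bi i = {y \<in> B. g i y = No}" for i
  have A_sub: "A \<subseteq> space (Rvec n)" and B_sub: "B \<subseteq> space (Rvec n)"
    using A B sets.sets_into_space by blast+
  have Ai: "Ai i \<in> sets (Rvec n)" if "i \<in> ?I" for i
  proof -
    have "T -` {i} \<inter> space (Rvec n) \<in> sets (Rvec n)" using T that by (intro measurable_sets[of T]) auto
    moreover have "Ai i = A \<inter> (T -` {i} \<inter> space (Rvec n))" using A_sub by (auto simp: Ai_def)
    ultimately show ?thesis using A by simp
  qed
  have Bi: "Bi i \<in> sets (Rvec n)" if "i \<in> ?I" for i
  proof -
    have "(\<lambda>y. (i, y)) \<in> Rvec n \<rightarrow>\<^sub>M count_space ?I \<Otimes>\<^sub>M Rvec n" using that by (intro measurable_Pair1') simp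
    from measurable_comp[OF this g] have "g i \<in> Rvec n \<rightarrow>\<^sub>M count_space UNIV" by (simp add: comp_def)
    then have "g i -` {No} \<inter> space (Rvec n) \<in> sets (Rvec n)" by (rule measurable_sets) simp
    moreover have "Bi i = B \<inter> (g i -` {No} \<inter> space (Rvec n))" using B_sub by (auto simp: Bi_def)
    ultimately show ?thesis using B by simp
  qed
  define S where "S = {(x, y) \<in> space (?X \<Otimes>\<^sub>M ?Y). g (T x) y = Maybe}"
  have S: "S \<in> sets (?X \<Otimes>\<^sub>M ?Y)" unfolding S_def by (rule answer_set_measurable[OF sys PX PY])
  have S_prob: "measure (?X \<Otimes>\<^sub>M ?Y) S = maybe_prob PX PY n T g" by (simp add: S_def maybe_prob_def Let_def)
  have times: "measure (?X \<Otimes>\<^sub>M ?Y) (E \<times> F) = measure ?X E * measure ?Y F"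
    if "E \<in> sets (Rvec n)" "F \<in> sets (Rvec n)" for E F
    using that by (simp add: measure_def Y.emeasure_pair_measure_Times X_eq Y_eq enn2real_mult)
  have rect: "E \<times> F \<in> sets (?X \<Otimes>\<^sub>M ?Y)" if "E \<in> sets (Rvec n)" "F \<in> sets (Rvec n)" for E F
    using that by (intro pair_measureI) (simp_all add: X_eq Y_eq)
  have top: "space (Rvec n) \<in> sets (Rvec n)" by simp
  have Ac: "space (Rvec n) - A \<in> sets (Rvec n)" "space (Rvec n) - B \<in> sets (Rvec n)" using A B by auto
  have sp1: "measure ?X (space (Rvec n)) = 1" "measure ?Y (space (Rvec n)) = 1"
    using X.prob_space Y.prob_space by (simp_all add: X_eq Y_eq)
  have T_in: "T x \<in> ?I" if "x \<in> space (Rvec n)" for x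
    using measurable_space[OF T that] by simp
  \<comment> \<open>Pairs with an atypical component or the answer \<open>Maybe\<close>; every other
    pair lies in the product cell of its index.\<close>
  let ?bad = "(space (Rvec n) - A) \<times> space (Rvec n) \<union> space (Rvec n) \<times> (space (Rvec n) - B) \<union> S"
  have sub: "space (?X \<Otimes>\<^sub>M ?Y) \<subseteq> ?bad \<union> (\<Union>i\<in>?I. Ai i \<times> Bi i)"
  proof
    fix z assume z: "z \<in> space (?X \<Otimes>\<^sub>M ?Y)"
    obtain x y where xy: "z = (x, y)" by (cases z)
    then have "x \<in> space (Rvec n)" "y \<in> space (Rvec n)" using z by (simp_all add: space_pair_measure X_eq Y_eq)
    then show "z \<in> ?bad \<union> (\<Union>i\<in>?I. Ai i \<times> Bi i)"
      using z T_in[of x] unfolding xy by (cases "g (T x) y") (auto simp: S_def Ai_def Bi_def)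
  qed
  have fin: "finite ?I" by (rule finite_indices)
  have cells: "(\<Union>i\<in>?I. Ai i \<times> Bi i) \<in> sets (?X \<Otimes>\<^sub>M ?Y)" using fin Ai Bi by (intro sets.finite_UN rect) auto
  have bad: "?bad \<in> sets (?X \<Otimes>\<^sub>M ?Y)" using Ac top S by (intro sets.Un rect) auto
  have "1 \<le> measure (?X \<Otimes>\<^sub>M ?Y) (?bad \<union> (\<Union>i\<in>?I. Ai i \<times> Bi i))"
    using XY.finite_measure_mono[OF sub sets.Un[OF bad cells]] by (simp only: XY.prob_space)
  also have "\<dots> \<le> measure (?X \<Otimes>\<^sub>M ?Y) ?bad + measure (?X \<Otimes>\<^sub>M ?Y) (\<Union>i\<in>?I. Ai i \<times> Bi i)"
    using bad cells by (rule measure_Un_le)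
  also have "measure (?X \<Otimes>\<^sub>M ?Y) ?bad \<le> measure (?X \<Otimes>\<^sub>M ?Y) ((space (Rvec n) - A) \<times> space (Rvec n) \<union> space (Rvec n) \<times> (space (Rvec n) - B))
      + measure (?X \<Otimes>\<^sub>M ?Y) S"
    using Ac top S by (intro measure_Un_le sets.Un rect) auto
  also have "measure (?X \<Otimes>\<^sub>M ?Y) ((space (Rvec n) - A) \<times> space (Rvec n) \<union> space (Rvec n) \<times> (space (Rvec n) - B))
      \<le> measure (?X \<Otimes>\<^sub>M ?Y) ((space (Rvec n) - A) \<times> space (Rvec n)) + measure (?X \<Otimes>\<^sub>M ?Y) (space (Rvec n) \<times> (space (Rvec n) - B))"
    using Ac top by (intro measure_Un_le rect) auto
  finally have "1 - 1 / 4 < measure (?X \<Otimes>\<^sub>M ?Y) (\<Union>i\<in>?I. Ai i \<times> Bi i)"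
    using small by (simp add: times Ac top sp1 S_prob)
  also have "\<dots> \<le> (\<Sum>i\<in>?I. measure (?X \<Otimes>\<^sub>M ?Y) (Ai i \<times> Bi i))"
    using fin Ai Bi by (intro XY.finite_measure_subadditive_finite) (auto intro: rect)
  \<comment> \<open>One summand for each way of failing. The first sums to at most 1/4 because there
    are at most \<open>1 / q\<close> indices, the second to at most 1/2 because the cells are
    disjoint.\<close>
  also have "\<dots> \<le> (\<Sum>i\<in>?I. q / 4 + measure ?X (Ai i) / 2)"
  proof (rule sum_mono)
    fix i assume i: "i \<in> ?I"
    have "measure ?X (Ai i) < q / 4 \<or> measure ?Y (Bi i) < 1 / 2"
      using contr Ai[OF i] Bi[OF i] unfolding Ai_def Bi_def q_def by (meson not_le)
    then have "measure ?X (Ai i) * measure ?Y (Bi i) \<le> q / 4 + measure ?X (Ai i) / 2"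
    proof
      assume "measure ?X (Ai i) < q / 4"
      moreover have "measure ?X (Ai i) * measure ?Y (Bi i) \<le> measure ?X (Ai i) * 1"
        by (intro mult_left_mono Y.prob_le_1) simp
      moreover have "0 \<le> measure ?X (Ai i)" by simp
      ultimately show ?thesis by linarith
    next
      assume "measure ?Y (Bi i) < 1 / 2"
      then have "measure ?X (Ai i) * measure ?Y (Bi i) \<le> measure ?X (Ai i) * (1 / 2)"
        by (intro mult_left_mono) auto
      moreover have "0 \<le> q" by (simp add: q_def)
      ultimately show ?thesis by simp
    qed
    then show "measure (?X \<Otimes>\<^sub>M ?Y) (Ai i \<times> Bi i) \<le> q / 4 + measure ?X (Ai i) / 2"
      using times[OF Ai[OF i] Bi[OF i]] by simp
  qed
  also have "\<dots> = real (card ?I) * q / 4 + (\<Sum>i\<in>?I. measure ?X (Ai i)) / 2"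
    by (simp add: sum.distrib sum_divide_distrib)
  also have "(\<Sum>i\<in>?I. measure ?X (Ai i)) = measure ?X (\<Union>i\<in>?I. Ai i)"
    using fin Ai by (intro X.finite_measure_finite_Union[symmetric]) (auto simp: disjoint_family_on_def Ai_def X_eq)
  also have "\<dots> \<le> 1" by (rule X.prob_le_1)
  finally show False using card by simp
qed

text \<open>At blocklength 1 a negative rate leaves no index at all, while \<open>T\<close> must
  take a value.\<close>

lemma achievable_nonneg_rate:
  assumes "achievable D PX PY R"
  shows "0 \<le> R"
proof -
  obtain T g where "admissible_systems D R T g" using assms unfolding achievable_def by blast
  then have T: "T 1 \<in> Rvec 1 \<rightarrow>\<^sub>M count_space (indices R 1)"
    unfolding admissible_systems_def id_system_def by auto
  have "(\<lambda>i\<in>{..<1}. 0) \<in> space (Rvec 1)" by (simp add: space_PiM)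
  from measurable_space[OF T this] have "1 \<le> 2 powr R" by (auto simp: indices_def intro: order_trans[rotated])
  then have "2 powr 0 \<le> 2 powr R" by simp
  then show ?thesis by (subst (asm) powr_le_cancel_iff) auto
qed

text \<open>If \<open>k < Q\<close>, a suitable \<open>p\<close> makes the sum set fit into a ball
  smaller than its volume allows; \<delta> and then \<open>n\<close> are chosen so that the error
  terms do not close the gap.\<close>

lemma gaussian_converse:
  fixes \<sigma>X \<sigma>Y D R :: real
  assumes "\<sigma>X > 0" "\<sigma>Y > 0" and ach: "achievable D (gaussian 0 (\<sigma>X\<^sup>2)) (gaussian 0 (\<sigma>Y\<^sup>2)) R"
  shows "2 powr (- R) \<le> (\<sigma>X\<^sup>2 + \<sigma>Y\<^sup>2 - D) / (2 * \<sigma>X * \<sigma>Y)"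
proof (rule ccontr)
  define k where "k = (\<sigma>X\<^sup>2 + \<sigma>Y\<^sup>2 - D) / (2 * \<sigma>X * \<sigma>Y)"
  define Q where "Q = 2 powr (- R)"
  define P where "P = \<sigma>X * \<sigma>Y"
  define W where "W = \<sigma>X\<^sup>2 + \<sigma>Y\<^sup>2"
  assume "\<not> ?thesis"
  then have "k < Q" by (simp add: k_def Q_def)
  have "Q > 0" by (simp add: Q_def)
  have "P > 0" using assms(1,2) by (simp add: P_def)
  have Pk: "W - D = 2 * (P * k)" using assms(1,2) by (simp add: P_def W_def k_def)
  \<comment> \<open>\<open>p \<le> Q - k\<close> makes \<open>p\<close> times the gap outweigh the
    quadratic error, and \<open>p \<le> 1\<close> keeps \<open>w\<close> positive even if
    \<open>k\<close> is negative, as happens for large \<open>D\<close>.\<close>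
  define p where "p = min 1 (Q - k)"
  have "p > 0" "p \<le> 1" "k \<le> Q - p" using \<open>k < Q\<close> by (auto simp: p_def)
  \<comment> \<open>The bound on the squared norm of the sum for exact lengths:
    \<open>1 + 2 * p * k + p^2 \<le> w\<close>, because \<open>k \<le> Q - p\<close>.\<close>
  define w where "w = 1 + 2 * (p * Q) - p\<^sup>2"
  have "p\<^sup>2 \<le> 1" using \<open>p > 0\<close> \<open>p \<le> 1\<close> by (simp add: power_le_one)
  have "p * Q > 0" using \<open>p > 0\<close> \<open>Q > 0\<close> by simp
  then have "w > 0" using \<open>p\<^sup>2 \<le> 1\<close> unfolding w_def by linarith
  have w_less: "w < (1 + p * Q)\<^sup>2"
  proof -
    have "(1 + p * Q)\<^sup>2 = 1 + 2 * (p * Q) + (p * Q)\<^sup>2" by (simp add: power2_sum)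
    moreover have "(p * Q)\<^sup>2 > 0" "p\<^sup>2 > 0" using \<open>p * Q > 0\<close> \<open>p > 0\<close> zero_less_power by blast+
    ultimately show ?thesis unfolding w_def by linarith
  qed
  \<comment> \<open>The coefficient of \<delta> in the same bound when the squared lengths may be
    off by a factor \<open>1 + \<delta>\<close>.\<close>
  define K where "K = 1 + p\<^sup>2 + p * W / P"
  have "K > 0" unfolding K_def W_def using \<open>p > 0\<close> \<open>P > 0\<close> by (intro add_pos_nonneg) auto
  have "((\<lambda>\<delta>. \<delta> / 2 + ln (w + \<delta> * K) / 2) \<longlongrightarrow> 0 / 2 + ln (w + 0 * K) / 2) (at_right 0)"
    using \<open>w > 0\<close> by (intro tendsto_intros) auto
  moreover have "0 / 2 + ln (w + 0 * K) / 2 < ln (1 + p * Q)"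
  proof -
    have "ln w < ln ((1 + p * Q)\<^sup>2)" using ln_less_cancel_iff[OF \<open>w > 0\<close>, of "(1 + p * Q)\<^sup>2"] w_less \<open>w > 0\<close> by linarith
    also have "\<dots> = 2 * ln (1 + p * Q)" using \<open>p * Q > 0\<close> by (simp add: ln_realpow)
    finally show ?thesis by simp
  qed
  ultimately have "eventually (\<lambda>\<delta>. \<delta> / 2 + ln (w + \<delta> * K) / 2 < ln (1 + p * Q)) (at_right 0)"
    by (rule order_tendstoD(2))
  then have "eventually (\<lambda>\<delta>. \<delta> / 2 + ln (w + \<delta> * K) / 2 < ln (1 + p * Q) \<and> 0 < \<delta>) (at_right 0)"
    using eventually_at_right_less by (rule eventually_conj)
  then have "\<exists>\<delta>. \<delta> / 2 + ln (w + \<delta> * K) / 2 < ln (1 + p * Q) \<and> 0 < \<delta>"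
    by (rule eventually_happens'[rotated]) simp
  then obtain \<delta> where "\<delta> > 0" and \<delta>: "\<delta> / 2 + ln (w + \<delta> * K) / 2 < ln (1 + p * Q)"
    by blast
  define v where "v = w + \<delta> * K"
  have "v > 0" unfolding v_def using \<open>w > 0\<close> \<open>\<delta> > 0\<close> \<open>K > 0\<close> by (simp add: add_pos_pos)
  let ?PX = "gaussian 0 (\<sigma>X\<^sup>2)" and ?PY = "gaussian 0 (\<sigma>Y\<^sup>2)"
  obtain T g where sys: "admissible_systems D R T g"
    and lim: "(\<lambda>n. maybe_prob ?PX ?PY n (T n) (g n)) \<longlonglongrightarrow> 0"
    using ach unfolding achievable_def by blast
  define A where "A n = {x \<in> space (Rvec n). \<bar>(\<Sum>i<n. (x i)\<^sup>2) - real n * \<sigma>X\<^sup>2\<bar> < real n * (\<sigma>X\<^sup>2 * \<delta>)}" for n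
  define B where "B n = {y \<in> space (Rvec n). \<bar>(\<Sum>i<n. (y i)\<^sup>2) - real n * \<sigma>Y\<^sup>2\<bar> < real n * (\<sigma>Y\<^sup>2 * \<delta>)}" for n
  have AB: "A n \<in> sets (Rvec n)" "B n \<in> sets (Rvec n)" for n unfolding A_def B_def by measurable
  have typical: "(\<lambda>n. measure (\<Pi>\<^sub>M i\<in>{..<n}. gaussian 0 (\<sigma>\<^sup>2)) (space (Rvec n) - {x \<in> space (Rvec n).
        \<bar>(\<Sum>i<n. (x i)\<^sup>2) - real n * \<sigma>\<^sup>2\<bar> < real n * (\<sigma>\<^sup>2 * \<delta>)})) \<longlonglongrightarrow> 0" if "\<sigma> > 0" for \<sigma>
    using gaussian_moment_2[of "\<sigma>\<^sup>2" 0] that \<open>\<delta> > 0\<close>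
    by (intro weak_law_sum_squares prob_space_gaussian) auto
  have "(\<lambda>n. measure (\<Pi>\<^sub>M i\<in>{..<n}. ?PX) (space (Rvec n) - A n) + measure (\<Pi>\<^sub>M i\<in>{..<n}. ?PY) (space (Rvec n) - B n)
      + maybe_prob ?PX ?PY n (T n) (g n)) \<longlonglongrightarrow> 0 + 0 + 0"
    unfolding A_def B_def by (intro tendsto_add typical lim assms)
  then have ev1: "eventually (\<lambda>n. measure (\<Pi>\<^sub>M i\<in>{..<n}. ?PX) (space (Rvec n) - A n)
      + measure (\<Pi>\<^sub>M i\<in>{..<n}. ?PY) (space (Rvec n) - B n) + maybe_prob ?PX ?PY n (T n) (g n) < 1 / 4) sequentially"
    by (rule order_tendstoD(2)) simp
  have "(\<lambda>n. \<delta> / 2 + ln 4 * (1 / real n) + ln v / 2) \<longlonglongrightarrow> \<delta> / 2 + ln 4 * 0 + ln v / 2"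
    by (intro tendsto_intros lim_1_over_n)
  then have ev2: "eventually (\<lambda>n. \<delta> / 2 + ln 4 * (1 / real n) + ln v / 2 < ln (1 + p * Q)) sequentially"
    by (rule order_tendstoD(2)) (use \<delta> in \<open>simp add: v_def\<close>)
  have "eventually (\<lambda>n. False) sequentially"
    using ev1 ev2 eventually_gt_at_top[of 0]
  proof eventually_elim
    case (elim n)
    have id: "id_system R n (T n) (g n)" and adm: "admissible D n (T n) (g n)"
      using sys elim(3) unfolding admissible_systems_def by auto
    have pX: "prob_space ?PX" and pY: "prob_space ?PY"
      using assms(1,2) by (simp_all add: prob_space_gaussian)
    obtain i where i: "{x \<in> A n. T n x = i} \<in> sets (Rvec n)" "{y \<in> B n. g n i y = No} \<in> sets (Rvec n)"
      "Q ^ n / 4 \<le> measure (\<Pi>\<^sub>M i\<in>{..<n}. ?PX) {x \<in> A n. T n x = i}"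
      "1 / 2 \<le> measure (\<Pi>\<^sub>M i\<in>{..<n}. ?PY) {y \<in> B n. g n i y = No}"
      using large_cell[OF id pX pY sets_gaussian sets_gaussian AB elim(1)] unfolding Q_def by blast
    have lb: "sets (\<Pi>\<^sub>M i\<in>{..<n}. lborel) = sets (Rvec n)" by (intro sets_PiM_cong) auto
    have bounds: "real n * (\<sigma>\<^sup>2 * (1 - \<delta>)) \<le> (\<Sum>i<n. (x i)\<^sup>2)" "(\<Sum>i<n. (x i)\<^sup>2) \<le> real n * (\<sigma>\<^sup>2 * (1 + \<delta>))"
      if "\<bar>(\<Sum>i<n. (x i)\<^sup>2) - real n * \<sigma>\<^sup>2\<bar> < real n * (\<sigma>\<^sup>2 * \<delta>)" for x and \<sigma> :: real
    proof -
      define S a c where "S = (\<Sum>i<n. (x i)\<^sup>2)" and "a = real n * \<sigma>\<^sup>2" and "c = real n * (\<sigma>\<^sup>2 * \<delta>)"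
      have eq: "real n * (\<sigma>\<^sup>2 * (1 - \<delta>)) = a - c" "real n * (\<sigma>\<^sup>2 * (1 + \<delta>)) = a + c"
        by (simp_all add: a_def c_def algebra_simps)
      have "\<bar>S - a\<bar> < c" using that by (simp add: S_def a_def c_def)
      then show "real n * (\<sigma>\<^sup>2 * (1 - \<delta>)) \<le> (\<Sum>i<n. (x i)\<^sup>2)" "(\<Sum>i<n. (x i)\<^sup>2) \<le> real n * (\<sigma>\<^sup>2 * (1 + \<delta>))"
        unfolding eq S_def[symmetric] by linarith+
    qed
    have sum_le: "(\<Sum>j<n. (p / \<sigma>X * x j + 1 / \<sigma>Y * y j)\<^sup>2) \<le> real n * v"
      if x: "x \<in> {x \<in> A n. T n x = i}" and y: "y \<in> {y \<in> B n. g n i y = No}" for x y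
    proof -
      define X where "X = (\<Sum>j<n. (x j)\<^sup>2)"
      define Y where "Y = (\<Sum>j<n. (y j)\<^sup>2)"
      define Z where "Z = (\<Sum>j<n. x j * y j)"
      have X: "X \<le> real n * (\<sigma>X\<^sup>2 * (1 + \<delta>))" unfolding X_def using x by (intro bounds) (auto simp: A_def)
      have Y: "Y \<le> real n * (\<sigma>Y\<^sup>2 * (1 + \<delta>))" unfolding Y_def using y by (intro bounds) (auto simp: B_def)
      have "x \<in> space (Rvec n)" "y \<in> space (Rvec n)" "g n (T n x) y \<noteq> Maybe"
        using x y by (auto simp: A_def B_def)
      then have "D < distortion n x y" using adm unfolding admissible_def by (meson not_le)
      also have "\<dots> = (1 / real n) * (\<Sum>j<n. (x j - y j)\<^sup>2)"
        by (simp add: distortion_def L2_set_def sum_nonneg)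
      also have "(\<Sum>j<n. (x j - y j)\<^sup>2) = X + Y - 2 * Z"
        by (simp add: X_def Y_def Z_def power2_diff sum.distrib sum_subtractf sum_distrib_left mult.assoc)
      finally have "real n * D < X + Y - 2 * Z" using \<open>0 < n\<close> by (simp add: field_simps)
      then have "2 * Z \<le> real n * (\<sigma>X\<^sup>2 * (1 + \<delta>)) + real n * (\<sigma>Y\<^sup>2 * (1 + \<delta>)) - real n * D"
        using X Y by linarith
      also have "\<dots> = real n * (W - D + \<delta> * W)" by (simp add: W_def algebra_simps)
      finally have Z: "2 * Z \<le> real n * (2 * (P * k) + \<delta> * W)" unfolding Pk .
      have "(\<Sum>j<n. (p / \<sigma>X * x j + 1 / \<sigma>Y * y j)\<^sup>2)
          = (\<Sum>j<n. (p / \<sigma>X)\<^sup>2 * (x j)\<^sup>2 + (1 / \<sigma>Y)\<^sup>2 * (y j)\<^sup>2 + p / P * (2 * (x j * y j)))"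
        by (intro sum.cong) (auto simp: power2_sum power_mult_distrib power_divide P_def mult_ac)
      also have "\<dots> = (p / \<sigma>X)\<^sup>2 * X + (1 / \<sigma>Y)\<^sup>2 * Y + p / P * (2 * Z)"
        by (simp add: X_def Y_def Z_def sum.distrib sum_distrib_left)
      also have "\<dots> \<le> (p / \<sigma>X)\<^sup>2 * (real n * (\<sigma>X\<^sup>2 * (1 + \<delta>))) + (1 / \<sigma>Y)\<^sup>2 * (real n * (\<sigma>Y\<^sup>2 * (1 + \<delta>)))
          + p / P * (real n * (2 * (P * k) + \<delta> * W))"
        using X Y Z \<open>p > 0\<close> \<open>P > 0\<close> by (intro add_mono mult_left_mono) auto
      also have "\<dots> = real n * (p\<^sup>2 * (1 + \<delta>) + (1 + \<delta>) + (2 * (p * k) + \<delta> * (p * W / P)))"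
      proof -
        have "(p / \<sigma>X)\<^sup>2 * (real n * (\<sigma>X\<^sup>2 * (1 + \<delta>))) = real n * (p\<^sup>2 * (1 + \<delta>))"
          "(1 / \<sigma>Y)\<^sup>2 * (real n * (\<sigma>Y\<^sup>2 * (1 + \<delta>))) = real n * (1 + \<delta>)"
          using assms(1,2) by (simp_all add: power_divide)
        moreover have "p / P * (real n * (2 * (P * k) + \<delta> * W)) = real n * (2 * (p * k) + \<delta> * (p * W / P))"
          using \<open>P > 0\<close> by (simp add: field_simps)
        ultimately show ?thesis by (simp add: distrib_left)
      qed
      also have "\<dots> \<le> real n * v"
      proof (rule mult_left_mono)
        have "p * k \<le> p * (Q - p)" using \<open>p > 0\<close> \<open>k \<le> Q - p\<close> by (intro mult_left_mono) auto
        then have "2 * (p * k) \<le> 2 * (p * Q) - 2 * p\<^sup>2" by (simp add: right_diff_distrib power2_eq_square)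
        moreover have "p\<^sup>2 * (1 + \<delta>) + (1 + \<delta>) + \<delta> * (p * W / P) = 1 + p\<^sup>2 + \<delta> * K"
          by (simp add: K_def distrib_left distrib_right mult.commute)
        ultimately show "p\<^sup>2 * (1 + \<delta>) + (1 + \<delta>) + (2 * (p * k) + \<delta> * (p * W / P)) \<le> v"
          unfolding v_def w_def by linarith
      qed simp
      finally show ?thesis .
    qed
    have "ln (1 + p * Q) \<le> \<delta> / 2 + ln 4 / real n + ln v / 2"
    proof (rule gaussian_expansion[OF \<open>0 < n\<close> assms(1,2) \<open>v > 0\<close> \<open>p > 0\<close> \<open>Q > 0\<close> _ _ _ _ _ _ sum_le i(3,4)])
      show "{x \<in> A n. T n x = i} \<in> sets (\<Pi>\<^sub>M i\<in>{..<n}. lborel)" "{y \<in> B n. g n i y = No} \<in> sets (\<Pi>\<^sub>M i\<in>{..<n}. lborel)"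
        using i(1,2) unfolding lb .
      show "real n * (\<sigma>X\<^sup>2 * (1 - \<delta>)) \<le> (\<Sum>i<n. (x i)\<^sup>2)" "(\<Sum>i<n. (x i)\<^sup>2) \<le> real n * (\<sigma>X\<^sup>2 * (1 + \<delta>))"
        if "x \<in> {x \<in> A n. T n x = i}" for x
        using that by (auto simp: A_def intro!: bounds)
      show "real n * (\<sigma>Y\<^sup>2 * (1 - \<delta>)) \<le> (\<Sum>i<n. (y i)\<^sup>2)" "(\<Sum>i<n. (y i)\<^sup>2) \<le> real n * (\<sigma>Y\<^sup>2 * (1 + \<delta>))"
        if "y \<in> {y \<in> B n. g n i y = No}" for y
        using that by (auto simp: B_def intro!: bounds)
    qed
    then show False using elim(2) by simp
  qed
  then show False by simp
qed

theorem mainTheorem5: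
  fixes \<sigma>X \<sigma>Y D R :: real
  assumes "\<sigma>X > 0" and "\<sigma>Y > 0" and "D \<ge> 0"
    and "ereal R > R_ID D (gaussian 0 (\<sigma>X\<^sup>2)) (gaussian 0 (\<sigma>Y\<^sup>2))"
  shows "\<exists>T g. admissible_systems D R T g \<and>
           (\<forall>PX PY. real_distribution PX \<and> has_mean_variance PX 0 (\<sigma>X\<^sup>2) \<and>
                    real_distribution PY \<and> has_mean_variance PY 0 (\<sigma>Y\<^sup>2) \<longrightarrow>
              (\<lambda>n. maybe_prob PX PY n (T n) (g n)) \<longlonglongrightarrow> 0)"
proof -
  obtain R' where R': "achievable D (gaussian 0 (\<sigma>X\<^sup>2)) (gaussian 0 (\<sigma>Y\<^sup>2)) R'" "R' < R"
    using assms(4) unfolding R_ID_def by (auto simp: Inf_less_iff)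
  have "R > 0" using achievable_nonneg_rate[OF R'(1)] R'(2) by simp
  \<comment> \<open>The converse is only a weak inequality; passing from \<open>R'\<close> to the
    larger \<open>R\<close> makes it strict, as the universal scheme requires.\<close>
  have "2 powr (- R) < 2 powr (- R')" using R'(2) by (intro powr_less_mono) auto
  also have "\<dots> \<le> (\<sigma>X\<^sup>2 + \<sigma>Y\<^sup>2 - D) / (2 * \<sigma>X * \<sigma>Y)"
    by (rule gaussian_converse[OF assms(1,2) R'(1)])
  finally show ?thesis by (rule universal_achievability[OF assms(1,2) \<open>R > 0\<close>])
qed

end
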